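(* None of the following statements can be proved in $\mathsf Z_2^{\omega}+\mathsf{IND}_0$. (1) Any function in $\mathsf{ACG}$ is differentiable at some point of the unit interval. (2) Any function in $\mathsf{ACG}^{*}$ is differentiable at some point of the unit interval. (3) The complement of $\mathsf{ACG}$ is dense in $C([0,1])$. (4) The complement of $\mathsf{ACG}^{*}$ is dense in $C([0,1])$.
   Context: Formal setting. $\mathsf{RCA}_0^{\omega}$ is Kohlenbach's base theory of higher-order Reverse Mathematics: a classical theory in the language of all finite types (type $0$ is the natural numbers, $\sigma\to\tau$ is the type of maps from type $\sigma$ to type $\tau$ objects, $1:=0\to 0$, $n+1:=n\to 0$; equality at higher types is defined pointwise from equality at type $0$), with axioms: ordered semi-ring axioms for $0,1,<,+,\times$; combinator axioms giving $\lambda$-abstraction; primitive recursion $\mathbf R_0(f,m,0)=m$, $\mathbf R_0(f,m,n+1)=f(n,\mathbf R_0(f,m,n))$ for number-valued $f$ on numbers; extensionality $x=_\rho y\to\varphi(x)=_\tau\varphi(y)$ at all types; induction for quantifier-free formulas (parameters of any type allowed); and $\mathsf{QF\text{-}AC}^{1,0}$, where $\mathsf{QF\text{-}AC}^{\sigma,\tau}$ is the schema $(\forall x^\sigma)(\exists y^\tau)A(x,y)\to(\exists Y^{\sigma\to\tau})(\forall x^\sigma)A(x,Y(x))$ for quantifier-free $A$. Reals are fast-converging Cauchy sequences of rationals ($|q_n-q_{n+i}|<2^{-n}$) with the usual $=_{\mathbb R},<_{\mathbb R}$; functions on reals are type $1\to1$ objects respecting $=_{\mathbb R}$. A set of reals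 is given by its characteristic function (a sequence of sets by a function of a real and a number). $O$ is open if for each $x\in O$ some ball $B(x,2^{-k})$ is contained in $O$ (no further representation is given), relative to $[0,1]$ for subsets of $[0,1]$; a set is closed if its complement is open. For $k\ge1$, $(\mathsf S_k^2)$ is the axiom stating that there is a functional $\mathsf S_k^2:\mathbb N^{\mathbb N}\to\{0,1\}$ deciding the truth of $\Sigma_k^1$-formulas of second-order arithmetic (parameters in $\mathbb N$ and $\mathbb N^{\mathbb N}$ only); for $k=1$: $\mathsf S^2(f)=0\leftrightarrow(\exists g\in\mathbb N^{\mathbb N})(\forall n)(f(\overline gn)=0)$, where $\overline gn$ codes $\langle g(0),\dots,g(n-1)\rangle$. $\mathsf Z_2^{\omega}$ is $\mathsf{RCA}_0^{\omega}$ together with $(\mathsf S_k^2)$ for all $k$. $\mathsf{IND}_0$: let $Y^2$ be such that for every $n\in\mathbb N$ there is at most one $f\in2^{\mathbb N}$ with $Y(f,n)=0$; then for every $k\in\mathbb N$ there is a finite sequence $w$ of length $k$ of elements of $\mathbb N^{\mathbb N}$ such that for all $m<k$: $(w(m)\in2^{\mathbb N}\wedge Y(w(m),m)=0)\leftrightarrow(\exists f\in2^{\mathbb N})(Y(f,m)=0)$. Definitions. Fix $f:[0,1]\to\mathbb R$ and $X\subset[0,1]$. $f\in\mathsf{AC}(X)$ if for every $\epsilon>0$ there is $\delta>0$ such that for any finite collection of pairwise disjoint intervals $(a_0,b_0),\dots,(a_k,b_k)$ with endpoints in $X$, $\sum_{i\le k}|a_i-b_i|<\delta\to\sum_{i\le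 k}|f(a_i)-f(b_i)|<\epsilon$. $f\in\mathsf{AC}^{*}(X)$ is the same with $|f(a_i)-f(b_i)|$ replaced by $\mathrm{osc}_f([a_i,b_i])=\sup_{x\in[a_i,b_i]}f(x)-\inf_{x\in[a_i,b_i]}f(x)$. $f\in\mathsf{ACG}$ (resp. $\mathsf{ACG}^{*}$) if $f$ is continuous on $[0,1]$ and there is a sequence of closed sets $(C_n)_{n\in\mathbb N}$ with $[0,1]=\bigcup_nC_n$ such that $f$ is $\mathsf{AC}(C_n)$ (resp. $\mathsf{AC}^{*}(C_n)$) for each $n$. $C([0,1])$ is the space of continuous functions $[0,1]\to\mathbb R$ with the supremum norm; density of a complement means that every continuous function is uniformly approximated arbitrarily well by continuous functions not in the class. *)

theory Defs
  imports Main
begin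

section \<open>The language of all finite types\<close>

datatype ty = Ty0  ("\<zero>") | Arr ty ty  (infixr "\<rightarrow>" 60)

abbreviation ty1 :: ty ("\<one>") where "\<one> \<equiv> \<zero> \<rightarrow> \<zero>"
abbreviation ty2 :: ty ("\<two>") where "\<two> \<equiv> \<one> \<rightarrow> \<zero>"

text \<open>
  Variables are de Bruijn indices; their types are recorded in a context, whose head is the type
  of index 0. The combinators carry their types: \<^term>\<open>Kc \<rho> \<tau>\<close> and \<^term>\<open>Sc \<delta> \<rho> \<tau>\<close> are
  Kohlenbach's projector and substitutor.
\<close>

datatype tm =
    Var nat
  | Zero | One | Plus | Times
  | Kc ty ty
  | Sc ty ty ty
  | Rec
  | App tm tm

type_synonym ctx = "ty list"

fun ty_of :: "ctx \<Rightarrow> tm \<Rightarrow> ty option" where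
  "ty_of \<Gamma> (Var n) = (if n < length \<Gamma> then Some (\<Gamma> ! n) else None)"
| "ty_of \<Gamma> Zero = Some \<zero>"
| "ty_of \<Gamma> One = Some \<zero>"
| "ty_of \<Gamma> Plus = Some (\<zero> \<rightarrow> \<zero> \<rightarrow> \<zero>)"
| "ty_of \<Gamma> Times = Some (\<zero> \<rightarrow> \<zero> \<rightarrow> \<zero>)"
| "ty_of \<Gamma> (Kc \<rho> \<tau>) = Some (\<rho> \<rightarrow> \<tau> \<rightarrow> \<rho>)"
| "ty_of \<Gamma> (Sc \<delta> \<rho> \<tau>) = Some ((\<delta> \<rightarrow> \<rho> \<rightarrow> \<tau>) \<rightarrow> (\<delta> \<rightarrow> \<rho>) \<rightarrow> \<delta> \<rightarrow> \<tau>)"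
| "ty_of \<Gamma> Rec = Some ((\<zero> \<rightarrow> \<zero> \<rightarrow> \<zero>) \<rightarrow> \<zero> \<rightarrow> \<zero> \<rightarrow> \<zero>)"
| "ty_of \<Gamma> (App s t) =
    (case ty_of \<Gamma> s of
       Some (\<sigma> \<rightarrow> \<tau>) \<Rightarrow> (if ty_of \<Gamma> t = Some \<sigma> then Some \<tau> else None)
     | _ \<Rightarrow> None)"

text \<open>
  The only prime formulas are equalities and inequalities between terms of type \<^term>\<open>\<zero>\<close>; the remaining
  connectives and the existential quantifier are defined classically.
\<close>

datatype fm =
    Eq tm tm
  | Less tm tm
  | Fls
  | Imp fm fm
  | Forall ty fm

abbreviation Neg :: "fm \<Rightarrow> fm" where "Neg \<phi> \<equiv> Imp \<phi> Fls"
abbreviation Exists :: "ty \<Rightarrow> fm \<Rightarrow> fm" where "Exists \<tau> \<phi> \<equiv> Neg (Forall \<tau> (Neg \<phi>))"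

fun wff :: "ctx \<Rightarrow> fm \<Rightarrow> bool" where
  "wff \<Gamma> (Eq s t) \<longleftrightarrow> ty_of \<Gamma> s = Some \<zero> \<and> ty_of \<Gamma> t = Some \<zero>"
| "wff \<Gamma> (Less s t) \<longleftrightarrow> ty_of \<Gamma> s = Some \<zero> \<and> ty_of \<Gamma> t = Some \<zero>"
| "wff \<Gamma> Fls \<longleftrightarrow> True"
| "wff \<Gamma> (Imp \<phi> \<psi>) \<longleftrightarrow> wff \<Gamma> \<phi> \<and> wff \<Gamma> \<psi>"
| "wff \<Gamma> (Forall \<tau> \<phi>) \<longleftrightarrow> wff (\<tau> # \<Gamma>) \<phi>"

fun qfree :: "fm \<Rightarrow> bool" where
  "qfree (Imp \<phi> \<psi>) \<longleftrightarrow> qfree \<phi> \<and> qfree \<psi>"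
| "qfree (Forall \<tau> \<phi>) \<longleftrightarrow> False"
| "qfree _ \<longleftrightarrow> True"

fun tsubst :: "(nat \<Rightarrow> tm) \<Rightarrow> tm \<Rightarrow> tm" where
  "tsubst \<theta> (Var n) = \<theta> n"
| "tsubst \<theta> (App s t) = App (tsubst \<theta> s) (tsubst \<theta> t)"
| "tsubst \<theta> c = c"

definition up :: "(nat \<Rightarrow> tm) \<Rightarrow> nat \<Rightarrow> tm" where
  "up \<theta> n = (case n of 0 \<Rightarrow> Var 0 | Suc m \<Rightarrow> tsubst (\<lambda>i. Var (Suc i)) (\<theta> m))"

fun subst :: "(nat \<Rightarrow> tm) \<Rightarrow> fm \<Rightarrow> fm" where
  "subst \<theta> (Eq s t) = Eq (tsubst \<theta> s) (tsubst \<theta> t)"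
| "subst \<theta> (Less s t) = Less (tsubst \<theta> s) (tsubst \<theta> t)"
| "subst \<theta> Fls = Fls"
| "subst \<theta> (Imp \<phi> \<psi>) = Imp (subst \<theta> \<phi>) (subst \<theta> \<psi>)"
| "subst \<theta> (Forall \<tau> \<phi>) = Forall \<tau> (subst (up \<theta>) \<phi>)"

definition lift :: "fm \<Rightarrow> fm" where
  "lift = subst (\<lambda>i. Var (Suc i))"

definition inst :: "tm \<Rightarrow> fm \<Rightarrow> fm" where
  "inst t = subst (\<lambda>n. case n of 0 \<Rightarrow> t | Suc m \<Rightarrow> Var m)"

fun univ_closure :: "ctx \<Rightarrow> fm \<Rightarrow> fm" where
  "univ_closure [] \<phi> = \<phi>"
| "univ_closure (\<tau> # \<Gamma>) \<phi> = univ_closure \<Gamma> (Forall \<tau> \<phi>)"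


section \<open>Provability: classical many-sorted natural deduction with equality at type 0\<close>

text \<open>
  \<^term>\<open>derives T \<Gamma> H \<phi>\<close>: from the sentences in \<^term>\<open>T\<close> and the hypotheses \<^term>\<open>H\<close>, the formula
  \<^term>\<open>\<phi>\<close> is derivable, where free variables are typed by \<^term>\<open>\<Gamma>\<close>. Since \<^term>\<open>T\<close> consists of
  sentences, its members need no lifting in \<open>Ax\<close>.
\<close>

inductive derives :: "fm set \<Rightarrow> ctx \<Rightarrow> fm list \<Rightarrow> fm \<Rightarrow> bool" for T where
  Ax:      "\<phi> \<in> T \<Longrightarrow> wff [] \<phi> \<Longrightarrow> derives T \<Gamma> H \<phi>"
| Hyp:     "\<phi> \<in> set H \<Longrightarrow> wff \<Gamma> \<phi> \<Longrightarrow> derives T \<Gamma> H \<phi>"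
| ImpI:    "wff \<Gamma> \<phi> \<Longrightarrow> derives T \<Gamma> (\<phi> # H) \<psi> \<Longrightarrow> derives T \<Gamma> H (Imp \<phi> \<psi>)"
| ImpE:    "derives T \<Gamma> H (Imp \<phi> \<psi>) \<Longrightarrow> derives T \<Gamma> H \<phi> \<Longrightarrow> derives T \<Gamma> H \<psi>"
| RAA:     "wff \<Gamma> \<phi> \<Longrightarrow> derives T \<Gamma> (Neg \<phi> # H) Fls \<Longrightarrow> derives T \<Gamma> H \<phi>"
| ForallI: "derives T (\<tau> # \<Gamma>) (map lift H) \<phi> \<Longrightarrow> derives T \<Gamma> H (Forall \<tau> \<phi>)"
| ForallE: "derives T \<Gamma> H (Forall \<tau> \<phi>) \<Longrightarrow> ty_of \<Gamma> t = Some \<tau> \<Longrightarrow> derives T \<Gamma> H (inst t \<phi>)"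
| EqRefl:  "ty_of \<Gamma> t = Some \<zero> \<Longrightarrow> derives T \<Gamma> H (Eq t t)"
| EqSubst: "derives T \<Gamma> H (Eq s t) \<Longrightarrow> wff (\<zero> # \<Gamma>) \<phi> \<Longrightarrow> derives T \<Gamma> H (inst s \<phi>)
              \<Longrightarrow> derives T \<Gamma> H (inst t \<phi>)"

definition proves :: "fm set \<Rightarrow> fm \<Rightarrow> bool"  (infix "\<turnstile>" 45) where
  "T \<turnstile> \<phi> \<longleftrightarrow> derives T [] [] \<phi>"


section \<open>Writing formulas with named variables\<close>

text \<open>
  To avoid explicit de Bruijn indices, terms and formulas are written as functions of the context
  in which they are placed. A quantifier or abstraction binds a HOL variable to the term denoting
  the new object variable; that term computes its index from the length of the context in which it
  finally occurs. A closed formula is obtained by applying the result to the empty context.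
\<close>

type_synonym ptm = "ctx \<Rightarrow> tm"
type_synonym pfm = "ctx \<Rightarrow> fm"

definition bound :: "ctx \<Rightarrow> ptm" where
  "bound \<Gamma> = (\<lambda>\<Gamma>'. Var (length \<Gamma>' - Suc (length \<Gamma>)))"

definition pall :: "ty \<Rightarrow> (ptm \<Rightarrow> pfm) \<Rightarrow> pfm" where
  "pall \<tau> P = (\<lambda>\<Gamma>. Forall \<tau> (P (bound \<Gamma>) (\<tau> # \<Gamma>)))"

definition pex :: "ty \<Rightarrow> (ptm \<Rightarrow> pfm) \<Rightarrow> pfm" where
  "pex \<tau> P = (\<lambda>\<Gamma>. Exists \<tau> (P (bound \<Gamma>) (\<tau> # \<Gamma>)))"

syntax
  "_pall" :: "pttrn \<Rightarrow> ty \<Rightarrow> pfm \<Rightarrow> pfm"  ("(3\<^bold>\<forall>_:_./ _)" [0, 60, 10] 10)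
  "_pex" :: "pttrn \<Rightarrow> ty \<Rightarrow> pfm \<Rightarrow> pfm"  ("(3\<^bold>\<exists>_:_./ _)" [0, 60, 10] 10)
translations
  "\<^bold>\<forall>x:\<tau>. P" \<rightleftharpoons> "CONST pall \<tau> (\<lambda>x. P)"
  "\<^bold>\<exists>x:\<tau>. P" \<rightleftharpoons> "CONST pex \<tau> (\<lambda>x. P)"

definition papp :: "ptm \<Rightarrow> ptm \<Rightarrow> ptm"  (infixl "\<cdot>" 200) where
  "(s \<cdot> t) = (\<lambda>\<Gamma>. App (s \<Gamma>) (t \<Gamma>))"

definition cst :: "tm \<Rightarrow> ptm" where "cst c = (\<lambda>\<Gamma>. c)"

definition padd :: "ptm \<Rightarrow> ptm \<Rightarrow> ptm"  (infixl "\<^bold>+" 65) where "(s \<^bold>+ t) = cst Plus \<cdot> s \<cdot> t"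
definition pmul :: "ptm \<Rightarrow> ptm \<Rightarrow> ptm"  (infixl "\<^bold>*" 70) where "(s \<^bold>* t) = cst Times \<cdot> s \<cdot> t"
definition pzero :: ptm  ("\<^bold>0") where "\<^bold>0 = cst Zero"
definition pone :: ptm  ("\<^bold>1") where "\<^bold>1 = cst One"

definition peq :: "ptm \<Rightarrow> ptm \<Rightarrow> pfm"  (infix "\<^bold>=" 50) where "(s \<^bold>= t) = (\<lambda>\<Gamma>. Eq (s \<Gamma>) (t \<Gamma>))"
definition plt :: "ptm \<Rightarrow> ptm \<Rightarrow> pfm"  (infix "\<^bold><" 50) where "(s \<^bold>< t) = (\<lambda>\<Gamma>. Less (s \<Gamma>) (t \<Gamma>))"

definition pnot :: "pfm \<Rightarrow> pfm"  ("\<^bold>\<not> _" [40] 40) where "(\<^bold>\<not> P) = (\<lambda>\<Gamma>. Neg (P \<Gamma>))"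
definition pimp :: "pfm \<Rightarrow> pfm \<Rightarrow> pfm"  (infixr "\<^bold>\<longrightarrow>" 25) where
  "(P \<^bold>\<longrightarrow> Q) = (\<lambda>\<Gamma>. Imp (P \<Gamma>) (Q \<Gamma>))"
definition por :: "pfm \<Rightarrow> pfm \<Rightarrow> pfm"  (infixr "\<^bold>\<or>" 30) where "(P \<^bold>\<or> Q) = (\<^bold>\<not> P \<^bold>\<longrightarrow> Q)"
definition pand :: "pfm \<Rightarrow> pfm \<Rightarrow> pfm"  (infixr "\<^bold>\<and>" 35) where "(P \<^bold>\<and> Q) = (\<^bold>\<not> (P \<^bold>\<longrightarrow> \<^bold>\<not> Q))"
definition piff :: "pfm \<Rightarrow> pfm \<Rightarrow> pfm"  (infixr "\<^bold>\<longleftrightarrow>" 25) where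
  "(P \<^bold>\<longleftrightarrow> Q) = ((P \<^bold>\<longrightarrow> Q) \<^bold>\<and> (Q \<^bold>\<longrightarrow> P))"

definition ple :: "ptm \<Rightarrow> ptm \<Rightarrow> pfm"  (infix "\<^bold>\<le>" 50) where "(s \<^bold>\<le> t) = (s \<^bold>< t \<^bold>\<or> s \<^bold>= t)"

fun eqT :: "ty \<Rightarrow> ptm \<Rightarrow> ptm \<Rightarrow> pfm" where
  "eqT \<zero> s t = (s \<^bold>= t)"
| "eqT (\<sigma> \<rightarrow> \<tau>) s t = (\<^bold>\<forall>x:\<sigma>. eqT \<tau> (s \<cdot> x) (t \<cdot> x))"

text \<open>
  Bracket abstraction: for \<^term>\<open>t\<close> in context \<^term>\<open>\<sigma> # \<Gamma>\<close>, the term \<^term>\<open>bracket \<sigma> \<Gamma> t\<close> in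
  context \<^term>\<open>\<Gamma>\<close> denotes the \<open>\<lambda>\<close>-abstraction of \<^term>\<open>t\<close> over index 0.
\<close>

fun bracket :: "ty \<Rightarrow> ctx \<Rightarrow> tm \<Rightarrow> tm" where
  "bracket \<sigma> \<Gamma> (Var n) =
    (case n of
       0 \<Rightarrow> App (App (Sc \<sigma> (\<sigma> \<rightarrow> \<sigma>) \<sigma>) (Kc \<sigma> (\<sigma> \<rightarrow> \<sigma>))) (Kc \<sigma> \<sigma>)
     | Suc m \<Rightarrow> App (Kc (the (ty_of \<Gamma> (Var m))) \<sigma>) (Var m))"
| "bracket \<sigma> \<Gamma> (App s t) =
    App (App (Sc \<sigma> (the (ty_of (\<sigma> # \<Gamma>) t)) (the (ty_of (\<sigma> # \<Gamma>) (App s t)))) (bracket \<sigma> \<Gamma> s))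
      (bracket \<sigma> \<Gamma> t)"
| "bracket \<sigma> \<Gamma> c = App (Kc (the (ty_of \<Gamma> c)) \<sigma>) c"

definition plam :: "ty \<Rightarrow> (ptm \<Rightarrow> ptm) \<Rightarrow> ptm" where
  "plam \<sigma> F = (\<lambda>\<Gamma>. bracket \<sigma> \<Gamma> (F (bound \<Gamma>) (\<sigma> # \<Gamma>)))"

syntax
  "_plam" :: "pttrn \<Rightarrow> ty \<Rightarrow> ptm \<Rightarrow> ptm"  ("(3\<^bold>\<lambda>_:_./ _)" [0, 60, 10] 10)
translations
  "\<^bold>\<lambda>x:\<tau>. t" \<rightleftharpoons> "CONST plam \<tau> (\<lambda>x. t)"

text \<open>The usual injective coding of pairs and of finite sequences of numbers.\<close>

definition pr :: "ptm \<Rightarrow> ptm \<Rightarrow> ptm" where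
  "pr s t = (s \<^bold>+ t) \<^bold>* (s \<^bold>+ t) \<^bold>+ s"

definition pow2 :: "ptm \<Rightarrow> ptm" where
  "pow2 n = cst Rec \<cdot> (\<^bold>\<lambda>k:\<zero>. \<^bold>\<lambda>m:\<zero>. m \<^bold>+ m) \<cdot> \<^bold>1 \<cdot> n"

text \<open>
  \<^term>\<open>initseg g n\<close> codes \<open>\<langle>g 0, \<dots>, g (n - 1)\<rangle>\<close>: the empty sequence has code 0, and the extension
  of the sequence with code \<open>s\<close> by \<open>a\<close> has code \<open>pr s a + 1\<close>.
\<close>

definition initseg :: "ptm \<Rightarrow> ptm \<Rightarrow> ptm" where
  "initseg g n = cst Rec \<cdot> (\<^bold>\<lambda>k:\<zero>. \<^bold>\<lambda>s:\<zero>. pr s (g \<cdot> k) \<^bold>+ \<^bold>1) \<cdot> \<^bold>0 \<cdot> n"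


section \<open>The theory $\mathsf{RCA}_0^\omega$\<close>

definition semiring_axioms :: "fm set" where
  "semiring_axioms = (\<lambda>P. P []) `
   {\<^bold>\<forall>x:\<zero>. \<^bold>\<forall>y:\<zero>. \<^bold>\<forall>z:\<zero>. (x \<^bold>+ y) \<^bold>+ z \<^bold>= x \<^bold>+ (y \<^bold>+ z),
    \<^bold>\<forall>x:\<zero>. \<^bold>\<forall>y:\<zero>. x \<^bold>+ y \<^bold>= y \<^bold>+ x,
    \<^bold>\<forall>x:\<zero>. x \<^bold>+ \<^bold>0 \<^bold>= x,
    \<^bold>\<forall>x:\<zero>. \<^bold>\<forall>y:\<zero>. \<^bold>\<forall>z:\<zero>. (x \<^bold>* y) \<^bold>* z \<^bold>= x \<^bold>* (y \<^bold>* z),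
    \<^bold>\<forall>x:\<zero>. \<^bold>\<forall>y:\<zero>. x \<^bold>* y \<^bold>= y \<^bold>* x,
    \<^bold>\<forall>x:\<zero>. x \<^bold>* \<^bold>1 \<^bold>= x,
    \<^bold>\<forall>x:\<zero>. x \<^bold>* \<^bold>0 \<^bold>= \<^bold>0,
    \<^bold>\<forall>x:\<zero>. \<^bold>\<forall>y:\<zero>. \<^bold>\<forall>z:\<zero>. x \<^bold>* (y \<^bold>+ z) \<^bold>= x \<^bold>* y \<^bold>+ x \<^bold>* z,
    \<^bold>\<forall>x:\<zero>. \<^bold>\<not> x \<^bold>< x,
    \<^bold>\<forall>x:\<zero>. \<^bold>\<forall>y:\<zero>. \<^bold>\<forall>z:\<zero>. x \<^bold>< y \<^bold>\<longrightarrow> y \<^bold>< z \<^bold>\<longrightarrow> x \<^bold>< z,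
    \<^bold>\<forall>x:\<zero>. \<^bold>\<forall>y:\<zero>. x \<^bold>< y \<^bold>\<or> x \<^bold>= y \<^bold>\<or> y \<^bold>< x,
    \<^bold>\<forall>x:\<zero>. \<^bold>\<forall>y:\<zero>. \<^bold>\<forall>z:\<zero>. x \<^bold>< y \<^bold>\<longrightarrow> x \<^bold>+ z \<^bold>< y \<^bold>+ z,
    \<^bold>\<forall>x:\<zero>. \<^bold>\<forall>y:\<zero>. \<^bold>\<forall>z:\<zero>. \<^bold>0 \<^bold>< z \<^bold>\<longrightarrow> x \<^bold>< y \<^bold>\<longrightarrow> x \<^bold>* z \<^bold>< y \<^bold>* z,
    \<^bold>\<forall>x:\<zero>. \<^bold>0 \<^bold>\<le> x,
    \<^bold>0 \<^bold>< \<^bold>1,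
    \<^bold>\<forall>x:\<zero>. \<^bold>0 \<^bold>< x \<^bold>\<longrightarrow> \<^bold>1 \<^bold>\<le> x}"

definition combinator_axioms :: "fm set" where
  "combinator_axioms =
     {(\<^bold>\<forall>x:\<rho>. \<^bold>\<forall>y:\<tau>. eqT \<rho> (cst (Kc \<rho> \<tau>) \<cdot> x \<cdot> y) x) [] | \<rho> \<tau>. True} \<union>
     {(\<^bold>\<forall>x:\<delta> \<rightarrow> \<rho> \<rightarrow> \<tau>. \<^bold>\<forall>y:\<delta> \<rightarrow> \<rho>. \<^bold>\<forall>z:\<delta>. eqT \<tau> (cst (Sc \<delta> \<rho> \<tau>) \<cdot> x \<cdot> y \<cdot> z) (x \<cdot> z \<cdot> (y \<cdot> z))) []
      | \<delta> \<rho> \<tau>. True}"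

definition recursion_axioms :: "fm set" where
  "recursion_axioms =
     {(\<^bold>\<forall>f:\<zero> \<rightarrow> \<zero> \<rightarrow> \<zero>. \<^bold>\<forall>m:\<zero>. cst Rec \<cdot> f \<cdot> m \<cdot> \<^bold>0 \<^bold>= m) [],
      (\<^bold>\<forall>f:\<zero> \<rightarrow> \<zero> \<rightarrow> \<zero>. \<^bold>\<forall>m:\<zero>. \<^bold>\<forall>n:\<zero>.
         cst Rec \<cdot> f \<cdot> m \<cdot> (n \<^bold>+ \<^bold>1) \<^bold>= f \<cdot> n \<cdot> (cst Rec \<cdot> f \<cdot> m \<cdot> n)) []}"

definition extensionality_axioms :: "fm set" where
  "extensionality_axioms =
     {(\<^bold>\<forall>F:\<rho> \<rightarrow> \<tau>. \<^bold>\<forall>x:\<rho>. \<^bold>\<forall>y:\<rho>. eqT \<rho> x y \<^bold>\<longrightarrow> eqT \<tau> (F \<cdot> x) (F \<cdot> y)) [] | \<rho> \<tau>. True}"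

text \<open>In the schemas, the context \<^term>\<open>\<Gamma>\<close> types the parameters of \<^term>\<open>A\<close>.\<close>

definition QF_IND :: "fm set" where
  "QF_IND =
     {univ_closure \<Gamma>
        (Imp (inst Zero A)
        (Imp (Forall \<zero> (Imp A
               (subst (\<lambda>i. case i of 0 \<Rightarrow> App (App Plus (Var 0)) One | Suc j \<Rightarrow> Var (Suc j)) A)))
             (Forall \<zero> A)))
      | \<Gamma> A. wff (\<zero> # \<Gamma>) A \<and> qfree A}"

text \<open>
  In \<^term>\<open>A\<close>, index 0 is \<open>y\<close> and index 1 is \<open>x\<close>; in the scope of the quantifiers of the conclusion
  index 0 is \<open>x\<close> and index 1 is the choice functional \<open>Y\<close>, so \<open>y\<close> is replaced by \<open>Y x\<close>.
\<close>

definition QF_AC :: "ty \<Rightarrow> ty \<Rightarrow> fm set" where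
  "QF_AC \<sigma> \<tau> =
     {univ_closure \<Gamma>
        (Imp (Forall \<sigma> (Exists \<tau> A))
             (Exists (\<sigma> \<rightarrow> \<tau>) (Forall \<sigma>
               (subst (\<lambda>i. case i of
                         0 \<Rightarrow> App (Var 1) (Var 0)
                       | Suc 0 \<Rightarrow> Var 0
                       | Suc (Suc j) \<Rightarrow> Var (Suc (Suc j))) A))))
      | \<Gamma> A. wff (\<tau> # \<sigma> # \<Gamma>) A \<and> qfree A}"

definition RCA0\<omega> :: "fm set" where
  "RCA0\<omega> = semiring_axioms \<union> combinator_axioms \<union> recursion_axioms \<union> extensionality_axioms
           \<union> QF_IND \<union> QF_AC \<one> \<zero>"


section \<open>The theory $\mathsf{Z}_2^\omega + \mathsf{IND}_0$\<close>

text \<open>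
  \<open>\<Sigma>\<^sup>1\<^sub>k\<close>-formulas are taken in Kleene normal form with function parameter \<open>f\<close>:
  \<open>\<exists>g\<^sub>1 \<forall>g\<^sub>2 \<exists>g\<^sub>3 \<dots> g\<^sub>k\<close>, followed by one number quantifier continuing the alternation, applied to
  \<open>f \<langle>g\<^sub>1 | n, \<dots>, g\<^sub>k | n\<rangle> = 0\<close>. In \<open>alternate ex k gs f\<close>, \<open>gs\<close> are the functions already
  quantified (latest first), \<open>k\<close> is the number of those still to come, and \<open>ex\<close> says whether the
  next quantifier is existential.
\<close>

fun tuple :: "ptm list \<Rightarrow> ptm" where
  "tuple [] = \<^bold>0"
| "tuple [s] = s"
| "tuple (s # ss) = pr s (tuple ss)"

fun alternate :: "bool \<Rightarrow> nat \<Rightarrow> ptm list \<Rightarrow> ptm \<Rightarrow> pfm" where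
  "alternate ex 0 gs f =
     (if ex then \<^bold>\<exists>n:\<zero>. f \<cdot> tuple (map (\<lambda>g. initseg g n) (rev gs)) \<^bold>= \<^bold>0
            else \<^bold>\<forall>n:\<zero>. f \<cdot> tuple (map (\<lambda>g. initseg g n) (rev gs)) \<^bold>= \<^bold>0)"
| "alternate ex (Suc k) gs f =
     (if ex then \<^bold>\<exists>g:\<one>. alternate False k (g # gs) f
            else \<^bold>\<forall>g:\<one>. alternate True k (g # gs) f)"

definition Suslin_ax :: "nat \<Rightarrow> fm" where
  "Suslin_ax k =
     (\<^bold>\<exists>S:\<two>. \<^bold>\<forall>f:\<one>. (S \<cdot> f \<^bold>= \<^bold>0 \<^bold>\<or> S \<cdot> f \<^bold>= \<^bold>1) \<^bold>\<and> (S \<cdot> f \<^bold>= \<^bold>0 \<^bold>\<longleftrightarrow> alternate True k [] f)) []"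

definition Z2\<omega> :: "fm set" where
  "Z2\<omega> = RCA0\<omega> \<union> {Suslin_ax k | k. k \<ge> 1}"

definition cantor :: "ptm \<Rightarrow> pfm" where
  "cantor f = (\<^bold>\<forall>n:\<zero>. f \<cdot> n \<^bold>= \<^bold>0 \<^bold>\<or> f \<cdot> n \<^bold>= \<^bold>1)"

text \<open>
  \<open>Y (f, n)\<close> is curried, and a sequence of length \<open>k\<close> of elements of Baire space is given by the
  first \<open>k\<close> values of an object \<open>w\<close> of type \<open>0 \<rightarrow> 1\<close>.
\<close>

definition IND0 :: fm where
  "IND0 =
     (\<^bold>\<forall>Y:\<one> \<rightarrow> \<zero> \<rightarrow> \<zero>.
        (\<^bold>\<forall>n:\<zero>. \<^bold>\<forall>f:\<one>. \<^bold>\<forall>g:\<one>.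
            cantor f \<^bold>\<and> cantor g \<^bold>\<and> Y \<cdot> f \<cdot> n \<^bold>= \<^bold>0 \<^bold>\<and> Y \<cdot> g \<cdot> n \<^bold>= \<^bold>0 \<^bold>\<longrightarrow> eqT \<one> f g) \<^bold>\<longrightarrow>
        (\<^bold>\<forall>k:\<zero>. \<^bold>\<exists>w:\<zero> \<rightarrow> \<one>. \<^bold>\<forall>m:\<zero>. m \<^bold>< k \<^bold>\<longrightarrow>
            (cantor (w \<cdot> m) \<^bold>\<and> Y \<cdot> (w \<cdot> m) \<cdot> m \<^bold>= \<^bold>0 \<^bold>\<longleftrightarrow>
             (\<^bold>\<exists>f:\<one>. cantor f \<^bold>\<and> Y \<cdot> f \<cdot> m \<^bold>= \<^bold>0)))) []"

definition Z2\<omega>_IND0 :: "fm set" where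
  "Z2\<omega>_IND0 = Z2\<omega> \<union> {IND0}"


section \<open>Rational and real numbers\<close>

text \<open>
  A triple \<open>(i, j, c)\<close> of number terms stands for the rational \<open>(i - j) / c\<close>, where \<open>c > 0\<close>; the
  number \<open>pr i (pr j c)\<close> is a code of it. \<open>dec q \<Phi>\<close> says that the number \<open>q\<close> is the code of a
  rational which satisfies \<open>\<Phi>\<close>.
\<close>

type_synonym qtriple = "ptm \<times> ptm \<times> ptm"

fun rcode :: "qtriple \<Rightarrow> ptm" where
  "rcode (i, j, c) = pr i (pr j c)"

definition dec :: "ptm \<Rightarrow> (qtriple \<Rightarrow> pfm) \<Rightarrow> pfm" where
  "dec q \<Phi> = (\<^bold>\<exists>i:\<zero>. \<^bold>\<exists>j:\<zero>. \<^bold>\<exists>c:\<zero>. \<^bold>0 \<^bold>< c \<^bold>\<and> q \<^bold>= rcode (i, j, c) \<^bold>\<and> \<Phi> (i, j, c))"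

fun qadd :: "qtriple \<Rightarrow> qtriple \<Rightarrow> qtriple" where
  "qadd (i, j, c) (k, l, d) = (i \<^bold>* d \<^bold>+ k \<^bold>* c, j \<^bold>* d \<^bold>+ l \<^bold>* c, c \<^bold>* d)"
fun qneg :: "qtriple \<Rightarrow> qtriple" where
  "qneg (i, j, c) = (j, i, c)"
definition qsub :: "qtriple \<Rightarrow> qtriple \<Rightarrow> qtriple" where
  "qsub p q = qadd p (qneg q)"
fun qmul :: "qtriple \<Rightarrow> qtriple \<Rightarrow> qtriple" where
  "qmul (i, j, c) (k, l, d) = (i \<^bold>* k \<^bold>+ j \<^bold>* l, i \<^bold>* l \<^bold>+ j \<^bold>* k, c \<^bold>* d)"
fun qless :: "qtriple \<Rightarrow> qtriple \<Rightarrow> pfm" where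
  "qless (i, j, c) (k, l, d) = (i \<^bold>* d \<^bold>+ l \<^bold>* c \<^bold>< k \<^bold>* c \<^bold>+ j \<^bold>* d)"
definition qle :: "qtriple \<Rightarrow> qtriple \<Rightarrow> pfm" where
  "qle p q = (\<^bold>\<not> qless q p)"
definition qabs_less :: "qtriple \<Rightarrow> qtriple \<Rightarrow> pfm" where
  "qabs_less p q = (qless p q \<^bold>\<and> qless (qneg p) q)"
definition qabs_le :: "qtriple \<Rightarrow> qtriple \<Rightarrow> pfm" where
  "qabs_le p q = (qle p q \<^bold>\<and> qle (qneg p) q)"

definition q0 :: qtriple where "q0 = (\<^bold>0, \<^bold>0, \<^bold>1)"
definition q1 :: qtriple where "q1 = (\<^bold>1, \<^bold>0, \<^bold>1)"

text \<open>\<open>2\<^sup>-\<^sup>n\<close> and \<open>2\<^sup>-\<^sup>n\<^sup>+\<^sup>1\<close>\<close>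
definition qeps :: "ptm \<Rightarrow> qtriple" where "qeps n = (\<^bold>1, \<^bold>0, pow2 n)"
definition qeps2 :: "ptm \<Rightarrow> qtriple" where "qeps2 n = (\<^bold>1 \<^bold>+ \<^bold>1, \<^bold>0, pow2 n)"

definition is_real :: "ptm \<Rightarrow> pfm" where
  "is_real x = (\<^bold>\<forall>n:\<zero>. \<^bold>\<forall>i:\<zero>. dec (x \<cdot> n) (\<lambda>p. dec (x \<cdot> (n \<^bold>+ i)) (\<lambda>q. qabs_less (qsub p q) (qeps n))))"

definition req :: "ptm \<Rightarrow> ptm \<Rightarrow> pfm"  (infix "=\<^sub>\<real>" 50) where
  "(x =\<^sub>\<real> y) = (\<^bold>\<forall>n:\<zero>. dec (x \<cdot> n) (\<lambda>p. dec (y \<cdot> n) (\<lambda>q. qabs_le (qsub p q) (qeps2 n))))"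

definition rless :: "ptm \<Rightarrow> ptm \<Rightarrow> pfm"  (infix "<\<^sub>\<real>" 50) where
  "(x <\<^sub>\<real> y) = (\<^bold>\<exists>n:\<zero>. dec (x \<cdot> n) (\<lambda>p. dec (y \<cdot> n) (\<lambda>q. qless (qadd p (qeps2 n)) q)))"

definition rle :: "ptm \<Rightarrow> ptm \<Rightarrow> pfm"  (infix "\<le>\<^sub>\<real>" 50) where
  "(x \<le>\<^sub>\<real> y) = (\<^bold>\<not> y <\<^sub>\<real> x)"

definition rconst :: "qtriple \<Rightarrow> ptm" where
  "rconst q = (\<^bold>\<lambda>n:\<zero>. rcode q)"

definition rpos :: "ptm \<Rightarrow> pfm" where
  "rpos x = (is_real x \<^bold>\<and> rconst q0 <\<^sub>\<real> x)"

text \<open>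
  Real arithmetic is termwise rational arithmetic on Cauchy sequences: \<open>rop f x y z\<close> says that the
  real \<open>z\<close> is the limit of the rational sequence \<open>f (x n) (y n)\<close>. It is used with \<open>f\<close> being
  \<^const>\<open>qadd\<close>, \<^const>\<open>qsub\<close> or \<^const>\<open>qmul\<close>, and \<open>x\<close>, \<open>y\<close> reals.
\<close>

definition rop :: "(qtriple \<Rightarrow> qtriple \<Rightarrow> qtriple) \<Rightarrow> ptm \<Rightarrow> ptm \<Rightarrow> ptm \<Rightarrow> pfm" where
  "rop f x y z =
     (is_real z \<^bold>\<and>
      (\<^bold>\<forall>m:\<zero>. \<^bold>\<exists>k:\<zero>. \<^bold>\<forall>n:\<zero>. k \<^bold>\<le> n \<^bold>\<longrightarrow>
         dec (x \<cdot> n) (\<lambda>p. dec (y \<cdot> n) (\<lambda>q. dec (z \<cdot> n) (\<lambda>r.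
           qabs_less (qsub (f p q) r) (qeps m))))))"

text \<open>\<open>d = |x - y|\<close>\<close>
definition rdist :: "ptm \<Rightarrow> ptm \<Rightarrow> ptm \<Rightarrow> pfm" where
  "rdist x y d = (rconst q0 \<le>\<^sub>\<real> d \<^bold>\<and> (rop qsub x y d \<^bold>\<or> rop qsub y x d))"

definition rdist_less :: "ptm \<Rightarrow> ptm \<Rightarrow> ptm \<Rightarrow> pfm" where
  "rdist_less x y e = (\<^bold>\<exists>d:\<one>. rdist x y d \<^bold>\<and> d <\<^sub>\<real> e)"

text \<open>\<open>t = \<Sum>i\<le>k. d i\<close> for a sequence \<open>d\<close> of reals; \<open>s\<close> is the sequence of partial sums.\<close>
definition rsum :: "ptm \<Rightarrow> ptm \<Rightarrow> ptm \<Rightarrow> pfm" where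
  "rsum d k t =
     (\<^bold>\<exists>s:\<zero> \<rightarrow> \<one>. is_real (s \<cdot> \<^bold>0) \<^bold>\<and> s \<cdot> \<^bold>0 =\<^sub>\<real> d \<cdot> \<^bold>0 \<^bold>\<and>
        (\<^bold>\<forall>i:\<zero>. i \<^bold>< k \<^bold>\<longrightarrow> rop qadd (s \<cdot> i) (d \<cdot> (i \<^bold>+ \<^bold>1)) (s \<cdot> (i \<^bold>+ \<^bold>1))) \<^bold>\<and>
        is_real t \<^bold>\<and> t =\<^sub>\<real> s \<cdot> k)"


section \<open>Functions and sets on the unit interval\<close>

definition unit_interval :: "ptm \<Rightarrow> pfm" where
  "unit_interval x = (is_real x \<^bold>\<and> rconst q0 \<le>\<^sub>\<real> x \<^bold>\<and> x \<le>\<^sub>\<real> rconst q1)"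

definition real_fun :: "ptm \<Rightarrow> pfm" where
  "real_fun f =
     ((\<^bold>\<forall>x:\<one>. unit_interval x \<^bold>\<longrightarrow> is_real (f \<cdot> x)) \<^bold>\<and>
      (\<^bold>\<forall>x:\<one>. \<^bold>\<forall>y:\<one>. unit_interval x \<^bold>\<and> unit_interval y \<^bold>\<and> x =\<^sub>\<real> y \<^bold>\<longrightarrow> f \<cdot> x =\<^sub>\<real> f \<cdot> y))"

definition continuous_on_unit :: "ptm \<Rightarrow> pfm" where
  "continuous_on_unit f =
     (\<^bold>\<forall>x:\<one>. unit_interval x \<^bold>\<longrightarrow> (\<^bold>\<forall>e:\<one>. rpos e \<^bold>\<longrightarrow> (\<^bold>\<exists>d:\<one>. rpos d \<^bold>\<and>
        (\<^bold>\<forall>y:\<one>. unit_interval y \<^bold>\<and> rdist_less x y d \<^bold>\<longrightarrow> rdist_less (f \<cdot> x) (f \<cdot> y) e))))"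

text \<open>
  Differentiability at \<open>x\<close> within \<open>[0,1]\<close> (hence one-sided at the endpoints); \<open>q\<close> is the difference
  quotient \<open>(f y - f x) / (y - x)\<close>.
\<close>

definition differentiable_at :: "ptm \<Rightarrow> ptm \<Rightarrow> pfm" where
  "differentiable_at f x =
     (\<^bold>\<exists>L:\<one>. is_real L \<^bold>\<and> (\<^bold>\<forall>e:\<one>. rpos e \<^bold>\<longrightarrow> (\<^bold>\<exists>d:\<one>. rpos d \<^bold>\<and>
        (\<^bold>\<forall>y:\<one>. unit_interval y \<^bold>\<and> \<^bold>\<not> y =\<^sub>\<real> x \<^bold>\<and> rdist_less y x d \<^bold>\<longrightarrow>
           (\<^bold>\<exists>h:\<one>. \<^bold>\<exists>u:\<one>. \<^bold>\<exists>q:\<one>.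
              rop qsub y x h \<^bold>\<and> rop qsub (f \<cdot> y) (f \<cdot> x) u \<^bold>\<and>
              is_real q \<^bold>\<and> rop qmul q h u \<^bold>\<and> rdist_less q L e)))))"

text \<open>
  A sequence of subsets of \<open>[0,1]\<close> is a \<open>{0,1}\<close>-valued \<open>C\<close> of type \<open>1 \<rightarrow> 0 \<rightarrow> 0\<close> respecting
  \<open>=\<^sub>\<real>\<close>; \<open>C x n = 1\<close> means that \<open>x\<close> belongs to the \<open>n\<close>-th set.
\<close>

definition set_seq :: "ptm \<Rightarrow> pfm" where
  "set_seq C =
     ((\<^bold>\<forall>x:\<one>. \<^bold>\<forall>n:\<zero>. unit_interval x \<^bold>\<longrightarrow> C \<cdot> x \<cdot> n \<^bold>= \<^bold>0 \<^bold>\<or> C \<cdot> x \<cdot> n \<^bold>= \<^bold>1) \<^bold>\<and>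
      (\<^bold>\<forall>x:\<one>. \<^bold>\<forall>y:\<one>. \<^bold>\<forall>n:\<zero>. unit_interval x \<^bold>\<and> unit_interval y \<^bold>\<and> x =\<^sub>\<real> y \<^bold>\<longrightarrow>
          C \<cdot> x \<cdot> n \<^bold>= C \<cdot> y \<cdot> n))"

definition mem :: "ptm \<Rightarrow> ptm \<Rightarrow> ptm \<Rightarrow> pfm" where
  "mem C n x = (unit_interval x \<^bold>\<and> C \<cdot> x \<cdot> n \<^bold>= \<^bold>1)"

definition is_open :: "(ptm \<Rightarrow> pfm) \<Rightarrow> pfm" where
  "is_open X =
     (\<^bold>\<forall>x:\<one>. unit_interval x \<^bold>\<and> X x \<^bold>\<longrightarrow>
        (\<^bold>\<exists>k:\<zero>. \<^bold>\<forall>y:\<one>. unit_interval y \<^bold>\<and> rdist_less x y (rconst (qeps k)) \<^bold>\<longrightarrow> X y))"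

definition is_closed :: "(ptm \<Rightarrow> pfm) \<Rightarrow> pfm" where
  "is_closed X = is_open (\<lambda>x. \<^bold>\<not> X x)"


section \<open>Generalised absolute continuity\<close>

definition is_sup :: "ptm \<Rightarrow> ptm \<Rightarrow> ptm \<Rightarrow> ptm \<Rightarrow> pfm" where
  "is_sup f a b s =
     (is_real s \<^bold>\<and>
      (\<^bold>\<forall>x:\<one>. is_real x \<^bold>\<and> a \<le>\<^sub>\<real> x \<^bold>\<and> x \<le>\<^sub>\<real> b \<^bold>\<longrightarrow> f \<cdot> x \<le>\<^sub>\<real> s) \<^bold>\<and>
      (\<^bold>\<forall>t:\<one>. is_real t \<^bold>\<and> (\<^bold>\<forall>x:\<one>. is_real x \<^bold>\<and> a \<le>\<^sub>\<real> x \<^bold>\<and> x \<le>\<^sub>\<real> b \<^bold>\<longrightarrow> f \<cdot> x \<le>\<^sub>\<real> t) \<^bold>\<longrightarrow> s \<le>\<^sub>\<real> t))"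

definition is_inf :: "ptm \<Rightarrow> ptm \<Rightarrow> ptm \<Rightarrow> ptm \<Rightarrow> pfm" where
  "is_inf f a b s =
     (is_real s \<^bold>\<and>
      (\<^bold>\<forall>x:\<one>. is_real x \<^bold>\<and> a \<le>\<^sub>\<real> x \<^bold>\<and> x \<le>\<^sub>\<real> b \<^bold>\<longrightarrow> s \<le>\<^sub>\<real> f \<cdot> x) \<^bold>\<and>
      (\<^bold>\<forall>t:\<one>. is_real t \<^bold>\<and> (\<^bold>\<forall>x:\<one>. is_real x \<^bold>\<and> a \<le>\<^sub>\<real> x \<^bold>\<and> x \<le>\<^sub>\<real> b \<^bold>\<longrightarrow> t \<le>\<^sub>\<real> f \<cdot> x) \<^bold>\<longrightarrow> t \<le>\<^sub>\<real> s))"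

definition osc :: "ptm \<Rightarrow> ptm \<Rightarrow> ptm \<Rightarrow> ptm \<Rightarrow> pfm" where
  "osc f a b d = (\<^bold>\<exists>s:\<one>. \<^bold>\<exists>t:\<one>. is_sup f a b s \<^bold>\<and> is_inf f a b t \<^bold>\<and> rop qsub s t d)"

text \<open>
  Below, \<open>a\<close> and \<open>b\<close> have type \<open>0 \<rightarrow> 1\<close>, and \<open>V a\<^sub>i b\<^sub>i v\<close> says that \<open>v\<close> is the value
  assigned to the interval \<open>(a\<^sub>i, b\<^sub>i)\<close>: its length, \<open>|f a\<^sub>i - f b\<^sub>i|\<close>, or the oscillation of \<open>f\<close>.
\<close>

definition sum_less :: "(ptm \<Rightarrow> ptm \<Rightarrow> ptm \<Rightarrow> pfm) \<Rightarrow> ptm \<Rightarrow> ptm \<Rightarrow> ptm \<Rightarrow> ptm \<Rightarrow> pfm" where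
  "sum_less V a b k e =
     (\<^bold>\<exists>v:\<zero> \<rightarrow> \<one>. \<^bold>\<exists>t:\<one>. (\<^bold>\<forall>i:\<zero>. i \<^bold>\<le> k \<^bold>\<longrightarrow> V (a \<cdot> i) (b \<cdot> i) (v \<cdot> i)) \<^bold>\<and> rsum v k t \<^bold>\<and> t <\<^sub>\<real> e)"

definition disjoint_intervals :: "(ptm \<Rightarrow> pfm) \<Rightarrow> ptm \<Rightarrow> ptm \<Rightarrow> ptm \<Rightarrow> pfm" where
  "disjoint_intervals X a b k =
     ((\<^bold>\<forall>i:\<zero>. i \<^bold>\<le> k \<^bold>\<longrightarrow> X (a \<cdot> i) \<^bold>\<and> X (b \<cdot> i) \<^bold>\<and> a \<cdot> i <\<^sub>\<real> b \<cdot> i) \<^bold>\<and>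
      (\<^bold>\<forall>i:\<zero>. \<^bold>\<forall>j:\<zero>. i \<^bold>\<le> k \<^bold>\<and> j \<^bold>\<le> k \<^bold>\<and> \<^bold>\<not> i \<^bold>= j \<^bold>\<longrightarrow>
         \<^bold>\<not> (\<^bold>\<exists>x:\<one>. is_real x \<^bold>\<and> a \<cdot> i <\<^sub>\<real> x \<^bold>\<and> x <\<^sub>\<real> b \<cdot> i \<^bold>\<and> a \<cdot> j <\<^sub>\<real> x \<^bold>\<and> x <\<^sub>\<real> b \<cdot> j)))"

definition AC_wrt :: "(ptm \<Rightarrow> ptm \<Rightarrow> ptm \<Rightarrow> pfm) \<Rightarrow> (ptm \<Rightarrow> pfm) \<Rightarrow> pfm" where
  "AC_wrt V X =
     (\<^bold>\<forall>e:\<one>. rpos e \<^bold>\<longrightarrow> (\<^bold>\<exists>d:\<one>. rpos d \<^bold>\<and>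
        (\<^bold>\<forall>k:\<zero>. \<^bold>\<forall>a:\<zero> \<rightarrow> \<one>. \<^bold>\<forall>b:\<zero> \<rightarrow> \<one>. disjoint_intervals X a b k \<^bold>\<longrightarrow>
           sum_less rdist a b k d \<^bold>\<longrightarrow> sum_less V a b k e)))"

definition AC :: "ptm \<Rightarrow> (ptm \<Rightarrow> pfm) \<Rightarrow> pfm" where
  "AC f = AC_wrt (\<lambda>a b. rdist (f \<cdot> a) (f \<cdot> b))"

definition ACstar :: "ptm \<Rightarrow> (ptm \<Rightarrow> pfm) \<Rightarrow> pfm" where
  "ACstar f = AC_wrt (osc f)"

definition generalised :: "(ptm \<Rightarrow> (ptm \<Rightarrow> pfm) \<Rightarrow> pfm) \<Rightarrow> ptm \<Rightarrow> pfm" where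
  "generalised A f =
     (real_fun f \<^bold>\<and> continuous_on_unit f \<^bold>\<and>
      (\<^bold>\<exists>C:\<one> \<rightarrow> \<zero> \<rightarrow> \<zero>. set_seq C \<^bold>\<and>
         (\<^bold>\<forall>n:\<zero>. is_closed (mem C n)) \<^bold>\<and>
         (\<^bold>\<forall>x:\<one>. unit_interval x \<^bold>\<longrightarrow> (\<^bold>\<exists>n:\<zero>. mem C n x)) \<^bold>\<and>
         (\<^bold>\<forall>n:\<zero>. A f (mem C n))))"

definition ACG :: "ptm \<Rightarrow> pfm" where "ACG = generalised AC"
definition ACGstar :: "ptm \<Rightarrow> pfm" where "ACGstar = generalised ACstar"


section \<open>The four sentences\<close>

definition somewhere_differentiable :: "(ptm \<Rightarrow> pfm) \<Rightarrow> fm" where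
  "somewhere_differentiable G =
     (\<^bold>\<forall>f:\<one> \<rightarrow> \<one>. G f \<^bold>\<longrightarrow> (\<^bold>\<exists>x:\<one>. unit_interval x \<^bold>\<and> differentiable_at f x)) []"

definition complement_dense :: "(ptm \<Rightarrow> pfm) \<Rightarrow> fm" where
  "complement_dense G =
     (\<^bold>\<forall>g:\<one> \<rightarrow> \<one>. real_fun g \<^bold>\<and> continuous_on_unit g \<^bold>\<longrightarrow> (\<^bold>\<forall>e:\<one>. rpos e \<^bold>\<longrightarrow>
        (\<^bold>\<exists>f:\<one> \<rightarrow> \<one>. real_fun f \<^bold>\<and> continuous_on_unit f \<^bold>\<and> \<^bold>\<not> G f \<^bold>\<and>
           (\<^bold>\<forall>x:\<one>. unit_interval x \<^bold>\<longrightarrow> rdist_less (f \<cdot> x) (g \<cdot> x) e)))) []"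

end

(*
  The proof exhibits a model of Z_2^omega + IND_0 in which there is an injection from the reals to the
  natural numbers that is constant on =_R-classes. Its fibres form a sequence of closed sets with at
  most one element each, which witnesses that every continuous function is in ACG and in ACG*;
  there is no interval with both endpoints in one of these sets. The Takagi function, which is
  nowhere differentiable already along dyadic rationals, belongs to the model.

  The second-order part M1 is a countable set of functions closed under Skolem functions for
  Sigma^1_k-formulas, so that Sigma^1_k-truth in M1 is actual truth. It is built in omega stages
  together with an injection Y into the natural numbers: if G codes a sequence of functions
  G_p of the present stage, then the function sending p to Y(G_p) is added at the next stage. Thus Y maps every
  sequence in M1 to a function in M1. This one property makes Y an object of the model: the higher
  types are those functionals, named by closed combinator terms, which hereditarily map sequences
  in the model to sequences in the model. Numbers are standard, so induction and IND_0 are trivial.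
*)
theory Submission
  imports Defs Complex_Main "HOL-Library.Countable_Set" "HOL-Library.Nat_Bijection"
begin

section \<open>Codes of rational and real numbers\<close>

text \<open>The obstacle is to have an injection from the reals to the numbers as an object of a
  model of Z_2^omega without creating new reals. An arbitrary injection on a countable
  \<open>M1\<close> may code, along some sequence in \<open>M1\<close>, a function outside
  \<open>M1\<close>; so injection and reals grow together and values once given are frozen. This
  does not clash with the Suslin functionals: they decide formulas whose parameters are numbers and
  functions, whereas a diagonal argument against the injection would have to decide whether some
  function has a given index, a function quantifier with a third-order parameter. Since a real has
  many codes, the injection is applied to \<open>canonical_code\<close>, which depends on the real
  only.

  The Takagi function is convenient because passing to either half of a dyadic cell changes its
  slope by exactly 1. The failure of differentiability is therefore visible at rational points,
  whose codes are present from stage 0 on, and one further closure operation makes the function an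
  object of the model.\<close>

text \<open>
  The prefix \<open>n\<close> marks the value in the model of an object-language abbreviation: \<open>nqadd\<close> is that of
  \<^const>\<open>qadd\<close>, \<open>nreal\<close> that of \<^const>\<open>is_real\<close>, and so on.
\<close>

definition npr :: "nat \<Rightarrow> nat \<Rightarrow> nat" where
  "npr s t = (s + t) * (s + t) + s"

text \<open>The value lies between the squares of \<open>s + t\<close> and \<open>s + t + 1\<close>,
  so it determines \<open>s + t\<close>, and then the remainder \<open>s\<close>.\<close>

lemma npr_inject [simp]: "npr s t = npr s' t' \<longleftrightarrow> s = s' \<and> t = t'"
proof
  assume eq: "npr s t = npr s' t'"
  have bound: "npr a b < (a + b + 1) * (a + b + 1)" for a b
    by (simp add: npr_def algebra_simps)
  have "a + b \<le> a' + b'" if "npr a b = npr a' b'" for a b a' b'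
  proof (rule ccontr)
    assume "\<not> a + b \<le> a' + b'"
    then have "(a' + b' + 1) * (a' + b' + 1) \<le> (a + b) * (a + b)"
      by (intro mult_mono) auto
    also have "\<dots> \<le> npr a b"
      by (simp add: npr_def)
    finally show False
      using bound[of a' b'] that by simp
  qed
  from this[OF eq] this[OF eq[symmetric]] have "s + t = s' + t'"
    by simp
  with eq show "s = s' \<and> t = t'"
    by (simp add: npr_def)
qed simp

type_synonym ntriple = "nat \<times> nat \<times> nat"

fun ncode :: "ntriple \<Rightarrow> nat" where
  "ncode (i, j, c) = npr i (npr j c)"

definition pos_den :: "ntriple \<Rightarrow> bool" where
  "pos_den p \<longleftrightarrow> 0 < snd (snd p)"

definition is_code :: "nat \<Rightarrow> bool" where
  "is_code q \<longleftrightarrow> (\<exists>p. pos_den p \<and> q = ncode p)"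

definition decode :: "nat \<Rightarrow> ntriple" where
  "decode q = (SOME p. pos_den p \<and> q = ncode p)"

text \<open>Written with the quantifiers of \<open>dec\<close> in the same order, so that
  \<open>mean_dec\<close> can match them one by one; \<open>sdec_iff\<close> gives the usable
  form.\<close>

definition sdec :: "nat \<Rightarrow> (ntriple \<Rightarrow> bool) \<Rightarrow> bool" where
  "sdec q \<Phi> \<longleftrightarrow> (\<exists>i j c. 0 < c \<and> q = npr i (npr j c) \<and> \<Phi> (i, j, c))"

lemma ncode_inject: "ncode p = ncode q \<Longrightarrow> p = q"
  by (cases p; cases q) auto

declare ncode.simps [simp del]

lemma decode_ncode: "pos_den p \<Longrightarrow> decode (ncode p) = p"
  unfolding decode_def by (rule some_equality) (auto dest: ncode_inject)

lemma pos_den_decode: "is_code q \<Longrightarrow> pos_den (decode q)"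
  by (auto simp: is_code_def decode_ncode)

text \<open>A number codes at most one triple, so the quantifier over triples reduces to the triple
  chosen by \<open>decode\<close>.\<close>

lemma sdec_iff: "sdec q \<Phi> \<longleftrightarrow> is_code q \<and> \<Phi> (decode q)"
proof -
  have "sdec q \<Phi> \<longleftrightarrow> (\<exists>p. pos_den p \<and> q = ncode p \<and> \<Phi> p)"
    by (simp add: sdec_def pos_den_def ncode.simps)
  also have "\<dots> \<longleftrightarrow> is_code q \<and> \<Phi> (decode q)"
    by (metis is_code_def decode_ncode)
  finally show ?thesis .
qed

section \<open>Arithmetic of rational triples\<close>

fun qval :: "ntriple \<Rightarrow> real" where
  "qval (i, j, c) = (real i - real j) / real c"

definition cval :: "nat \<Rightarrow> real" where
  "cval q = qval (decode q)"

fun nqadd :: "ntriple \<Rightarrow> ntriple \<Rightarrow> ntriple" where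
  "nqadd (i, j, c) (k, l, d) = (i * d + k * c, j * d + l * c, c * d)"
fun nqneg :: "ntriple \<Rightarrow> ntriple" where
  "nqneg (i, j, c) = (j, i, c)"
definition nqsub :: "ntriple \<Rightarrow> ntriple \<Rightarrow> ntriple" where
  "nqsub p q = nqadd p (nqneg q)"
fun nqmul :: "ntriple \<Rightarrow> ntriple \<Rightarrow> ntriple" where
  "nqmul (i, j, c) (k, l, d) = (i * k + j * l, i * l + j * k, c * d)"
fun nqless :: "ntriple \<Rightarrow> ntriple \<Rightarrow> bool" where
  "nqless (i, j, c) (k, l, d) \<longleftrightarrow> i * d + l * c < k * c + j * d"
definition nqle :: "ntriple \<Rightarrow> ntriple \<Rightarrow> bool" where
  "nqle p q \<longleftrightarrow> \<not> nqless q p"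
definition nqabs_less :: "ntriple \<Rightarrow> ntriple \<Rightarrow> bool" where
  "nqabs_less p q \<longleftrightarrow> nqless p q \<and> nqless (nqneg p) q"
definition nqabs_le :: "ntriple \<Rightarrow> ntriple \<Rightarrow> bool" where
  "nqabs_le p q \<longleftrightarrow> nqle p q \<and> nqle (nqneg p) q"
definition nqeps :: "nat \<Rightarrow> ntriple" where "nqeps n = (1, 0, 2 ^ n)"
definition nqeps2 :: "nat \<Rightarrow> ntriple" where "nqeps2 n = (1 + 1, 0, 2 ^ n)"

lemma pos_den_ops [simp]:
  "pos_den (nqeps n)" "pos_den (nqeps2 n)"
  "pos_den p \<Longrightarrow> pos_den (nqneg p)"
  "pos_den p \<Longrightarrow> pos_den q \<Longrightarrow> pos_den (nqadd p q)"
  "pos_den p \<Longrightarrow> pos_den q \<Longrightarrow> pos_den (nqsub p q)"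
  "pos_den p \<Longrightarrow> pos_den q \<Longrightarrow> pos_den (nqmul p q)"
  by (cases p; cases q; simp add: pos_den_def nqeps_def nqeps2_def nqsub_def)+

lemma qval_ops [simp]:
  "qval (nqeps n) = 1 / 2 ^ n" "qval (nqeps2 n) = 2 / 2 ^ n"
  "qval (nqneg p) = - qval p"
  "pos_den p \<Longrightarrow> pos_den q \<Longrightarrow> qval (nqadd p q) = qval p + qval q"
  "qval (nqmul p q) = qval p * qval q"
proof -
  obtain i j c k l d where pq: "p = (i, j, c)" "q = (k, l, d)"
    by (metis prod_cases3)
  show "qval (nqeps n) = 1 / 2 ^ n" "qval (nqeps2 n) = 2 / 2 ^ n"
    by (simp_all add: nqeps_def nqeps2_def)
  show "qval (nqneg p) = - qval p"
    by (simp add: pq minus_divide_left)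
  show "qval (nqmul p q) = qval p * qval q"
    by (simp add: pq algebra_simps)
  assume "pos_den p" "pos_den q"
  then have "real c > 0" "real d > 0"
    by (auto simp: pos_den_def pq)
  then have "qval p + qval q = ((real i - real j) * real d + (real k - real l) * real c) / (real c * real d)"
    by (simp add: pq add_divide_eq_iff divide_add_eq_iff)
  then show "qval (nqadd p q) = qval p + qval q"
    by (simp add: pq algebra_simps)
qed

lemma qval_nqsub [simp]:
  "pos_den p \<Longrightarrow> pos_den q \<Longrightarrow> qval (nqsub p q) = qval p - qval q"
  by (simp add: nqsub_def)

text \<open>Cross-multiplication by the positive denominators, with negative parts moved to the
  other side so that only sums of natural numbers are compared.\<close>

lemma nqless_iff [simp]:
  assumes "pos_den p" "pos_den q"
  shows "nqless p q \<longleftrightarrow> qval p < qval q"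
proof -
  obtain i j c k l d where pq: "p = (i, j, c)" "q = (k, l, d)"
    by (metis prod_cases3)
  with assms have cd: "real c > 0" "real d > 0"
    by (auto simp: pos_den_def)
  have "qval p < qval q \<longleftrightarrow> (real i - real j) * real d < (real k - real l) * real c"
    using cd by (simp add: pq divide_less_eq less_divide_eq)
  also have "\<dots> \<longleftrightarrow> real (i * d + l * c) < real (k * c + j * d)"
    by (simp add: algebra_simps)
  also have "\<dots> \<longleftrightarrow> nqless p q"
    by (simp only: pq nqless.simps of_nat_less_iff)
  finally show ?thesis ..
qed

lemma nqabs_iff [simp]:
  assumes "pos_den p" "pos_den q"
  shows "nqabs_less p q \<longleftrightarrow> \<bar>qval p\<bar> < qval q" "nqabs_le p q \<longleftrightarrow> \<bar>qval p\<bar> \<le> qval q"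
  using assms by (auto simp: nqabs_less_def nqabs_le_def nqle_def)

text \<open>This and the following definitions copy the object-language formulas symbol by symbol,
  so that evaluation rules produce exactly these propositions by unification. Lemmas such as
  \<open>nreal_iff\<close> and \<open>nrop_iff\<close> then translate them into statements about
  \<open>rval\<close>.\<close>

definition nreal :: "(nat \<Rightarrow> nat) \<Rightarrow> bool" where
  "nreal x \<longleftrightarrow> (\<forall>n i. sdec (x n) (\<lambda>p. sdec (x (n + i)) (\<lambda>q. nqabs_less (nqsub p q) (nqeps n))))"

definition nreq :: "(nat \<Rightarrow> nat) \<Rightarrow> (nat \<Rightarrow> nat) \<Rightarrow> bool" where
  "nreq x y \<longleftrightarrow> (\<forall>n. sdec (x n) (\<lambda>p. sdec (y n) (\<lambda>q. nqabs_le (nqsub p q) (nqeps2 n))))"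

definition nrless :: "(nat \<Rightarrow> nat) \<Rightarrow> (nat \<Rightarrow> nat) \<Rightarrow> bool" where
  "nrless x y \<longleftrightarrow> (\<exists>n. sdec (x n) (\<lambda>p. sdec (y n) (\<lambda>q. nqless (nqadd p (nqeps2 n)) q)))"

definition nrop ::
    "(ntriple \<Rightarrow> ntriple \<Rightarrow> ntriple) \<Rightarrow> (nat \<Rightarrow> nat) \<Rightarrow> (nat \<Rightarrow> nat) \<Rightarrow> (nat \<Rightarrow> nat) \<Rightarrow> bool" where
  "nrop f x y z \<longleftrightarrow> nreal z \<and>
     (\<forall>m. \<exists>k. \<forall>n. (k < n \<or> k = n) \<longrightarrow>
        sdec (x n) (\<lambda>p. sdec (y n) (\<lambda>q. sdec (z n) (\<lambda>r. nqabs_less (nqsub (f p q) r) (nqeps m)))))"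

text \<open>Total, because \<open>lim\<close> has some value on divergent sequences too; functionals
  defined through \<open>rval\<close> are thus defined on all of Baire space.\<close>

definition rval :: "(nat \<Rightarrow> nat) \<Rightarrow> real" where
  "rval x = lim (\<lambda>n. cval (x n))"

lemma nreal_iff:
  "nreal x \<longleftrightarrow> (\<forall>n. is_code (x n)) \<and> (\<forall>n i. \<bar>cval (x n) - cval (x (n + i))\<bar> < 1 / 2 ^ n)"
proof -
  have "sdec a (\<lambda>p. sdec b (\<lambda>q. nqabs_less (nqsub p q) (nqeps n))) \<longleftrightarrow>
      is_code a \<and> is_code b \<and> \<bar>cval a - cval b\<bar> < 1 / 2 ^ n" for a b n
    by (simp add: sdec_iff pos_den_decode cval_def cong: conj_cong)
  then show ?thesis
    unfolding nreal_def by auto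
qed

lemma nreal_is_code: "nreal x \<Longrightarrow> is_code (x n)"
  by (simp add: nreal_iff)

lemma ex_inverse_power_less:
  assumes "(0::real) < e" shows "\<exists>n. c / 2 ^ n < e"
proof (cases "c \<le> 0")
  case True
  then show ?thesis using assms by (auto intro!: exI[of _ 0])
next
  case False
  obtain n where "c / e < 2 ^ n"
    using real_arch_pow[of 2 "c / e"] by auto
  then have "c / 2 ^ n < e"
    using assms by (simp add: field_simps)
  then show ?thesis ..
qed

lemma nreal_tendsto:
  assumes "nreal x" shows "(\<lambda>n. cval (x n)) \<longlonglongrightarrow> rval x"
proof -
  have "Cauchy (\<lambda>n. cval (x n))"
  proof (rule metric_CauchyI)
    fix e :: real assume "0 < e"
    then obtain N where N: "2 / 2 ^ N < e"
      using ex_inverse_power_less by blast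
    have "dist (cval (x m)) (cval (x n)) < e" if "m \<ge> N" "n \<ge> N" for m n
    proof -
      have d: "\<bar>cval (x N) - cval (x k)\<bar> < 1 / 2 ^ N" if "k \<ge> N" for k
        using assms that by (metis nreal_iff le_add_diff_inverse)
      show ?thesis
        using d[OF that(1)] d[OF that(2)] N by (simp add: dist_real_def)
    qed
    then show "\<exists>M. \<forall>m\<ge>M. \<forall>n\<ge>M. dist (cval (x m)) (cval (x n)) < e"
      by blast
  qed
  then show ?thesis
    by (simp add: rval_def Cauchy_convergent_iff convergent_LIMSEQ_iff)
qed

lemma nreal_approx:
  assumes "nreal x" shows "\<bar>cval (x n) - rval x\<bar> \<le> 1 / 2 ^ n"
proof (rule LIMSEQ_le_const2)
  show "(\<lambda>m. \<bar>cval (x n) - cval (x m)\<bar>) \<longlonglongrightarrow> \<bar>cval (x n) - rval x\<bar>"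
    by (intro tendsto_intros nreal_tendsto assms)
  have "\<bar>cval (x n) - cval (x m)\<bar> \<le> 1 / 2 ^ n" if "m \<ge> n" for m
    using assms that by (metis nreal_iff le_add_diff_inverse less_imp_le)
  then show "\<exists>N. \<forall>m\<ge>N. \<bar>cval (x n) - cval (x m)\<bar> \<le> 1 / 2 ^ n"
    by blast
qed

lemma nreq_iff:
  assumes "nreal x" "nreal y" shows "nreq x y \<longleftrightarrow> rval x = rval y"
proof -
  have iff: "nreq x y \<longleftrightarrow> (\<forall>n. \<bar>cval (x n) - cval (y n)\<bar> \<le> 2 / 2 ^ n)"
    using assms by (simp add: nreq_def sdec_iff pos_den_decode cval_def nreal_is_code)
  have dbl: "2 / 2 ^ n = 2 * (1 / (2::real) ^ n)" "4 / 2 ^ n = 4 * (1 / (2::real) ^ n)" for n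
    by simp_all
  show ?thesis
  proof
    assume "nreq x y"
    show "rval x = rval y"
    proof (rule ccontr)
      assume "rval x \<noteq> rval y"
      \<comment> \<open>The constant is 1 + 2 + 1: one approximation error for each of the two
        reals, and the tolerance 2 in the definition of equality.\<close>
      then obtain n where "4 / 2 ^ n < \<bar>rval x - rval y\<bar>"
        using ex_inverse_power_less[of "\<bar>rval x - rval y\<bar>" 4] by auto
      moreover have "\<bar>cval (x n) - cval (y n)\<bar> \<le> 2 / 2 ^ n"
        using \<open>nreq x y\<close> iff by blast
      ultimately show False
        using nreal_approx[OF assms(1), of n] nreal_approx[OF assms(2), of n] dbl[of n] by linarith
    qed
  next
    assume "rval x = rval y"
    then have "\<bar>cval (x n) - cval (y n)\<bar> \<le> 2 / 2 ^ n" for n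
      using nreal_approx[OF assms(1), of n] nreal_approx[OF assms(2), of n] dbl[of n] by linarith
    then show "nreq x y"
      using iff by blast
  qed
qed

lemma nrless_iff:
  assumes "nreal x" "nreal y" shows "nrless x y \<longleftrightarrow> rval x < rval y"
proof -
  have iff: "nrless x y \<longleftrightarrow> (\<exists>n. cval (x n) + 2 / 2 ^ n < cval (y n))"
    using assms by (simp add: nrless_def sdec_iff pos_den_decode cval_def nreal_is_code)
  have dbl: "2 / 2 ^ n = 2 * (1 / (2::real) ^ n)" "4 / 2 ^ n = 4 * (1 / (2::real) ^ n)" for n
    by simp_all
  show ?thesis
  proof
    assume "nrless x y"
    then obtain n where "cval (x n) + 2 / 2 ^ n < cval (y n)"
      using iff by blast
    then show "rval x < rval y"
      using nreal_approx[OF assms(1), of n] nreal_approx[OF assms(2), of n] dbl[of n] by linarith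
  next
    assume "rval x < rval y"
    then obtain n where "4 / 2 ^ n < rval y - rval x"
      using ex_inverse_power_less[of "rval y - rval x" 4] by auto
    then have "cval (x n) + 2 / 2 ^ n < cval (y n)"
      using nreal_approx[OF assms(1), of n] nreal_approx[OF assms(2), of n] dbl[of n] by linarith
    then show "nrless x y"
      using iff by blast
  qed
qed

text \<open>The termwise results converge to \<open>F (rval x) (rval y)\<close> by assumption, so
  approaching the terms of \<open>z\<close> means having the same limit as \<open>z\<close>.\<close>

lemma nrop_iff:
  assumes "nreal x" "nreal y"
    and f: "\<And>p q. pos_den p \<Longrightarrow> pos_den q \<Longrightarrow> pos_den (f p q)"
           "\<And>p q. pos_den p \<Longrightarrow> pos_den q \<Longrightarrow> qval (f p q) = F (qval p) (qval q)"
    and F: "(\<lambda>n. F (cval (x n)) (cval (y n))) \<longlonglongrightarrow> F (rval x) (rval y)"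
  shows "nrop f x y z \<longleftrightarrow> nreal z \<and> rval z = F (rval x) (rval y)"
proof (cases "nreal z")
  case True
  let ?d = "\<lambda>n. F (cval (x n)) (cval (y n)) - cval (z n)"
  have lim: "?d \<longlonglongrightarrow> F (rval x) (rval y) - rval z"
    by (intro tendsto_intros F nreal_tendsto True)
  have "nrop f x y z \<longleftrightarrow> (\<forall>m. \<exists>k. \<forall>n\<ge>k. \<bar>?d n\<bar> < 1 / 2 ^ m)"
    using assms(1,2) True f
    by (simp add: nrop_def sdec_iff pos_den_decode cval_def nreal_is_code le_less)
  also have "\<dots> \<longleftrightarrow> ?d \<longlonglongrightarrow> 0"
  proof
    assume *: "\<forall>m. \<exists>k. \<forall>n\<ge>k. \<bar>?d n\<bar> < 1 / 2 ^ m"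
    show "?d \<longlonglongrightarrow> 0"
    proof (rule LIMSEQ_I)
      fix r :: real assume "0 < r"
      then obtain m where m: "1 / 2 ^ m < r"
        using ex_inverse_power_less by blast
      obtain k where "\<forall>n\<ge>k. \<bar>?d n\<bar> < 1 / 2 ^ m"
        using * by blast
      with m have "\<forall>n\<ge>k. norm (?d n - 0) < r"
        by auto
      then show "\<exists>k. \<forall>n\<ge>k. norm (?d n - 0) < r" ..
    qed
  next
    assume "?d \<longlonglongrightarrow> 0"
    show "\<forall>m. \<exists>k. \<forall>n\<ge>k. \<bar>?d n\<bar> < 1 / 2 ^ m"
    proof
      fix m
      have "\<exists>k. \<forall>n\<ge>k. norm (?d n - 0) < 1 / 2 ^ m"
        using \<open>?d \<longlonglongrightarrow> 0\<close> by (intro LIMSEQ_D) auto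
      then show "\<exists>k. \<forall>n\<ge>k. \<bar>?d n\<bar> < 1 / 2 ^ m"
        by simp
    qed
  qed
  also have "\<dots> \<longleftrightarrow> F (rval x) (rval y) - rval z = 0"
    using lim LIMSEQ_unique by (metis (no_types, lifting))
  finally show ?thesis
    using True by auto
qed (simp add: nrop_def)

lemma nrop_sub_iff:
  "nreal x \<Longrightarrow> nreal y \<Longrightarrow> nrop nqsub x y z \<longleftrightarrow> nreal z \<and> rval z = rval x - rval y"
  by (rule nrop_iff) (auto intro!: tendsto_intros nreal_tendsto)

lemma nrop_mul_iff:
  "nreal x \<Longrightarrow> nreal y \<Longrightarrow> nrop nqmul x y z \<longleftrightarrow> nreal z \<and> rval z = rval x * rval y"
  by (rule nrop_iff) (auto intro!: tendsto_intros nreal_tendsto)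

text \<open>Dyadic truncation, the numerator being split into positive and negative part. All errors
  lie in [0, 1/2^n) and have the same sign, whence the strict bound that \<open>nreal\<close>
  demands.\<close>

definition real_code :: "real \<Rightarrow> nat \<Rightarrow> nat" where
  "real_code r n = ncode (nat \<lfloor>r * 2 ^ n\<rfloor>, nat (- \<lfloor>r * 2 ^ n\<rfloor>), 2 ^ n)"

lemma cval_ncode: "pos_den p \<Longrightarrow> cval (ncode p) = qval p"
  by (simp add: cval_def decode_ncode)

lemma cval_real_code: "cval (real_code r n) = of_int \<lfloor>r * 2 ^ n\<rfloor> / 2 ^ n"
  by (auto simp: real_code_def cval_ncode pos_den_def)

lemma real_code_approx: "cval (real_code r n) \<le> r" "r < cval (real_code r n) + 1 / 2 ^ n"
proof -
  have *: "of_int \<lfloor>r * 2 ^ n\<rfloor> \<le> r * 2 ^ n" "r * 2 ^ n < of_int \<lfloor>r * 2 ^ n\<rfloor> + 1"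
    by linarith+
  show "cval (real_code r n) \<le> r"
    using *(1) by (simp add: cval_real_code field_simps)
  have "r < (of_int \<lfloor>r * 2 ^ n\<rfloor> + 1) / 2 ^ n"
    using *(2) by (simp add: field_simps)
  then show "r < cval (real_code r n) + 1 / 2 ^ n"
    by (simp add: cval_real_code add_divide_distrib)
qed

lemma is_code_ncode: "pos_den p \<Longrightarrow> is_code (ncode p)"
  unfolding is_code_def by blast

lemma nreal_real_code [simp]: "nreal (real_code r)"
proof -
  have "is_code (real_code r n)" for n
    by (simp add: real_code_def is_code_ncode pos_den_def)
  moreover have "\<bar>cval (real_code r n) - cval (real_code r (n + i))\<bar> < 1 / 2 ^ n" for n i
  proof -
    have "1 / 2 ^ (n + i) \<le> 1 / (2::real) ^ n"
      by (simp add: frac_le)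
    then show ?thesis
      using real_code_approx[of r n] real_code_approx[of r "n + i"] by linarith
  qed
  ultimately show ?thesis
    by (simp add: nreal_iff)
qed

lemma rval_eqI:
  assumes "\<And>n. \<bar>cval (x n) - r\<bar> \<le> 1 / 2 ^ n"
  shows "rval x = r"
proof -
  have "(\<lambda>n. cval (x n)) \<longlonglongrightarrow> r"
  proof (rule LIMSEQ_I)
    fix e :: real assume "0 < e"
    then obtain N where N: "1 / 2 ^ N < e"
      using ex_inverse_power_less by blast
    have "norm (cval (x n) - r) < e" if "n \<ge> N" for n
    proof -
      have "1 / 2 ^ n \<le> 1 / (2::real) ^ N"
        using that by (simp add: frac_le)
      then show ?thesis
        using assms[of n] N by simp
    qed
    then show "\<exists>N. \<forall>n\<ge>N. norm (cval (x n) - r) < e"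
      by blast
  qed
  then show ?thesis
    by (simp add: rval_def limI)
qed

lemma rval_real_code [simp]: "rval (real_code r) = r"
proof (rule rval_eqI)
  fix n show "\<bar>cval (real_code r n) - r\<bar> \<le> 1 / 2 ^ n"
    using real_code_approx[of r n] by linarith
qed

lemma const_ncode:
  assumes "pos_den p"
  shows "nreal (\<lambda>_. ncode p)" "rval (\<lambda>_. ncode p) = qval p"
  using assms by (auto simp: nreal_iff is_code_ncode cval_ncode intro!: rval_eqI)


section \<open>The Takagi function\<close>

text \<open>The distance from \<open>x\<close> to the nearest integer.\<close>

definition tent :: "real \<Rightarrow> real" where
  "tent x = min (frac x) (1 - frac x)"

definition takagi :: "real \<Rightarrow> real" where
  "takagi x = (\<Sum>n. tent (2 ^ n * x) / 2 ^ n)"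

lemma tent_bounds: "0 \<le> tent x" "tent x \<le> 1"
  using frac_ge_0[of x] frac_lt_1[of x] by (auto simp: tent_def min_def)

lemma tent_of_int: "tent (of_int k) = 0"
  by (simp add: tent_def)

lemma tent_le_dist_int: "tent x \<le> \<bar>x - of_int k\<bar>"
proof -
  have f: "tent x \<le> x - of_int \<lfloor>x\<rfloor>" "tent x \<le> 1 - (x - of_int \<lfloor>x\<rfloor>)"
    by (auto simp: tent_def frac_def)
  have "\<lfloor>x\<rfloor> \<ge> k \<or> \<lfloor>x\<rfloor> + 1 \<le> k"
    by linarith
  then show ?thesis
  proof
    assume "\<lfloor>x\<rfloor> \<ge> k"
    then show ?thesis using f(1) by linarith
  next
    assume "\<lfloor>x\<rfloor> + 1 \<le> k"
    then have "real_of_int \<lfloor>x\<rfloor> + 1 \<le> of_int k" by linarith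
    then show ?thesis using f(2) by linarith
  qed
qed

lemma tent_attained: "\<exists>k::int. tent x = \<bar>x - of_int k\<bar>"
proof (cases "frac x \<le> 1 - frac x")
  case True
  then have "tent x = \<bar>x - of_int \<lfloor>x\<rfloor>\<bar>"
    using frac_ge_0[of x] by (simp add: tent_def frac_def)
  then show ?thesis ..
next
  case False
  then have "tent x = \<bar>x - of_int (\<lfloor>x\<rfloor> + 1)\<bar>"
    using frac_lt_1[of x] by (simp add: tent_def frac_def)
  then show ?thesis ..
qed

text \<open>The distance to a fixed set is 1-Lipschitz: compare with the integer nearest to the
  other point.\<close>

lemma tent_lipschitz: "\<bar>tent x - tent y\<bar> \<le> \<bar>x - y\<bar>"
proof -
  have "tent a \<le> tent b + \<bar>a - b\<bar>" for a b
  proof -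
    obtain k :: int where "tent b = \<bar>b - of_int k\<bar>"
      using tent_attained by blast
    then show ?thesis
      using tent_le_dist_int[of a k] by linarith
  qed
  from this[of x y] this[of y x] show ?thesis
    by linarith
qed

lemma takagi_summable: "summable (\<lambda>n. tent (2 ^ n * x) / 2 ^ n)"
proof (rule summable_comparison_test')
  show "summable (\<lambda>n. (1 / 2 :: real) ^ n)"
    by (rule summable_geometric) simp
  show "norm (tent (2 ^ n * x) / 2 ^ n) \<le> (1 / 2) ^ n" if "n \<ge> 0" for n
    using tent_bounds[of "2 ^ n * x"] by (simp add: power_divide divide_right_mono)
qed

text \<open>Self-similarity: removing the first summand leaves the series at \<open>2 * x\<close>,
  scaled by 1/2. Both \<open>takagi_modulus\<close> and \<open>takagi_midpoint\<close> are
  inductions along this equation.\<close>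

lemma takagi_rec: "takagi x = tent x + takagi (2 * x) / 2"
proof -
  have "takagi x = (\<Sum>n. tent (2 ^ Suc n * x) / 2 ^ Suc n) + tent (2 ^ 0 * x) / 2 ^ 0"
    unfolding takagi_def by (subst suminf_split_head[OF takagi_summable]) simp
  also have "(\<Sum>n. tent (2 ^ Suc n * x) / 2 ^ Suc n) = (\<Sum>n. tent (2 ^ n * (2 * x)) / 2 ^ n / 2)"
    by (simp add: mult.commute mult.left_commute mult.assoc)
  also have "\<dots> = takagi (2 * x) / 2"
    unfolding takagi_def by (rule suminf_divide[OF takagi_summable])
  finally show ?thesis
    by simp
qed

lemma takagi_of_int: "takagi (of_int k) = 0"
proof -
  have "tent (2 ^ n * of_int k) = 0" for n
    using tent_of_int[of "2 ^ n * k"] by simp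
  then show ?thesis
    by (simp add: takagi_def)
qed

lemma takagi_bounds: "0 \<le> takagi x" "takagi x \<le> 2"
proof -
  show "0 \<le> takagi x"
    unfolding takagi_def by (intro suminf_nonneg takagi_summable) (simp add: tent_bounds)
  have "takagi x \<le> (\<Sum>n. (1 / 2 :: real) ^ n)"
    unfolding takagi_def
  proof (intro suminf_le takagi_summable)
    show "tent (2 ^ n * x) / 2 ^ n \<le> (1 / 2) ^ n" for n
      using tent_bounds[of "2 ^ n * x"] by (simp add: power_divide divide_right_mono)
    show "summable (\<lambda>n. (1 / 2 :: real) ^ n)"
      by (rule summable_geometric) simp
  qed
  then show "takagi x \<le> 2"
    by (simp add: suminf_geometric)
qed

text \<open>Each of the first \<open>n\<close> summands is 1-Lipschitz, the factor 2^k inside being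
  cancelled by the one outside; the tail is a scaled Takagi function with values in [0,2].\<close>

lemma takagi_modulus: "\<bar>takagi x - takagi y\<bar> \<le> real n * \<bar>x - y\<bar> + 2 / 2 ^ n"
proof (induction n arbitrary: x y)
  case 0
  show ?case
    using takagi_bounds[of x] takagi_bounds[of y] by (simp add: abs_if)
next
  case (Suc n)
  have "takagi x - takagi y = (tent x - tent y) + (takagi (2 * x) - takagi (2 * y)) / 2"
    by (subst (1 2) takagi_rec) (simp add: field_simps)
  moreover have "\<bar>takagi (2 * x) - takagi (2 * y)\<bar> \<le> 2 * (real n * \<bar>x - y\<bar>) + 2 / 2 ^ n"
  proof -
    have "2 * x - 2 * y = 2 * (x - y)"
      by simp
    then have "\<bar>2 * x - 2 * y\<bar> = 2 * \<bar>x - y\<bar>"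
      by (simp only: abs_mult abs_numeral)
    then have "real n * \<bar>2 * x - 2 * y\<bar> = 2 * (real n * \<bar>x - y\<bar>)"
      by simp
    then show ?thesis
      using Suc.IH[of "2 * x" "2 * y"] by (simp only:)
  qed
  moreover have "real (Suc n) * \<bar>x - y\<bar> = real n * \<bar>x - y\<bar> + \<bar>x - y\<bar>"
    "2 / 2 ^ n = 2 * (2 / (2::real) ^ Suc n)"
    by (simp_all add: algebra_simps)
  ultimately show ?case
    using tent_lipschitz[of x y] by argo
qed

lemma takagi_continuous:
  assumes "0 < e"
  shows "\<exists>k. \<forall>y. \<bar>x - y\<bar> < 1 / 2 ^ k \<longrightarrow> \<bar>takagi x - takagi y\<bar> < e"
proof -
  obtain n where n: "2 / 2 ^ n < e / 2"
    using ex_inverse_power_less[of "e / 2" 2] assms by auto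
  obtain k where k: "real n / 2 ^ k < e / 2"
    using ex_inverse_power_less[of "e / 2" "real n"] assms by auto
  have "\<bar>takagi x - takagi y\<bar> < e" if "\<bar>x - y\<bar> < 1 / 2 ^ k" for y
  proof -
    have "real n * \<bar>x - y\<bar> \<le> real n * (1 / 2 ^ k)"
      using that by (intro mult_left_mono) auto
    also have "real n * (1 / 2 ^ k) = real n / 2 ^ k"
      by simp
    finally show ?thesis
      using takagi_modulus[of x y n] n k by linarith
  qed
  then show ?thesis by blast
qed

section \<open>Slopes of the Takagi function over dyadic cells\<close>

text \<open>The tent is affine between consecutive half-integers.\<close>

lemma tent_midpoint:
  fixes k :: int
  shows "tent ((2 * of_int k + 1) / 2 ^ (n + 2)) =
    (tent (of_int k / 2 ^ (n + 1)) + tent ((of_int k + 1) / 2 ^ (n + 1))) / 2"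
proof -
  \<comment> \<open>The cell from k/2^(n+1) to (k+1)/2^(n+1) then lies inside the interval from m/2
    to (m+1)/2, on which the tent is affine.\<close>
  define m where "m = k div 2 ^ n"
  define N :: int where "N = 2 ^ n"
  have N: "N > 0" by (simp add: N_def)
  have "k = m * N + k mod N"
    by (simp only: m_def N_def div_mult_mod_eq)
  moreover have "0 \<le> k mod N" "k mod N < N"
    using N by simp_all
  moreover have "(m + 1) * N = m * N + N"
    by (simp add: algebra_simps)
  ultimately have "m * N \<le> k" "k + 1 \<le> (m + 1) * N"
    by linarith+
  then have "real_of_int (m * N) \<le> real_of_int k" "real_of_int (k + 1) \<le> real_of_int ((m + 1) * N)"
    by (simp_all only: of_int_le_iff)
  then have mk: "real_of_int m * 2 ^ n \<le> k" "real_of_int k + 1 \<le> (m + 1) * 2 ^ n"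
    by (simp_all add: N_def)
  define u v w where uvw_def: "u = real_of_int k / 2 ^ (n + 1)" "v = (real_of_int k + 1) / 2 ^ (n + 1)"
    "w = (2 * real_of_int k + 1) / 2 ^ (n + 2)"
  have uv: "of_int m / 2 \<le> u" "u \<le> v" "v \<le> (of_int m + 1) / 2" "w = (u + v) / 2"
    using mk by (simp_all add: uvw_def field_simps)
  have even: "tent x = x - of_int j" if "m = 2 * j" "of_int m / 2 \<le> x" "x \<le> (of_int m + 1) / 2" for x j
  proof -
    have "\<lfloor>x\<rfloor> = j"
      using that by (simp add: floor_eq_iff)
    then show ?thesis
      using that by (simp add: tent_def frac_def min_def)
  qed
  have odd: "tent x = of_int j + 1 - x" if "m = 2 * j + 1" "of_int m / 2 \<le> x" "x \<le> (of_int m + 1) / 2" for x j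
  \<comment> \<open>At the right endpoint the floor jumps to \<open>j + 1\<close>; there both sides
    are 0.\<close>
  proof (cases "x = of_int j + 1")
    case True
    then show ?thesis
      using tent_of_int[of "j + 1"] by simp
  next
    case False
    then have "\<lfloor>x\<rfloor> = j"
      using that by (simp add: floor_eq_iff)
    then show ?thesis
      using that by (simp add: tent_def frac_def min_def)
  qed
  have w: "of_int m / 2 \<le> w" "w \<le> (of_int m + 1) / 2"
    using uv by argo+
  have u: "u \<le> (of_int m + 1) / 2" and v: "of_int m / 2 \<le> v"
    using uv by auto
  show ?thesis
    unfolding uvw_def(1,2,3)[symmetric]
  proof (cases "even m")
    case True
    then obtain j where j: "m = 2 * j" by blast
    show "tent w = (tent u + tent v) / 2"
      using even[OF j uv(1) u] even[OF j v uv(3)] even[OF j w] uv(4) by argo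
  next
    case False
    then obtain j where j: "m = 2 * j + 1" by (rule oddE)
    show "tent w = (tent u + tent v) / 2"
      using odd[OF j uv(1) u] odd[OF j v uv(3)] odd[OF j w] uv(4) by argo
  qed
qed

text \<open>The excess of the midpoint over the mean of the endpoints is 1/2 for unit cells, where
  the tent has its peak and the Takagi function vanishes at the ends. Doubling the argument leads
  from level n+1 to level n; the affine tent adds no excess, and \<open>takagi_rec\<close> halves
  the old one.\<close>

lemma takagi_midpoint:
  fixes k :: int
  shows "takagi ((2 * of_int k + 1) / 2 ^ Suc n) =
    (takagi (of_int k / 2 ^ n) + takagi ((of_int k + 1) / 2 ^ n)) / 2 + 1 / 2 ^ Suc n"
proof (induction n)
  case 0
  have "2 * ((2 * of_int k + 1) / 2) = real_of_int (2 * k + 1)"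
    by simp
  then have "takagi ((2 * of_int k + 1) / 2) = tent ((2 * of_int k + 1) / 2) + takagi (of_int (2 * k + 1)) / 2"
    by (subst takagi_rec) (simp only:)
  moreover have "tent ((2 * of_int k + 1) / 2) = 1 / 2"
  proof -
    have "(2 * of_int k + 1) / 2 = real_of_int k + 1 / 2"
      by simp
    moreover have "\<lfloor>real_of_int k + 1 / 2\<rfloor> = k"
      by (simp add: floor_eq_iff)
    ultimately show ?thesis
      by (simp only: tent_def frac_def)
  qed
  moreover have "takagi (real_of_int k) = 0" "takagi (real_of_int k + 1) = 0"
    using takagi_of_int[of k] takagi_of_int[of "k + 1"] by simp_all
  ultimately show ?case
    by (simp add: takagi_of_int[of "2 * k + 1", simplified])
next
  case (Suc n)
  have half: "2 * (x / 2 ^ Suc i) = x / 2 ^ i" for x :: real and i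
    by simp
  have "takagi ((2 * of_int k + 1) / 2 ^ Suc (Suc n)) =
    tent ((2 * of_int k + 1) / 2 ^ (n + 2)) + takagi ((2 * of_int k + 1) / 2 ^ Suc n) / 2"
    by (subst takagi_rec) (simp only: half add_2_eq_Suc')
  also have "\<dots> = (tent (of_int k / 2 ^ Suc n) + takagi (of_int k / 2 ^ n) / 2
     + (tent ((of_int k + 1) / 2 ^ Suc n) + takagi ((of_int k + 1) / 2 ^ n) / 2)) / 2 + 1 / 2 ^ Suc (Suc n)"
    unfolding tent_midpoint Suc.IH by (simp add: field_simps)
  also have "\<dots> = (takagi (of_int k / 2 ^ Suc n) + takagi ((of_int k + 1) / 2 ^ Suc n)) / 2 + 1 / 2 ^ Suc (Suc n)"
    by (subst (3 4) takagi_rec) (simp only: half)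
  finally show ?case .
qed

definition dyadic_slope :: "nat \<Rightarrow> int \<Rightarrow> real" where
  "dyadic_slope n k = 2 ^ n * (takagi ((of_int k + 1) / 2 ^ n) - takagi (of_int k / 2 ^ n))"

text \<open>The midpoint excess 1/2^(n+1), divided by the length of half a cell, contributes exactly
  +1 on the left half and -1 on the right half.\<close>

lemma dyadic_slope_Suc:
  "dyadic_slope (Suc n) (2 * k) = dyadic_slope n k + 1"
  "dyadic_slope (Suc n) (2 * k + 1) = dyadic_slope n k - 1"
proof -
  have e: "real_of_int (2 * k) / 2 ^ Suc n = of_int k / 2 ^ n"
    "(real_of_int (2 * k + 1) + 1) / 2 ^ Suc n = (of_int k + 1) / 2 ^ n"
    by (simp_all add: field_simps)
  have m: "real_of_int (2 * k) + 1 = 2 * of_int k + 1" "real_of_int (2 * k + 1) = 2 * of_int k + 1"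
    by simp_all
  show "dyadic_slope (Suc n) (2 * k) = dyadic_slope n k + 1"
    "dyadic_slope (Suc n) (2 * k + 1) = dyadic_slope n k - 1"
    unfolding dyadic_slope_def e unfolding m takagi_midpoint by (simp_all add: field_simps)
qed

lemma dyadic_cells:
  fixes x :: real
  assumes "0 \<le> x" "x \<le> 1"
  obtains k :: "nat \<Rightarrow> int" where
    "\<And>n. 0 \<le> k n" "\<And>n. k n + 1 \<le> 2 ^ n"
    "\<And>n. of_int (k n) / 2 ^ n \<le> x" "\<And>n. x \<le> (of_int (k n) + 1) / 2 ^ n"
    "\<And>n. k (Suc n) = 2 * k n \<or> k (Suc n) = 2 * k n + 1"
proof (cases "x = 1")
  case True
  \<comment> \<open>At x = 1 the floor would select the cell to the right of 1, so the last cell of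
    the unit interval is taken instead.\<close>
  show thesis
    by (rule that[of "\<lambda>n. 2 ^ n - 1"]) (auto simp: True)
next
  case False
  let ?k = "\<lambda>n. \<lfloor>x * 2 ^ n\<rfloor>"
  have le: "of_int (?k n) \<le> x * 2 ^ n" "x * 2 ^ n < of_int (?k n) + 1" for n
    by linarith+
  show thesis
  proof (rule that[of ?k])
    fix n
    show "0 \<le> ?k n"
      using assms by simp
    have "x * 2 ^ n < 2 ^ n"
      using assms False by simp
    then have "?k n < 2 ^ n"
      by (simp add: floor_less_iff)
    then show "?k n + 1 \<le> 2 ^ n"
      by simp
    show "of_int (?k n) / 2 ^ n \<le> x" "x \<le> (of_int (?k n) + 1) / 2 ^ n"
      using le[of n] by (simp_all add: field_simps)
    have "x * 2 ^ Suc n = 2 * (x * 2 ^ n)"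
      by simp
    then show "?k (Suc n) = 2 * ?k n \<or> ?k (Suc n) = 2 * ?k n + 1"
      by linarith
  qed
qed

text \<open>Near \<open>x\<close>, the slope of every dyadic cell containing \<open>x\<close> would
  be within 1/4 of \<open>L\<close>, but the slopes of two successive cells differ by 1. Any
  tolerance below 1/2 gives this contradiction. The estimate is assumed at rational points only, as
  these are the ones known to be in the model.\<close>

lemma takagi_no_derivative:
  fixes x L :: real
  assumes x: "0 \<le> x" "x \<le> 1"
    and d: "0 < d"
    and deriv: "\<And>q::rat. 0 \<le> real_of_rat q \<Longrightarrow> of_rat q \<le> (1::real) \<Longrightarrow> of_rat q \<noteq> x \<Longrightarrow> \<bar>of_rat q - x\<bar> < d \<Longrightarrow>
       \<bar>takagi (of_rat q) - takagi x - L * (of_rat q - x)\<bar> \<le> 1 / 4 * \<bar>of_rat q - x\<bar>"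
  shows False
proof -
  obtain k :: "nat \<Rightarrow> int" where k: "\<And>n. 0 \<le> k n" "\<And>n. k n + 1 \<le> 2 ^ n"
    "\<And>n. of_int (k n) / 2 ^ n \<le> x" "\<And>n. x \<le> (of_int (k n) + 1) / 2 ^ n"
    "\<And>n. k (Suc n) = 2 * k n \<or> k (Suc n) = 2 * k n + 1"
    using dyadic_cells[OF x] by metis
  obtain N where N: "1 / 2 ^ N < d"
    using ex_inverse_power_less[OF d] by blast
  have slope: "\<bar>dyadic_slope n (k n) - L\<bar> \<le> 1 / 4" if "n \<ge> N" for n
  proof -
    let ?u = "real_of_int (k n) / 2 ^ n" and ?v = "(real_of_int (k n) + 1) / 2 ^ n"
    have "1 / 2 ^ n \<le> 1 / (2::real) ^ N"
      using that by (simp add: frac_le)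
    with N have nd: "1 / 2 ^ n < d" by simp
    have vu: "?v = ?u + 1 / 2 ^ n"
      by (simp add: add_divide_distrib)
    have rat: "\<exists>q::rat. ?u = of_rat q" "\<exists>q::rat. ?v = of_rat q"
      by (rule exI[of _ "of_int (k n) / 2 ^ n"], simp add: of_rat_divide of_rat_power)
         (rule exI[of _ "(of_int (k n) + 1) / 2 ^ n"], simp add: of_rat_divide of_rat_power of_rat_add)
    have "real_of_int (k n + 1) \<le> real_of_int (2 ^ n)"
      using k(2)[of n] by (simp only: of_int_le_iff)
    then have v1: "?v \<le> 1"
      by simp
    have u0: "0 \<le> ?u"
      using k(1)[of n] by simp
    have est: "\<bar>takagi y - takagi x - L * (y - x)\<bar> \<le> 1 / 4 * \<bar>y - x\<bar>"
      if y_cases: "y = ?u \<or> y = ?v" for y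
    proof (cases "y = x")
      case False
      obtain q :: rat where q: "y = of_rat q"
        using y_cases rat by metis
      have y: "0 \<le> y" "y \<le> 1" "\<bar>y - x\<bar> < d"
        using y_cases u0 v1 vu nd k(3)[of n] k(4)[of n] by (smt (verit))+
      show ?thesis
        using deriv[of q] y False unfolding q by blast
    qed simp
    have "\<bar>takagi ?v - takagi ?u - L * (?v - ?u)\<bar> \<le> 1 / 4 * (?v - ?u)"
    proof -
      have "takagi ?v - takagi ?u - L * (?v - ?u) =
        (takagi ?v - takagi x - L * (?v - x)) - (takagi ?u - takagi x - L * (?u - x))"
        by (simp add: algebra_simps)
      \<comment> \<open>Since \<open>x\<close> lies between the endpoints, the two errors add up to
        a quarter of the length of the cell.\<close>
      moreover have "\<bar>?v - x\<bar> + \<bar>?u - x\<bar> = ?v - ?u"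
        using k(3)[of n] k(4)[of n] by linarith
      ultimately show ?thesis
        using est[of ?u] est[of ?v] by argo
    qed
    then have "2 ^ n * \<bar>takagi ?v - takagi ?u - L * (1 / 2 ^ n)\<bar> \<le> 2 ^ n * (1 / 4 * (1 / 2 ^ n))"
      unfolding vu by (intro mult_left_mono) auto
    moreover have "2 ^ n * \<bar>takagi ?v - takagi ?u - L * (1 / 2 ^ n)\<bar>
        = \<bar>2 ^ n * (takagi ?v - takagi ?u - L * (1 / 2 ^ n))\<bar>"
      by (simp add: abs_mult)
    moreover have "2 ^ n * (takagi ?v - takagi ?u - L * (1 / 2 ^ n)) = dyadic_slope n (k n) - L"
      by (simp add: dyadic_slope_def algebra_simps)
    ultimately show ?thesis
      by simp
  qed
  have "\<bar>dyadic_slope (Suc N) (k (Suc N)) - dyadic_slope N (k N)\<bar> = 1"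
    using k(5)[of N] dyadic_slope_Suc[of N "k N"] by auto
  then show False
    using slope[OF order_refl] slope[of "Suc N", OF le_SucI[OF order_refl]] by argo
qed


section \<open>The second-order part of the model\<close>

fun ntuple :: "nat list \<Rightarrow> nat" where
  "ntuple [] = 0"
| "ntuple [s] = s"
| "ntuple (s # t # ss) = npr s (ntuple (t # ss))"

definition nseg :: "(nat \<Rightarrow> nat) \<Rightarrow> nat \<Rightarrow> nat" where
  "nseg g = rec_nat 0 (\<lambda>k s. npr s (g k) + 1)"

text \<open>The set \<open>M\<close> bounds the function quantifiers: \<open>M1\<close> gives truth
  in the model, \<open>UNIV\<close> truth in Baire space.\<close>

fun nalternate :: "(nat \<Rightarrow> nat) set \<Rightarrow> bool \<Rightarrow> nat \<Rightarrow> (nat \<Rightarrow> nat) list \<Rightarrow> (nat \<Rightarrow> nat) \<Rightarrow> bool" where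
  "nalternate M ex 0 gs f \<longleftrightarrow>
     (if ex then \<exists>n. f (ntuple (map (\<lambda>g. nseg g n) (rev gs))) = 0
            else \<forall>n. f (ntuple (map (\<lambda>g. nseg g n) (rev gs))) = 0)"
| "nalternate M ex (Suc k) gs f \<longleftrightarrow>
     (if ex then \<exists>g\<in>M. nalternate M False k (g # gs) f
            else \<forall>g\<in>M. nalternate M True k (g # gs) f)"

type_synonym fun_op = "(nat \<Rightarrow> nat) \<Rightarrow> (nat \<Rightarrow> nat) \<Rightarrow> nat \<Rightarrow> nat"

definition row :: "(nat \<Rightarrow> nat) \<Rightarrow> nat \<Rightarrow> nat \<Rightarrow> nat" where
  "row G p = (\<lambda>i. G (prod_encode (p, i)))"

definition uncurry :: "(nat \<Rightarrow> nat \<Rightarrow> nat) \<Rightarrow> nat \<Rightarrow> nat" where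
  "uncurry u = (\<lambda>p. case prod_decode p of (i, j) \<Rightarrow> u i j)"

definition rows_op :: "((nat \<Rightarrow> nat) \<Rightarrow> nat \<Rightarrow> nat) \<Rightarrow> fun_op" where
  "rows_op \<Phi> = (\<lambda>G h. uncurry (\<lambda>p. \<Phi> (row G p)))"

text \<open>Packs several functions into one, so that Skolem functions of any arity become binary
  operations. The code does not determine the length of the list, which is why
  \<open>skolem_op\<close> has the parameter \<open>l\<close>.\<close>

fun list_fun :: "(nat \<Rightarrow> nat) list \<Rightarrow> nat \<Rightarrow> nat" where
  "list_fun [] = (\<lambda>n. 0)"
| "list_fun (g # gs) = (\<lambda>n. prod_encode (g n, list_fun gs n))"

text \<open>For \<open>ex\<close> a witness of an existential quantifier, otherwise a counterexample
  to a universal one. Here \<open>h\<close> carries the \<open>l\<close> functions quantified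
  before, and \<open>k\<close> counts the function quantifiers that follow.\<close>

definition skolem_op :: "nat \<Rightarrow> bool \<Rightarrow> nat \<Rightarrow> fun_op" where
  "skolem_op k ex l = (\<lambda>f h. SOME g. \<exists>gs. length gs = l \<and> list_fun gs = h \<and>
     (nalternate UNIV (\<not> ex) k (g # gs) f \<longleftrightarrow> ex))"

text \<open>Truth is that in Baire space, as \<open>M1\<close> is still to be built;
  \<open>nalternate_M1\<close> shows later that the two agree. The dummy argument \<open>n\<close>
  makes this a functional of type 1 to 1, and \<open>ex_functional2\<close> removes it
  again.\<close>

definition sigma_char :: "nat \<Rightarrow> (nat \<Rightarrow> nat) \<Rightarrow> nat \<Rightarrow> nat" where
  "sigma_char k f n = (if nalternate UNIV True k [] f then 0 else 1)"

definition takagi_code :: "(nat \<Rightarrow> nat) \<Rightarrow> nat \<Rightarrow> nat" where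
  "takagi_code x = real_code (takagi (rval x))"

definition canonical_code :: "(nat \<Rightarrow> nat) \<Rightarrow> nat \<Rightarrow> nat" where
  "canonical_code x = real_code (rval x)"

definition base_funs :: "(nat \<Rightarrow> nat) set" where
  "base_funs = {id, uncurry (\<lambda>i j. i), uncurry (\<lambda>i j. j), uncurry (+), uncurry (*),
      uncurry (\<lambda>i j. of_bool (i = j)), uncurry (\<lambda>i j. of_bool (i < j)),
      uncurry (\<lambda>i j. of_bool (i = 1 \<longrightarrow> j = 1)), uncurry (\<lambda>i j. if i = 0 then j else 0)}
    \<union> range (\<lambda>k n. k) \<union> range (\<lambda>q::rat. real_code (of_rat q))"

text \<open>Unary operations ignore their second argument, so that all can be iterated uniformly.
  The least-number search serves QF-AC, the recursion operation serves \<open>Rec\<close>, the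
  distance is the witness asked for by \<open>rdist_less\<close>, and closure under
  \<open>rows_op \<Phi>\<close> amounts to admissibility of \<open>\<Phi>\<close>.\<close>

definition fun_ops :: "fun_op set" where
  "fun_ops = {\<lambda>f g. f \<circ> g, \<lambda>f g n. prod_encode (f n, g n), \<lambda>G h p. LEAST n. row G p n = 1,
      \<lambda>G h. uncurry (\<lambda>p. uncurry (\<lambda>m. rec_nat m (\<lambda>i j. G (prod_encode (p, prod_encode (i, j)))))),
      \<lambda>f g. real_code \<bar>rval f - rval g\<bar>,
      rows_op takagi_code, rows_op canonical_code}
    \<union> range (\<lambda>p G h. row G p) \<union> range (\<lambda>k. rows_op (sigma_char k))
    \<union> range (\<lambda>(k, ex, l). skolem_op k ex l)"

text \<open>Values on \<open>A\<close> are kept; new functions get pairs with the tag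
  \<open>Suc n\<close>, which no earlier value carries. A row of \<open>G\<close> may itself be new,
  so \<open>y (row G p)\<close> may still be provisional here; \<open>M1_index_rows\<close> works
  one stage later, when the values on the rows are final.\<close>

definition extend_stage ::
    "nat \<Rightarrow> (nat \<Rightarrow> nat) set \<times> ((nat \<Rightarrow> nat) \<Rightarrow> nat) \<Rightarrow> (nat \<Rightarrow> nat) set \<times> ((nat \<Rightarrow> nat) \<Rightarrow> nat)" where
  "extend_stage n S =
     (let A = fst S; y = snd S;
          B = A \<union> (\<Union>\<phi>\<in>fun_ops. \<Union>f\<in>A. \<phi> f ` A) \<union> (\<lambda>G p. y (row G p)) ` A
      in (B, \<lambda>f. if f \<in> A then y f else prod_encode (Suc n, to_nat_on B f)))"

primrec stage :: "nat \<Rightarrow> (nat \<Rightarrow> nat) set \<times> ((nat \<Rightarrow> nat) \<Rightarrow> nat)" where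
  "stage 0 = (base_funs, \<lambda>f. prod_encode (0, to_nat_on base_funs f))"
| "stage (Suc n) = extend_stage n (stage n)"

definition M1 :: "(nat \<Rightarrow> nat) set" where
  "M1 = (\<Union>n. fst (stage n))"

definition index :: "(nat \<Rightarrow> nat) \<Rightarrow> nat" where
  "index f = snd (stage (LEAST n. f \<in> fst (stage n))) f"

section \<open>Stages and the injection\<close>

lemma countable_base_funs: "countable base_funs"
  by (simp add: base_funs_def)

lemma countable_fun_ops: "countable fun_ops"
  by (simp add: fun_ops_def)

lemma countable_stage: "countable (fst (stage n))"
proof (induction n)
  case (Suc n)
  then show ?case
    by (simp add: extend_stage_def Let_def countable_fun_ops)
qed (simp add: countable_base_funs)

lemma fst_stage_Suc:
  "fst (stage (Suc n)) = fst (stage n) \<union> (\<Union>\<phi>\<in>fun_ops. \<Union>f\<in>fst (stage n). \<phi> f ` fst (stage n))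
     \<union> (\<lambda>G p. snd (stage n) (row G p)) ` fst (stage n)"
  by (simp add: extend_stage_def Let_def)

lemma stage_Suc_subset: "fst (stage n) \<subseteq> fst (stage (Suc n))"
  unfolding fst_stage_Suc by blast

lemma stage_Suc_op:
  "\<phi> \<in> fun_ops \<Longrightarrow> f \<in> fst (stage n) \<Longrightarrow> g \<in> fst (stage n) \<Longrightarrow> \<phi> f g \<in> fst (stage (Suc n))"
  unfolding fst_stage_Suc by blast

lemma stage_mono: "n \<le> m \<Longrightarrow> fst (stage n) \<subseteq> fst (stage m)"
  by (rule lift_Suc_mono_le[where f = "\<lambda>n. fst (stage n)"]) (rule stage_Suc_subset)

lemma snd_stage_eq:
  assumes "n \<le> m" "f \<in> fst (stage n)" shows "snd (stage m) f = snd (stage n) f"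
  using assms(1)
proof (induction m rule: dec_induct)
  case (step k)
  have "f \<in> fst (stage k)"
    using stage_mono[OF step.hyps(1)] assms(2) by blast
  then show ?case
    using step.IH by (simp add: extend_stage_def Let_def)
qed simp

lemma index_eq: assumes "f \<in> fst (stage n)" shows "index f = snd (stage n) f"
proof -
  have "f \<in> fst (stage (LEAST n. f \<in> fst (stage n)))"
    using assms by (rule LeastI)
  moreover have "(LEAST n. f \<in> fst (stage n)) \<le> n"
    using assms by (rule Least_le)
  ultimately show ?thesis
    by (simp add: index_def snd_stage_eq)
qed

text \<open>The bound on tags is carried along in the induction to separate the values given at
  stage n+1 from all older ones.\<close>

lemma stage_injective:
  "inj_on (snd (stage n)) (fst (stage n)) \<and> (\<forall>f\<in>fst (stage n). fst (prod_decode (snd (stage n) f)) \<le> n)"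
proof (induction n)
  case 0
  show ?case
    using inj_on_to_nat_on[OF countable_base_funs] by (auto simp: inj_on_def)
next
  case (Suc n)
  let ?A = "fst (stage n)" and ?y = "snd (stage n)" and ?B = "fst (stage (Suc n))"
  have y: "snd (stage (Suc n)) f = (if f \<in> ?A then ?y f else prod_encode (Suc n, to_nat_on ?B f))" for f
    by (simp add: extend_stage_def Let_def)
  have inj: "inj_on (to_nat_on ?B) ?B"
    by (rule inj_on_to_nat_on[OF countable_stage])
  have new: "?y f \<noteq> prod_encode (Suc n, k)" if "f \<in> ?A" for f k
  proof
    assume "?y f = prod_encode (Suc n, k)"
    then have "fst (prod_decode (?y f)) = Suc n"
      by simp
    with Suc that show False
      by force
  qed
  have "f = g" if "f \<in> ?B" "g \<in> ?B" "snd (stage (Suc n)) f = snd (stage (Suc n)) g" for f g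
    using that Suc new inj unfolding y
    by (auto simp: inj_on_def prod_encode_eq split: if_splits dest: sym)
  moreover have "fst (prod_decode (snd (stage (Suc n)) f)) \<le> Suc n" if "f \<in> ?B" for f
    using Suc unfolding y by (auto simp: le_Suc_eq)
  ultimately show ?case
    by (auto simp: inj_on_def)
qed

lemma stage_ex2:
  assumes "f \<in> M1" "g \<in> M1" obtains n where "f \<in> fst (stage n)" "g \<in> fst (stage n)"
proof -
  from assms obtain n m where "f \<in> fst (stage n)" "g \<in> fst (stage m)"
    by (auto simp: M1_def)
  then show thesis
    using stage_mono[of n "max n m"] stage_mono[of m "max n m"] that[of "max n m"] by auto
qed

lemma index_inj: assumes "f \<in> M1" "g \<in> M1" "index f = index g" shows "f = g"
proof -
  obtain n where n: "f \<in> fst (stage n)" "g \<in> fst (stage n)"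
    using stage_ex2[OF assms(1,2)] .
  then show ?thesis
    using assms(3) stage_injective[of n] by (auto simp: index_eq inj_on_def)
qed

lemma M1_op: assumes "\<phi> \<in> fun_ops" "f \<in> M1" "g \<in> M1" shows "\<phi> f g \<in> M1"
proof -
  obtain n where "f \<in> fst (stage n)" "g \<in> fst (stage n)"
    using stage_ex2[OF assms(2,3)] .
  from stage_Suc_op[OF assms(1) this] have "\<phi> f g \<in> fst (stage (Suc n))" .
  then show ?thesis
    unfolding M1_def by blast
qed

text \<open>Taking a row is an operation in \<open>fun_ops\<close>, so all rows of \<open>G\<close>
  are present one stage after \<open>G\<close>, uniformly in \<open>p\<close>. From then on their
  indices are fixed, and the sequence of these indices enters at the next stage.\<close>

lemma M1_index_rows: assumes "G \<in> M1" shows "(\<lambda>p. index (row G p)) \<in> M1"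
proof -
  obtain n where n: "G \<in> fst (stage n)"
    using assms by (auto simp: M1_def)
  have "row G p \<in> fst (stage (Suc n))" for p
  proof -
    have "(\<lambda>G h. row G p) \<in> fun_ops"
      by (auto simp: fun_ops_def)
    from stage_Suc_op[OF this n n] show ?thesis .
  qed
  then have "(\<lambda>p. index (row G p)) = (\<lambda>p. snd (stage (Suc n)) (row G p))"
    by (intro ext index_eq)
  moreover have "G \<in> fst (stage (Suc n))"
    using n stage_Suc_subset by blast
  ultimately have "(\<lambda>p. index (row G p)) \<in> fst (stage (Suc (Suc n)))"
    unfolding fst_stage_Suc[of "Suc n"] by blast
  then show ?thesis
    unfolding M1_def by blast
qed

section \<open>Closure properties of \<open>M1\<close>\<close>

lemma M1_base: "f \<in> base_funs \<Longrightarrow> f \<in> M1"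
  using stage.simps(1) by (auto simp: M1_def intro!: exI[of _ 0])

lemma M1_ident: "(\<lambda>n. n) \<in> M1"
  using M1_base[of id] by (simp add: base_funs_def id_def)

lemma M1_const [simp]: "(\<lambda>n. k) \<in> M1"
  by (rule M1_base) (simp add: base_funs_def)

lemma M1_real_code_rat [simp]: "real_code (of_rat q) \<in> M1"
  by (rule M1_base) (simp add: base_funs_def)

lemma M1_comp: "f \<in> M1 \<Longrightarrow> g \<in> M1 \<Longrightarrow> (\<lambda>n. f (g n)) \<in> M1"
  using M1_op[of "\<lambda>f g. f \<circ> g" f g] by (simp add: fun_ops_def comp_def)

lemma M1_pair: "f \<in> M1 \<Longrightarrow> g \<in> M1 \<Longrightarrow> (\<lambda>n. prod_encode (f n, g n)) \<in> M1"
  using M1_op[of "\<lambda>f g n. prod_encode (f n, g n)" f g] by (simp add: fun_ops_def)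

lemma M1_binary:
  assumes "uncurry u \<in> M1" "f \<in> M1" "g \<in> M1" shows "(\<lambda>n. u (f n) (g n)) \<in> M1"
  using M1_comp[OF assms(1) M1_pair[OF assms(2,3)]] by (simp add: uncurry_def)

lemma uncurry_base:
  "uncurry (\<lambda>i j. i) \<in> M1" "uncurry (\<lambda>i j. j) \<in> M1" "uncurry (+) \<in> M1" "uncurry (*) \<in> M1"
  "uncurry (\<lambda>i j. of_bool (i = j)) \<in> M1" "uncurry (\<lambda>i j. of_bool (i < j)) \<in> M1"
  "uncurry (\<lambda>i j. of_bool (i = 1 \<longrightarrow> j = 1)) \<in> M1" "uncurry (\<lambda>i j. if i = 0 then j else 0) \<in> M1"
  by (rule M1_base; simp add: base_funs_def)+

lemma M1_fst: "f \<in> M1 \<Longrightarrow> (\<lambda>n. fst (prod_decode (f n))) \<in> M1"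
  and M1_snd: "f \<in> M1 \<Longrightarrow> (\<lambda>n. snd (prod_decode (f n))) \<in> M1"
  using M1_comp[OF uncurry_base(1)] M1_comp[OF uncurry_base(2)]
  by (simp_all add: uncurry_def case_prod_unfold)

lemma M1_add: "f \<in> M1 \<Longrightarrow> g \<in> M1 \<Longrightarrow> (\<lambda>n. f n + g n) \<in> M1"
  and M1_mult: "f \<in> M1 \<Longrightarrow> g \<in> M1 \<Longrightarrow> (\<lambda>n. f n * g n) \<in> M1"
  and M1_eq: "f \<in> M1 \<Longrightarrow> g \<in> M1 \<Longrightarrow> (\<lambda>n. of_bool (f n = g n)) \<in> M1"
  and M1_less: "f \<in> M1 \<Longrightarrow> g \<in> M1 \<Longrightarrow> (\<lambda>n. of_bool (f n < g n)) \<in> M1"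
  and M1_imp: "f \<in> M1 \<Longrightarrow> g \<in> M1 \<Longrightarrow> (\<lambda>n. of_bool (f n = 1 \<longrightarrow> g n = 1)) \<in> M1"
  and M1_cond: "f \<in> M1 \<Longrightarrow> g \<in> M1 \<Longrightarrow> (\<lambda>n. if f n = 0 then g n else 0) \<in> M1"
  by (rule M1_binary[OF uncurry_base(3)] M1_binary[OF uncurry_base(4)] M1_binary[OF uncurry_base(5)]
    M1_binary[OF uncurry_base(6)] M1_binary[OF uncurry_base(7)] M1_binary[OF uncurry_base(8)]; assumption)+

lemmas M1_intros = M1_ident M1_const M1_fst M1_snd M1_add M1_mult M1_eq M1_less M1_imp M1_cond

lemma M1_row: "G \<in> M1 \<Longrightarrow> row G p \<in> M1"
  using M1_op[of "\<lambda>G h. row G p" G G] by (simp add: fun_ops_def)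

lemma M1_least: "G \<in> M1 \<Longrightarrow> (\<lambda>p. LEAST n. row G p n = 1) \<in> M1"
  using M1_op[of "\<lambda>G h p. LEAST n. row G p n = 1" G G] by (simp add: fun_ops_def)

lemma M1_rec:
  assumes "G \<in> M1" "f \<in> M1" "g \<in> M1"
  shows "(\<lambda>p. rec_nat (f p) (\<lambda>i j. G (prod_encode (p, prod_encode (i, j)))) (g p)) \<in> M1"
proof -
  have "uncurry (\<lambda>p. uncurry (\<lambda>m. rec_nat m (\<lambda>i j. G (prod_encode (p, prod_encode (i, j)))))) \<in> M1"
    using M1_op[of "\<lambda>G h. uncurry (\<lambda>p. uncurry (\<lambda>m. rec_nat m (\<lambda>i j. G (prod_encode (p, prod_encode (i, j))))))" G G]
      assms(1) by (simp add: fun_ops_def)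
  from M1_comp[OF this M1_pair[OF M1_ident M1_pair[OF assms(2,3)]]] show ?thesis
    by (simp add: uncurry_def)
qed

lemma M1_dist: "f \<in> M1 \<Longrightarrow> g \<in> M1 \<Longrightarrow> real_code \<bar>rval f - rval g\<bar> \<in> M1"
  using M1_op[of "\<lambda>f g. real_code \<bar>rval f - rval g\<bar>" f g] by (simp add: fun_ops_def)

text \<open>
  A function in \<^const>\<open>M1\<close> codes the sequence of its rows. The admissible functionals, those which
  preserve such sequences, will be the objects of type \<open>1 \<rightarrow> 1\<close> of the model.
\<close>

definition admissible :: "((nat \<Rightarrow> nat) \<Rightarrow> nat \<Rightarrow> nat) \<Rightarrow> bool" where
  "admissible \<Phi> \<longleftrightarrow> (\<forall>G\<in>M1. uncurry (\<lambda>p. \<Phi> (row G p)) \<in> M1)"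

lemma admissibleI: "rows_op \<Phi> \<in> fun_ops \<Longrightarrow> admissible \<Phi>"
  using M1_op[of "rows_op \<Phi>"] by (auto simp: admissible_def rows_op_def)

lemma admissible_takagi: "admissible takagi_code"
  and admissible_canonical: "admissible canonical_code"
  and admissible_sigma: "admissible (sigma_char k)"
  by (rule admissibleI; simp add: fun_ops_def)+

lemma row_const: "row (\<lambda>n. f (snd (prod_decode n))) p = f"
  by (simp add: row_def)

lemma row_uncurry [simp]: "row (uncurry u) p = u p"
  by (simp add: row_def uncurry_def)

text \<open>Apply admissibility to the sequence all of whose rows are \<open>f\<close>, and read off
  one row.\<close>

lemma admissible_M1: assumes "admissible \<Phi>" "f \<in> M1" shows "\<Phi> f \<in> M1"
proof -
  have "(\<lambda>n. f (snd (prod_decode n))) \<in> M1"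
    by (intro M1_comp[OF assms(2)] M1_intros)
  then have "uncurry (\<lambda>p. \<Phi> f) \<in> M1"
    using assms(1) by (auto simp: admissible_def row_const)
  from M1_row[OF this] show ?thesis
    by simp
qed

text \<open>Canonical codes of the rows form a sequence in \<open>M1\<close>, and
  \<open>M1_index_rows\<close> applies to it. This functional is the sequence of sets that later
  witnesses ACG.\<close>

lemma admissible_index: "admissible (\<lambda>f n. of_bool (index (canonical_code f) = n))"
  unfolding admissible_def
proof
  fix G assume "G \<in> M1"
  then have "uncurry (\<lambda>p. canonical_code (row G p)) \<in> M1"
    using admissible_canonical by (simp add: admissible_def)
  from M1_index_rows[OF this] have "(\<lambda>p. index (canonical_code (row G p))) \<in> M1"
    by simp
  from M1_comp[OF this M1_fst[OF M1_ident]]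
  have "(\<lambda>n. of_bool (index (canonical_code (row G (fst (prod_decode n)))) = snd (prod_decode n))) \<in> M1"
    by (intro M1_intros)
  then show "uncurry (\<lambda>p n. of_bool (index (canonical_code (row G p)) = n)) \<in> M1"
    by (simp add: uncurry_def case_prod_unfold)
qed

section \<open>Skolem functions and elementarity\<close>

lemma list_fun_M1: "set gs \<subseteq> M1 \<Longrightarrow> list_fun gs \<in> M1"
  by (induction gs) (auto intro: M1_pair)

lemma list_fun_inject:
  "length gs = length hs \<Longrightarrow> list_fun gs = list_fun hs \<Longrightarrow> gs = hs"
  by (induction gs hs rule: list_induct2) (auto simp: fun_eq_iff)

text \<open>For lists of equal length \<open>list_fun\<close> is injective, so the list for which
  the operation chooses a function is \<open>gs\<close> itself.\<close>

lemma skolem_op: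
  assumes "nalternate UNIV (\<not> ex) k (g # gs) f \<longleftrightarrow> ex" "f \<in> M1" "set gs \<subseteq> M1"
  obtains g' where "g' \<in> M1" "nalternate UNIV (\<not> ex) k (g' # gs) f \<longleftrightarrow> ex"
proof
  let ?g = "skolem_op k ex (length gs) f (list_fun gs)"
  have "skolem_op k ex (length gs) = (case (k, ex, length gs) of (k, ex, l) \<Rightarrow> skolem_op k ex l)"
    by simp
  then have "skolem_op k ex (length gs) \<in> fun_ops"
    unfolding fun_ops_def by blast
  then show "?g \<in> M1"
    by (rule M1_op[OF _ assms(2) list_fun_M1[OF assms(3)]])
  have "\<exists>hs. length hs = length gs \<and> list_fun hs = list_fun gs \<and>
     (nalternate UNIV (\<not> ex) k (?g # hs) f \<longleftrightarrow> ex)"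
    unfolding skolem_op_def by (rule someI[where x = g]) (use assms(1) in blast)
  then show "nalternate UNIV (\<not> ex) k (?g # gs) f \<longleftrightarrow> ex"
    using list_fun_inject by metis
qed

text \<open>By closure under Skolem functions, \<^const>\<open>M1\<close> is an elementary substructure of Baire space.\<close>

lemma nalternate_M1:
  "f \<in> M1 \<Longrightarrow> set gs \<subseteq> M1 \<Longrightarrow> nalternate M1 ex k gs f \<longleftrightarrow> nalternate UNIV ex k gs f"
proof (induction k arbitrary: ex gs)
  case (Suc k)
  have IH: "nalternate M1 b k (g # gs) f \<longleftrightarrow> nalternate UNIV b k (g # gs) f" if "g \<in> M1" for g b
    using Suc that by simp
  show ?case
  proof (cases ex)
    case True
    then show ?thesis
      using IH skolem_op[of True k _ gs f] Suc.prems by (metis nalternate.simps(2) UNIV_I)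
  next
    case False
    then show ?thesis
      using IH skolem_op[of False k _ gs f] Suc.prems by (metis nalternate.simps(2) UNIV_I)
  qed
qed simp


section \<open>A term model for all finite types\<close>

text \<open>Terms are untyped: one \<open>KC\<close> and one \<open>SC\<close> serve all types, and
  \<open>C1\<close>, \<open>C2\<close>, \<open>Op\<close> accept arbitrary functions. The logical
  relation below decides which terms are objects of which type.\<close>

datatype cl =
    Num nat
  | C1 "nat \<Rightarrow> nat"
  | C2 "nat \<Rightarrow> nat \<Rightarrow> nat"
  | Op "(nat \<Rightarrow> nat) \<Rightarrow> nat \<Rightarrow> nat"
  | RecC | KC | SC
  | Ap cl cl  (infixl "\<bullet>" 210)

text \<open>Weak head reduction for the two combinators only; constants that need the values of
  their arguments are treated in \<open>ev\<close>.\<close>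

inductive head_step :: "cl \<Rightarrow> cl \<Rightarrow> bool" where
  K: "head_step (KC \<bullet> a \<bullet> b) a"
| S: "head_step (SC \<bullet> a \<bullet> b \<bullet> c) (a \<bullet> c \<bullet> (b \<bullet> c))"
| Ap: "head_step s s' \<Longrightarrow> head_step (s \<bullet> t) (s' \<bullet> t)"

text \<open>
  In the rules for \<^const>\<open>Op\<close> and \<^const>\<open>RecC\<close> the value is a separate variable, since a conclusion
  of the form \<open>\<Phi> g n\<close> makes unification explode in proofs by rule induction.
\<close>

inductive ev :: "cl \<Rightarrow> nat \<Rightarrow> bool" where
  Num: "ev (Num n) n"
| C1: "ev a n \<Longrightarrow> ev (C1 f \<bullet> a) (f n)"
| C2: "ev a n \<Longrightarrow> ev b m \<Longrightarrow> ev (C2 u \<bullet> a \<bullet> b) (u n m)"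
| Op: "(\<And>i. ev (a \<bullet> Num i) (g i)) \<Longrightarrow> ev b n \<Longrightarrow> v = \<Phi> g n \<Longrightarrow> ev (Op \<Phi> \<bullet> a \<bullet> b) v"
| Rec: "(\<And>i j. ev (a \<bullet> Num i \<bullet> Num j) (g i j)) \<Longrightarrow> ev b m \<Longrightarrow> ev c n \<Longrightarrow> v = rec_nat m g n \<Longrightarrow>
    ev (RecC \<bullet> a \<bullet> b \<bullet> c) v"
| head: "head_step s t \<Longrightarrow> ev t n \<Longrightarrow> ev s n"

inductive_simps head_step_simps [simp]:
  "head_step (Num n) t" "head_step (C1 f) t" "head_step (C2 u) t" "head_step (Op \<Phi>) t"
  "head_step RecC t" "head_step KC t" "head_step SC t"
  "head_step (C1 f \<bullet> a) t" "head_step (C2 u \<bullet> a) t" "head_step (Op \<Phi> \<bullet> a) t"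
  "head_step (RecC \<bullet> a) t" "head_step (KC \<bullet> a) t" "head_step (SC \<bullet> a) t"
  "head_step (C2 u \<bullet> a \<bullet> b) t" "head_step (Op \<Phi> \<bullet> a \<bullet> b) t" "head_step (RecC \<bullet> a \<bullet> b) t"
  "head_step (SC \<bullet> a \<bullet> b) t" "head_step (KC \<bullet> a \<bullet> b) t"
  "head_step (RecC \<bullet> a \<bullet> b \<bullet> c) t" "head_step (SC \<bullet> a \<bullet> b \<bullet> c) t"

lemma head_step_unique: "head_step s t \<Longrightarrow> head_step s t' \<Longrightarrow> t = t'"
proof (induction s t arbitrary: t' rule: head_step.induct)
  case (Ap s s' t)
  from Ap.prems show ?case
  proof cases
    case K
    then show ?thesis using Ap.hyps by simp
  next
    case S
    then show ?thesis using Ap.hyps by simp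
  next
    case (Ap s'')
    then show ?thesis using \<open>\<And>t'. head_step s t' \<Longrightarrow> s' = t'\<close> by simp
  qed
qed simp_all

inductive_cases ev_cases:
  "ev (Num n) m" "ev (C1 f \<bullet> a) m" "ev (C2 u \<bullet> a \<bullet> b) m" "ev (Op \<Phi> \<bullet> a \<bullet> b) m"
  "ev (RecC \<bullet> a \<bullet> b \<bullet> c) m"

lemma ev_RecC:
  assumes "ev (RecC \<bullet> a \<bullet> b \<bullet> c) m"
  shows "\<exists>g k n. m = rec_nat k g n \<and> (\<forall>i j. ev (a \<bullet> Num i \<bullet> Num j) (g i j)) \<and> ev b k \<and> ev c n"
  using assms by (rule ev_cases(5)) (metis, simp)

lemma ev_Op:
  assumes "ev (Op \<Phi> \<bullet> a \<bullet> b) m"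
  shows "\<exists>g n. m = \<Phi> g n \<and> (\<forall>i. ev (a \<bullet> Num i) (g i)) \<and> ev b n"
  using assms by (rule ev_cases(4)) (metis, simp)

lemma ev_unique: "ev t n \<Longrightarrow> ev t m \<Longrightarrow> n = m"
proof (induction t n arbitrary: m rule: ev.induct)
  case (Num n)
  show ?case
    using Num.prems by (rule ev_cases(1)) simp_all
next
  case (C1 a n f)
  obtain n' where "m = f n'" "ev a n'"
    using C1.prems by (rule ev_cases(2)) (blast, simp)
  with C1.IH[of n'] show ?case by simp
next
  case (C2 a n b k u)
  obtain n' k' where "m = u n' k'" "ev a n'" "ev b k'"
    using C2.prems by (rule ev_cases(3)) (blast, simp)
  with C2.IH(1)[of n'] C2.IH(2)[of k'] show ?case by simp
next
  case (Op a g b n v \<Phi>)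
  obtain g' n' where *: "m = \<Phi> g' n'" "\<forall>i. ev (a \<bullet> Num i) (g' i)" "ev b n'"
    using ev_Op[OF Op.prems] by blast
  have "g = g'"
  proof
    fix i show "g i = g' i"
      by (rule Op.IH(1)) (rule *(2)[rule_format])
  qed
  then show ?case
    using Op.hyps(3) *(1) Op.IH(2)[OF *(3)] by (simp only:)
next
  case (Rec a g b k c n v)
  obtain g' k' n' where *: "m = rec_nat k' g' n'" "\<forall>i j. ev (a \<bullet> Num i \<bullet> Num j) (g' i j)" "ev b k'" "ev c n'"
    using ev_RecC[OF Rec.prems] by blast
  have "g = g'"
  proof (rule ext, rule ext)
    fix i j show "g i j = g' i j"
      by (rule Rec.IH(1)) (rule *(2)[rule_format])
  qed
  then show ?case
    using Rec.hyps(4) *(1) Rec.IH(2)[OF *(3)] Rec.IH(3)[OF *(4)] by (simp only:)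
next
  case (head s t n)
  have "ev t m"
    using head.prems
  proof cases
    case (head t')
    then show ?thesis using head_step_unique[OF \<open>head_step s t\<close>] by simp
  qed (use head.hyps(1) in simp_all)
  then show ?case by (rule head.IH)
qed

text \<open>
  A Kripke logical relation on families of closed terms indexed by the natural numbers: at type 0
  the values of a family have to form a function in \<^const>\<open>M1\<close>. The reindexing \<open>h\<close> makes the
  relation stable under the formation of families of families.
\<close>

fun rel :: "ty \<Rightarrow> (nat \<Rightarrow> cl) \<Rightarrow> (nat \<Rightarrow> cl) \<Rightarrow> bool" where
  "rel \<zero> T T' \<longleftrightarrow> (\<exists>g\<in>M1. \<forall>p. ev (T p) (g p) \<and> ev (T' p) (g p))"
| "rel (\<sigma> \<rightarrow> \<tau>) T T' \<longleftrightarrow>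
    (\<forall>h\<in>M1. \<forall>A A'. rel \<sigma> A A' \<longrightarrow> rel \<tau> (\<lambda>p. T (h p) \<bullet> A p) (\<lambda>p. T' (h p) \<bullet> A' p))"

declare rel.simps(2) [simp del]

section \<open>The logical relation as an equality between objects\<close>

lemma rel_ArrI:
  "(\<And>h A A'. h \<in> M1 \<Longrightarrow> rel \<sigma> A A' \<Longrightarrow> rel \<tau> (\<lambda>p. T (h p) \<bullet> A p) (\<lambda>p. T' (h p) \<bullet> A' p))
    \<Longrightarrow> rel (\<sigma> \<rightarrow> \<tau>) T T'"
  by (simp add: rel.simps(2))

lemma rel_ArrD:
  "rel (\<sigma> \<rightarrow> \<tau>) T T' \<Longrightarrow> h \<in> M1 \<Longrightarrow> rel \<sigma> A A' \<Longrightarrow> rel \<tau> (\<lambda>p. T (h p) \<bullet> A p) (\<lambda>p. T' (h p) \<bullet> A' p)"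
  by (simp add: rel.simps(2))

lemma rel_0I:
  "g \<in> M1 \<Longrightarrow> (\<And>p. ev (T p) (g p)) \<Longrightarrow> (\<And>p. ev (T' p) (g p)) \<Longrightarrow> rel \<zero> T T'"
  by auto

lemma rel_app: "rel (\<sigma> \<rightarrow> \<tau>) T T' \<Longrightarrow> rel \<sigma> A A' \<Longrightarrow> rel \<tau> (\<lambda>p. T p \<bullet> A p) (\<lambda>p. T' p \<bullet> A' p)"
  by (rule rel_ArrD[OF _ M1_ident])

lemma rel_reindex: "rel \<tau> T T' \<Longrightarrow> h \<in> M1 \<Longrightarrow> rel \<tau> (\<lambda>p. T (h p)) (\<lambda>p. T' (h p))"
proof (induction \<tau> arbitrary: T T')
  case Ty0
  then obtain g where "g \<in> M1" "\<And>p. ev (T p) (g p) \<and> ev (T' p) (g p)"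
    by auto
  then show ?case
    using M1_comp[OF _ Ty0.prems(2), of g] by (auto intro!: bexI[of _ "\<lambda>p. g (h p)"])
next
  case (Arr \<sigma> \<tau>)
  show ?case
  proof (rule rel_ArrI)
    fix k A A' assume "k \<in> M1" "rel \<sigma> A A'"
    then show "rel \<tau> (\<lambda>p. T (h (k p)) \<bullet> A p) (\<lambda>p. T' (h (k p)) \<bullet> A' p)"
      using rel_ArrD[OF Arr.prems(1) M1_comp[OF Arr.prems(2)]] by blast
  qed
qed

lemma rel_sym: "rel \<tau> T T' \<Longrightarrow> rel \<tau> T' T"
proof (induction \<tau> arbitrary: T T')
  case (Arr \<sigma> \<tau>)
  show ?case
    by (rule rel_ArrI) (blast intro: Arr.IH rel_ArrD[OF Arr.prems])
qed auto

text \<open>At an arrow type the first pair is applied to \<open>A\<close> and \<open>A\<close>, the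
  second to \<open>A\<close> and \<open>A'\<close>; that \<open>A\<close> is related to itself
  follows from symmetry and transitivity at the argument type.\<close>

lemma rel_trans: "rel \<tau> T T' \<Longrightarrow> rel \<tau> T' T'' \<Longrightarrow> rel \<tau> T T''"
proof (induction \<tau> arbitrary: T T' T'')
  case Ty0
  then obtain g g' where "g \<in> M1" "\<And>p. ev (T p) (g p)" "\<And>p. ev (T' p) (g p)"
    "\<And>p. ev (T' p) (g' p)" "\<And>p. ev (T'' p) (g' p)"
    by auto
  moreover from this have "g = g'"
    by (blast intro: ev_unique)
  ultimately show ?case by auto
next
  case (Arr \<sigma> \<tau>)
  show ?case
  proof (rule rel_ArrI)
    fix h A A' assume h: "h \<in> M1" and A: "rel \<sigma> A A'"
    then have "rel \<sigma> A A"
      by (blast intro: Arr.IH(1) rel_sym)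
    from Arr.IH(2)[OF rel_ArrD[OF Arr.prems(1) h this] rel_ArrD[OF Arr.prems(2) h A]]
    show "rel \<tau> (\<lambda>p. T (h p) \<bullet> A p) (\<lambda>p. T'' (h p) \<bullet> A' p)" .
  qed
qed

text \<open>Closure under head expansion, by which \<open>KC\<close> and \<open>SC\<close> become
  objects of all their types: a head step persists when the term is applied to further
  arguments.\<close>

lemma rel_head_step:
  "(\<And>p. head_step (T p) (U p)) \<Longrightarrow> (\<And>p. head_step (T' p) (U' p)) \<Longrightarrow> rel \<tau> U U' \<Longrightarrow> rel \<tau> T T'"
proof (induction \<tau> arbitrary: T T' U U')
  case Ty0
  then obtain g where "g \<in> M1" "\<forall>p. ev (U p) (g p) \<and> ev (U' p) (g p)"
    by auto
  with Ty0.prems(1,2) show ?case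
    by (auto intro!: bexI[of _ g] intro: ev.head)
next
  case (Arr \<sigma> \<tau>)
  show ?case
  proof (rule rel_ArrI)
    fix h A A' assume h: "h \<in> M1" "rel \<sigma> A A'"
    show "rel \<tau> (\<lambda>p. T (h p) \<bullet> A p) (\<lambda>p. T' (h p) \<bullet> A' p)"
      by (rule Arr.IH(2)[OF _ _ rel_ArrD[OF Arr.prems(3) h]]) (auto intro: head_step.Ap Arr.prems)
  qed
qed

text \<open>Constant families yield the equality of the model. Objects remain terms and are not
  identified, so truth of formulas has to be shown invariant under \<open>eqv\<close>.\<close>

definition eqv :: "ty \<Rightarrow> cl \<Rightarrow> cl \<Rightarrow> bool" where
  "eqv \<tau> d e \<longleftrightarrow> rel \<tau> (\<lambda>_. d) (\<lambda>_. e)"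

definition elts :: "ty \<Rightarrow> cl set" where
  "elts \<tau> = {d. eqv \<tau> d d}"

lemma eqv_sym: "eqv \<tau> d e \<Longrightarrow> eqv \<tau> e d"
  by (simp add: eqv_def rel_sym)

lemma eqv_trans: "eqv \<tau> d e \<Longrightarrow> eqv \<tau> e f \<Longrightarrow> eqv \<tau> d f"
  unfolding eqv_def by (rule rel_trans)

lemma eqv_elts: "eqv \<tau> d e \<Longrightarrow> d \<in> elts \<tau>" "eqv \<tau> d e \<Longrightarrow> e \<in> elts \<tau>"
  unfolding elts_def using eqv_sym eqv_trans by blast+

lemma eqv_refl: "d \<in> elts \<tau> \<Longrightarrow> eqv \<tau> d d"
  by (simp add: elts_def)

lemma eqv_app: "eqv (\<sigma> \<rightarrow> \<tau>) d e \<Longrightarrow> eqv \<sigma> a b \<Longrightarrow> eqv \<tau> (d \<bullet> a) (e \<bullet> b)"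
  unfolding eqv_def by (rule rel_app)

lemma elts_app: "d \<in> elts (\<sigma> \<rightarrow> \<tau>) \<Longrightarrow> a \<in> elts \<sigma> \<Longrightarrow> d \<bullet> a \<in> elts \<tau>"
  by (simp add: elts_def eqv_app)

lemma eqv_at: "rel \<tau> T T' \<Longrightarrow> eqv \<tau> (T p) (T' p)"
  unfolding eqv_def using rel_reindex[of \<tau> T T' "\<lambda>_. p"] by simp

text \<open>The uniformity in \<open>M1\<close> is already contained in each family being related to
  itself, so only pointwise equality remains to be asked.\<close>

lemma rel_pointwise:
  "rel \<tau> T T \<Longrightarrow> rel \<tau> T' T' \<Longrightarrow> (\<And>p. eqv \<tau> (T p) (T' p)) \<Longrightarrow> rel \<tau> T T'"
proof (induction \<tau> arbitrary: T T')
  case Ty0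
  then obtain g where g: "g \<in> M1" "\<And>p. ev (T p) (g p)"
    by auto
  have "ev (T' p) (g p)" for p
  proof -
    obtain n where "ev (T p) n" "ev (T' p) n"
      using Ty0.prems(3)[of p] by (auto simp: eqv_def)
    then show ?thesis
      using ev_unique[OF g(2)[of p]] by simp
  qed
  with g show ?case by auto
next
  case (Arr \<sigma> \<tau>)
  show ?case
  proof (rule rel_ArrI)
    fix h A A' assume h: "h \<in> M1" and A: "rel \<sigma> A A'"
    then have AA: "rel \<sigma> A A" "rel \<sigma> A' A'"
      by (blast intro: rel_trans rel_sym)+
    show "rel \<tau> (\<lambda>p. T (h p) \<bullet> A p) (\<lambda>p. T' (h p) \<bullet> A' p)"
      by (rule Arr.IH(2)[OF rel_ArrD[OF Arr.prems(1) h AA(1)] rel_ArrD[OF Arr.prems(2) h AA(2)]])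
        (rule eqv_app[OF Arr.prems(3) eqv_at[OF A]])
  qed
qed

text \<open>By \<open>rel_pointwise\<close>, testing on single objects replaces testing on families.
  Hence the defined equality \<open>eqT\<close> of the object language means
  \<open>eqv\<close>.\<close>

lemma eqv_ext:
  assumes "d \<in> elts (\<sigma> \<rightarrow> \<tau>)" "e \<in> elts (\<sigma> \<rightarrow> \<tau>)"
    and "\<And>a. a \<in> elts \<sigma> \<Longrightarrow> eqv \<tau> (d \<bullet> a) (e \<bullet> a)"
  shows "eqv (\<sigma> \<rightarrow> \<tau>) d e"
  unfolding eqv_def
proof (rule rel_ArrI)
  fix h A A' assume h: "h \<in> M1" and A: "rel \<sigma> A A'"
  then have AA: "rel \<sigma> A A" "rel \<sigma> A' A'"
    by (blast intro: rel_trans rel_sym)+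
  have de: "rel (\<sigma> \<rightarrow> \<tau>) (\<lambda>_. d) (\<lambda>_. d)" "rel (\<sigma> \<rightarrow> \<tau>) (\<lambda>_. e) (\<lambda>_. e)"
    using assms(1,2) by (simp_all add: elts_def eqv_def)
  show "rel \<tau> (\<lambda>p. d \<bullet> A p) (\<lambda>p. e \<bullet> A' p)"
  proof (rule rel_pointwise[OF rel_ArrD[OF de(1) h AA(1)] rel_ArrD[OF de(2) h AA(2)]])
    fix p
    have "A p \<in> elts \<sigma>"
      using eqv_at[OF AA(1)] by (simp add: elts_def)
    then show "eqv \<tau> (d \<bullet> A p) (e \<bullet> A' p)"
      using eqv_trans[OF assms(3) eqv_app[OF eqv_refl[OF assms(2)] eqv_at[OF A]]] by blast
  qed
qed

lemma eqv_Arr_iff: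
  assumes "d \<in> elts (\<sigma> \<rightarrow> \<tau>)" "e \<in> elts (\<sigma> \<rightarrow> \<tau>)"
  shows "eqv (\<sigma> \<rightarrow> \<tau>) d e \<longleftrightarrow> (\<forall>a\<in>elts \<sigma>. eqv \<tau> (d \<bullet> a) (e \<bullet> a))"
  using eqv_ext[OF assms] eqv_app eqv_refl by blast

lemma eqv_head_step: "head_step d e \<Longrightarrow> e \<in> elts \<tau> \<Longrightarrow> eqv \<tau> d e"
proof (induction \<tau> arbitrary: d e)
  case Ty0
  then show ?case
    by (auto simp: eqv_def elts_def intro: ev.head)
next
  case (Arr \<sigma> \<tau>)
  have "d \<in> elts (\<sigma> \<rightarrow> \<tau>)"
    unfolding elts_def eqv_def using Arr.prems
    by (auto simp: elts_def eqv_def intro: rel_head_step[of _ "\<lambda>_. e" _ "\<lambda>_. e"])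
  then show ?case
    using Arr.prems by (intro eqv_ext) (auto intro: Arr.IH head_step.Ap elts_app)
qed

definition val :: "cl \<Rightarrow> nat" where
  "val d = (THE n. ev d n)"

lemma val_eq: "ev d n \<Longrightarrow> val d = n"
  unfolding val_def using ev_unique by blast

lemma eqv_0_iff: "eqv \<zero> d e \<longleftrightarrow> (\<exists>n. ev d n \<and> ev e n)"
  by (auto simp: eqv_def intro!: bexI[of _ "\<lambda>_. k" for k])

lemma elts_0_ev: "d \<in> elts \<zero> \<Longrightarrow> ev d (val d)"
  by (auto simp: elts_def eqv_0_iff val_eq)

lemma eqv_0_val: "eqv \<zero> d e \<longleftrightarrow> d \<in> elts \<zero> \<and> e \<in> elts \<zero> \<and> val d = val e"
  by (metis elts_0_ev eqv_0_iff eqv_elts val_eq)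

lemma Num_elts [simp]: "Num n \<in> elts \<zero>"
  by (auto simp: elts_def eqv_0_iff intro: ev.Num)

lemma val_Num [simp]: "val (Num n) = n"
  by (rule val_eq) (rule ev.Num)

lemma eqv_Num: "d \<in> elts \<zero> \<Longrightarrow> eqv \<zero> d (Num (val d))"
  by (simp add: eqv_0_val)

lemma rel_Num: "g \<in> M1 \<Longrightarrow> rel \<zero> (\<lambda>p. Num (g p)) (\<lambda>p. Num (g p))"
  by (auto intro: ev.Num)

text \<open>Reindex by the first projection and apply to the numerals given by the second: a family
  of type-1 objects becomes one function in \<open>M1\<close>. This is where the reindexing in
  \<open>rel\<close> is needed.\<close>

lemma rel_1_rows:
  assumes "rel \<one> A A'"
  obtains G where "G \<in> M1" "\<And>p i. ev (A p \<bullet> Num i) (row G p i)" "\<And>p i. ev (A' p \<bullet> Num i) (row G p i)"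
proof -
  have "rel \<zero> (\<lambda>p. A (fst (prod_decode p)) \<bullet> Num (snd (prod_decode p)))
      (\<lambda>p. A' (fst (prod_decode p)) \<bullet> Num (snd (prod_decode p)))"
    by (rule rel_ArrD[OF assms M1_fst[OF M1_ident] rel_Num[OF M1_snd[OF M1_ident]]])
  then obtain G where G: "G \<in> M1" "\<And>p. ev (A (fst (prod_decode p)) \<bullet> Num (snd (prod_decode p))) (G p)"
    "\<And>p. ev (A' (fst (prod_decode p)) \<bullet> Num (snd (prod_decode p))) (G p)"
    by auto
  have "ev (A p \<bullet> Num i) (row G p i)" "ev (A' p \<bullet> Num i) (row G p i)" for p i
    using G(2,3)[of "prod_encode (p, i)"] by (simp_all add: row_def)
  with G(1) show thesis
    by (rule that)
qed

lemma rel_00_rows: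
  assumes "rel (\<zero> \<rightarrow> \<one>) A A'"
  obtains G where "G \<in> M1"
    "\<And>p i j. ev (A p \<bullet> Num i \<bullet> Num j) (G (prod_encode (p, prod_encode (i, j))))"
    "\<And>p i j. ev (A' p \<bullet> Num i \<bullet> Num j) (G (prod_encode (p, prod_encode (i, j))))"
proof -
  let ?i = "\<lambda>p. fst (prod_decode (snd (prod_decode p)))" and ?j = "\<lambda>p. snd (prod_decode (snd (prod_decode p)))"
  have "rel \<one> (\<lambda>p. A (fst (prod_decode p)) \<bullet> Num (?i p)) (\<lambda>p. A' (fst (prod_decode p)) \<bullet> Num (?i p))"
    by (rule rel_ArrD[OF assms]) (intro rel_Num M1_intros)+
  then have "rel \<zero> (\<lambda>p. A (fst (prod_decode p)) \<bullet> Num (?i p) \<bullet> Num (?j p))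
      (\<lambda>p. A' (fst (prod_decode p)) \<bullet> Num (?i p) \<bullet> Num (?j p))"
    by (rule rel_app) (intro rel_Num M1_intros)
  then obtain G where G: "G \<in> M1"
    "\<And>p. ev (A (fst (prod_decode p)) \<bullet> Num (?i p) \<bullet> Num (?j p)) (G p)"
    "\<And>p. ev (A' (fst (prod_decode p)) \<bullet> Num (?i p) \<bullet> Num (?j p)) (G p)"
    by auto
  have "ev (A p \<bullet> Num i \<bullet> Num j) (G (prod_encode (p, prod_encode (i, j))))"
    "ev (A' p \<bullet> Num i \<bullet> Num j) (G (prod_encode (p, prod_encode (i, j))))" for p i j
    using G(2,3)[of "prod_encode (p, prod_encode (i, j))"] by simp_all
  with G(1) show thesis
    by (rule that)
qed

section \<open>The constants are objects of the model\<close>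

lemma rel_C1_rows:
  assumes "G \<in> M1" shows "rel \<one> (\<lambda>p. C1 (row G p)) (\<lambda>p. C1 (row G p))"
proof (rule rel_ArrI)
  fix h A A' assume h: "h \<in> M1" "rel \<zero> A A'"
  then obtain a where a: "a \<in> M1" "\<And>p. ev (A p) (a p)" "\<And>p. ev (A' p) (a p)"
    by auto
  have "(\<lambda>p. row G (h p) (a p)) \<in> M1"
    unfolding row_def by (intro M1_comp[OF assms] M1_pair h a)
  with a show "rel \<zero> (\<lambda>p. C1 (row G (h p)) \<bullet> A p) (\<lambda>p. C1 (row G (h p)) \<bullet> A' p)"
    by (intro rel_0I[of "\<lambda>p. row G (h p) (a p)"] ev.C1)
qed

lemma C1_elts: assumes "f \<in> M1" shows "C1 f \<in> elts \<one>"
proof -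
  have "(\<lambda>n. f (snd (prod_decode n))) \<in> M1"
    by (intro M1_comp[OF assms] M1_intros)
  from rel_C1_rows[OF this] show ?thesis
    by (simp add: elts_def eqv_def row_const)
qed

lemma C2_elts: assumes "uncurry u \<in> M1" shows "C2 u \<in> elts (\<zero> \<rightarrow> \<one>)"
  unfolding elts_def eqv_def mem_Collect_eq
proof (intro rel_ArrI)
  fix h A A' k B B' assume "h \<in> M1" "rel \<zero> A A'" and k: "k \<in> M1" and "rel \<zero> B B'"
  then obtain a b where a: "a \<in> M1" "\<And>p. ev (A p) (a p)" "\<And>p. ev (A' p) (a p)"
    and b: "b \<in> M1" "\<And>p. ev (B p) (b p)" "\<And>p. ev (B' p) (b p)"
    by auto
  have "(\<lambda>p. u (a (k p)) (b p)) \<in> M1"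
    by (rule M1_binary[OF assms M1_comp[OF a(1) k] b(1)])
  with a b show "rel \<zero> (\<lambda>p. C2 u \<bullet> A (k p) \<bullet> B p) (\<lambda>p. C2 u \<bullet> A' (k p) \<bullet> B' p)"
    by (intro rel_0I[of "\<lambda>p. u (a (k p)) (b p)"] ev.C2)
qed

text \<open>The arguments form the rows of one \<open>G\<close> in \<open>M1\<close>; admissibility
  collects all values in one function, into which the reindexing and the number argument are
  substituted.\<close>

lemma Op_elts: assumes "admissible \<Phi>" shows "Op \<Phi> \<in> elts (\<one> \<rightarrow> \<one>)"
  unfolding elts_def eqv_def mem_Collect_eq
proof (intro rel_ArrI)
  fix h A A' k B B' assume "h \<in> M1" and A: "rel \<one> A A'" and k: "k \<in> M1" and "rel \<zero> B B'"
  then obtain b where b: "b \<in> M1" "\<And>p. ev (B p) (b p)" "\<And>p. ev (B' p) (b p)"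
    by auto
  obtain G where G: "G \<in> M1" "\<And>p i. ev (A p \<bullet> Num i) (row G p i)" "\<And>p i. ev (A' p \<bullet> Num i) (row G p i)"
    using rel_1_rows[OF A] by blast
  have "uncurry (\<lambda>p. \<Phi> (row G p)) \<in> M1"
    using assms G(1) by (simp add: admissible_def)
  then have "(\<lambda>p. \<Phi> (row G (k p)) (b p)) \<in> M1"
    by (rule M1_binary[OF _ k b(1)])
  with b G show "rel \<zero> (\<lambda>p. Op \<Phi> \<bullet> A (k p) \<bullet> B p) (\<lambda>p. Op \<Phi> \<bullet> A' (k p) \<bullet> B' p)"
    by (intro rel_0I[of "\<lambda>p. \<Phi> (row G (k p)) (b p)"] ev.Op[OF _ _ refl])
qed

lemma RecC_elts: "RecC \<in> elts ((\<zero> \<rightarrow> \<one>) \<rightarrow> \<zero> \<rightarrow> \<one>)"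
  unfolding elts_def eqv_def mem_Collect_eq
proof (intro rel_ArrI)
  fix h A A' k B B' l C C'
  assume "h \<in> M1" and A: "rel (\<zero> \<rightarrow> \<one>) A A'" and k: "k \<in> M1" and "rel \<zero> B B'" and l: "l \<in> M1" and "rel \<zero> C C'"
  then obtain b c where b: "b \<in> M1" "\<And>p. ev (B p) (b p)" "\<And>p. ev (B' p) (b p)"
    and c: "c \<in> M1" "\<And>p. ev (C p) (c p)" "\<And>p. ev (C' p) (c p)"
    by auto
  obtain G where G: "G \<in> M1"
    "\<And>p i j. ev (A p \<bullet> Num i \<bullet> Num j) (G (prod_encode (p, prod_encode (i, j))))"
    "\<And>p i j. ev (A' p \<bullet> Num i \<bullet> Num j) (G (prod_encode (p, prod_encode (i, j))))"
    using rel_00_rows[OF A] by blast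
  \<comment> \<open>The composed reindexing acts on the parameter coordinate alone, so that
    \<open>M1_rec\<close> runs all recursions of the family at once.\<close>
  let ?G = "\<lambda>n. G (prod_encode (k (l (fst (prod_decode n))), snd (prod_decode n)))"
  have "?G \<in> M1"
    by (intro M1_comp[OF G(1)] M1_pair M1_comp[OF k] M1_comp[OF l] M1_intros)
  from M1_rec[OF this M1_comp[OF b(1) l] c(1)]
  have "(\<lambda>p. rec_nat (b (l p)) (\<lambda>i j. G (prod_encode (k (l p), prod_encode (i, j)))) (c p)) \<in> M1"
    by simp
  with b c G show "rel \<zero> (\<lambda>p. RecC \<bullet> A (k (l p)) \<bullet> B (l p) \<bullet> C p) (\<lambda>p. RecC \<bullet> A' (k (l p)) \<bullet> B' (l p) \<bullet> C' p)"
    by (intro rel_0I[of "\<lambda>p. rec_nat (b (l p)) (\<lambda>i j. G (prod_encode (k (l p), prod_encode (i, j)))) (c p)"] ev.Rec[OF _ _ _ refl])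
qed

lemma KC_elts: "KC \<in> elts (\<rho> \<rightarrow> \<tau> \<rightarrow> \<rho>)"
  unfolding elts_def eqv_def mem_Collect_eq
proof (intro rel_ArrI)
  fix h A A' k B B' assume "rel \<rho> A A'" "k \<in> M1"
  then have "rel \<rho> (\<lambda>p. A (k p)) (\<lambda>p. A' (k p))"
    by (rule rel_reindex)
  then show "rel \<rho> (\<lambda>p. KC \<bullet> A (k p) \<bullet> B p) (\<lambda>p. KC \<bullet> A' (k p) \<bullet> B' p)"
    by (rule rel_head_step[rotated 2]) (rule head_step.K)+
qed

lemma SC_elts: "SC \<in> elts ((\<delta> \<rightarrow> \<rho> \<rightarrow> \<tau>) \<rightarrow> (\<delta> \<rightarrow> \<rho>) \<rightarrow> \<delta> \<rightarrow> \<tau>)"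
  unfolding elts_def eqv_def mem_Collect_eq
proof (intro rel_ArrI)
  fix h A A' k B B' l C C'
  assume A: "rel (\<delta> \<rightarrow> \<rho> \<rightarrow> \<tau>) A A'" and k: "k \<in> M1" and B: "rel (\<delta> \<rightarrow> \<rho>) B B'" and l: "l \<in> M1"
    and C: "rel \<delta> C C'"
  have "rel \<tau> (\<lambda>p. A (k (l p)) \<bullet> C p \<bullet> (B (l p) \<bullet> C p)) (\<lambda>p. A' (k (l p)) \<bullet> C' p \<bullet> (B' (l p) \<bullet> C' p))"
    by (rule rel_app[OF rel_ArrD[OF A M1_comp[OF k l] C] rel_ArrD[OF B l C]])
  then show "rel \<tau> (\<lambda>p. SC \<bullet> A (k (l p)) \<bullet> B (l p) \<bullet> C p) (\<lambda>p. SC \<bullet> A' (k (l p)) \<bullet> B' (l p) \<bullet> C' p)"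
    by (rule rel_head_step[rotated 2]) (rule head_step.S)+
qed

lemma elts_nonempty: "\<exists>d. d \<in> elts \<tau>"
  by (induction \<tau>) (auto intro: Num_elts elts_app[OF KC_elts])


section \<open>Satisfaction and soundness\<close>

fun itp :: "(nat \<Rightarrow> cl) \<Rightarrow> tm \<Rightarrow> cl" where
  "itp \<rho> (Var n) = \<rho> n"
| "itp \<rho> Zero = Num 0"
| "itp \<rho> One = Num 1"
| "itp \<rho> Plus = C2 (+)"
| "itp \<rho> Times = C2 (*)"
| "itp \<rho> (Kc _ _) = KC"
| "itp \<rho> (Sc _ _ _) = SC"
| "itp \<rho> Rec = RecC"
| "itp \<rho> (App s t) = itp \<rho> s \<bullet> itp \<rho> t"

fun sat :: "(nat \<Rightarrow> cl) \<Rightarrow> fm \<Rightarrow> bool" where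
  "sat \<rho> (Eq s t) \<longleftrightarrow> val (itp \<rho> s) = val (itp \<rho> t)"
| "sat \<rho> (Less s t) \<longleftrightarrow> val (itp \<rho> s) < val (itp \<rho> t)"
| "sat \<rho> Fls \<longleftrightarrow> False"
| "sat \<rho> (Imp \<phi> \<psi>) \<longleftrightarrow> (sat \<rho> \<phi> \<longrightarrow> sat \<rho> \<psi>)"
| "sat \<rho> (Forall \<tau> \<phi>) \<longleftrightarrow> (\<forall>d\<in>elts \<tau>. sat (case_nat d \<rho>) \<phi>)"

lemma ty_of_App_SomeE:
  assumes "ty_of \<Gamma> (App s t) = Some \<tau>"
  obtains \<sigma> where "ty_of \<Gamma> s = Some (\<sigma> \<rightarrow> \<tau>)" "ty_of \<Gamma> t = Some \<sigma>"
  using assms by (auto split: option.splits ty.splits if_splits)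

lemma rel_itp:
  assumes "\<And>i. i < length \<Gamma> \<Longrightarrow> rel (\<Gamma> ! i) (\<lambda>p. \<rho> p i) (\<lambda>p. \<rho>' p i)"
  shows "ty_of \<Gamma> t = Some \<tau> \<Longrightarrow> rel \<tau> (\<lambda>p. itp (\<rho> p) t) (\<lambda>p. itp (\<rho>' p) t)"
proof (induction t arbitrary: \<tau>)
  case (Var n)
  then show ?case using assms by (auto split: if_splits)
next
  case (App s t)
  from App.prems obtain \<sigma> where "ty_of \<Gamma> s = Some (\<sigma> \<rightarrow> \<tau>)" "ty_of \<Gamma> t = Some \<sigma>"
    by (rule ty_of_App_SomeE)
  then show ?case using rel_app[OF App.IH] by simp
qed (use Num_elts C2_elts[OF uncurry_base(3)] C2_elts[OF uncurry_base(4)] KC_elts SC_elts RecC_elts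
      in \<open>auto simp: elts_def eqv_def simp del: rel.simps\<close>)

lemma eqv_itp:
  assumes "\<And>i. i < length \<Gamma> \<Longrightarrow> eqv (\<Gamma> ! i) (\<rho> i) (\<rho>' i)" "ty_of \<Gamma> t = Some \<tau>"
  shows "eqv \<tau> (itp \<rho> t) (itp \<rho>' t)"
  using rel_itp[of \<Gamma> "\<lambda>_. \<rho>" "\<lambda>_. \<rho>'" t \<tau>] assms by (simp add: eqv_def)

definition typed_env :: "ctx \<Rightarrow> (nat \<Rightarrow> cl) \<Rightarrow> bool" where
  "typed_env \<Gamma> \<rho> \<longleftrightarrow> (\<forall>i<length \<Gamma>. \<rho> i \<in> elts (\<Gamma> ! i))"

lemma typed_env_Nil [simp]: "typed_env [] \<rho>"
  by (simp add: typed_env_def)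

lemma typed_env_Cons: "typed_env (\<tau> # \<Gamma>) \<rho> \<longleftrightarrow> \<rho> 0 \<in> elts \<tau> \<and> typed_env \<Gamma> (\<lambda>i. \<rho> (Suc i))"
  by (auto simp: typed_env_def less_Suc_eq_0_disj)

lemma typed_env_case: "d \<in> elts \<tau> \<Longrightarrow> typed_env \<Gamma> \<rho> \<Longrightarrow> typed_env (\<tau> # \<Gamma>) (case_nat d \<rho>)"
  by (simp add: typed_env_Cons)

lemma itp_elts: "typed_env \<Gamma> \<rho> \<Longrightarrow> ty_of \<Gamma> t = Some \<tau> \<Longrightarrow> itp \<rho> t \<in> elts \<tau>"
  using eqv_itp[of \<Gamma> \<rho> \<rho>] by (simp add: elts_def typed_env_def)

text \<open>The invariance that replaces passing to a quotient; it justifies the substitution rule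
  for equality and the choice of representatives for quantifiers.\<close>

lemma sat_eqv:
  "(\<And>i. i < length \<Gamma> \<Longrightarrow> eqv (\<Gamma> ! i) (\<rho> i) (\<rho>' i)) \<Longrightarrow> wff \<Gamma> \<phi> \<Longrightarrow> sat \<rho> \<phi> \<longleftrightarrow> sat \<rho>' \<phi>"
proof (induction \<phi> arbitrary: \<Gamma> \<rho> \<rho>')
  case (Eq s t)
  have "val (itp \<rho> s) = val (itp \<rho>' s)" "val (itp \<rho> t) = val (itp \<rho>' t)"
    using Eq.prems eqv_itp[of \<Gamma> \<rho> \<rho>' _ \<zero>] unfolding eqv_0_val by simp_all
  then show ?case by simp
next
  case (Less s t)
  have "val (itp \<rho> s) = val (itp \<rho>' s)" "val (itp \<rho> t) = val (itp \<rho>' t)"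
    using Less.prems eqv_itp[of \<Gamma> \<rho> \<rho>' _ \<zero>] unfolding eqv_0_val by simp_all
  then show ?case by simp
next
  case (Imp \<phi> \<psi>)
  then show ?case by (metis sat.simps(4) wff.simps(4))
next
  case (Forall \<tau> \<phi>)
  have "sat (case_nat d \<rho>) \<phi> \<longleftrightarrow> sat (case_nat d \<rho>') \<phi>" if "d \<in> elts \<tau>" for d
  proof (rule Forall.IH)
    show "wff (\<tau> # \<Gamma>) \<phi>" using Forall.prems by simp
    show "eqv ((\<tau> # \<Gamma>) ! i) (case_nat d \<rho> i) (case_nat d \<rho>' i)" if "i < length (\<tau> # \<Gamma>)" for i
      using that \<open>d \<in> elts \<tau>\<close> Forall.prems(1) by (cases i) (auto intro: eqv_refl)
  qed
  then show ?case by simp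
qed simp

lemma sat_eqv_Cons:
  assumes "eqv \<tau> d e" "typed_env \<Gamma> \<rho>" "wff (\<tau> # \<Gamma>) \<phi>"
  shows "sat (case_nat d \<rho>) \<phi> \<longleftrightarrow> sat (case_nat e \<rho>) \<phi>"
proof (rule sat_eqv[OF _ assms(3)])
  fix i assume "i < length (\<tau> # \<Gamma>)"
  then show "eqv ((\<tau> # \<Gamma>) ! i) (case_nat d \<rho> i) (case_nat e \<rho> i)"
    using assms(1,2) by (cases i) (auto simp: typed_env_def intro: eqv_refl)
qed

lemma itp_tsubst: "itp \<rho> (tsubst \<theta> t) = itp (\<lambda>i. itp \<rho> (\<theta> i)) t"
  by (induction t) auto

lemma itp_up: "(\<lambda>i. itp (case_nat d \<rho>) (up \<theta> i)) = case_nat d (\<lambda>i. itp \<rho> (\<theta> i))"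
  by (auto simp: up_def itp_tsubst split: nat.splits)

lemma sat_subst: "sat \<rho> (subst \<theta> \<phi>) \<longleftrightarrow> sat (\<lambda>i. itp \<rho> (\<theta> i)) \<phi>"
  by (induction \<phi> arbitrary: \<rho> \<theta>) (simp_all add: itp_tsubst itp_up)

lemma sat_lift: "sat (case_nat d \<rho>) (lift \<phi>) \<longleftrightarrow> sat \<rho> \<phi>"
  by (simp add: lift_def sat_subst)

lemma sat_inst: "sat \<rho> (inst t \<phi>) \<longleftrightarrow> sat (case_nat (itp \<rho> t) \<rho>) \<phi>"
proof -
  have "(\<lambda>i. itp \<rho> (case i of 0 \<Rightarrow> t | Suc m \<Rightarrow> Var m)) = case_nat (itp \<rho> t) \<rho>"
    by (auto split: nat.splits)
  then show ?thesis
    by (simp add: inst_def sat_subst)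
qed

text \<open>Written so as to be \<open>wenv []\<close> by definition; the values are unspecified,
  and the truth of sentences does not depend on them.\<close>

definition env0 :: "nat \<Rightarrow> cl" where
  "env0 = (\<lambda>i. snd (([] :: (ty \<times> cl) list) ! i))"

section \<open>Typing under substitution, and soundness\<close>

lemma ty_of_tsubst:
  assumes "\<And>i. i < length \<Gamma> \<Longrightarrow> ty_of \<Delta> (\<theta> i) = Some (\<Gamma> ! i)"
  shows "ty_of \<Gamma> t = Some \<tau> \<Longrightarrow> ty_of \<Delta> (tsubst \<theta> t) = Some \<tau>"
proof (induction t arbitrary: \<tau>)
  case (App s t)
  from App.prems obtain \<sigma> where "ty_of \<Gamma> s = Some (\<sigma> \<rightarrow> \<tau>)" "ty_of \<Gamma> t = Some \<sigma>"
    by (rule ty_of_App_SomeE)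
  then show ?case using App.IH by simp
qed (use assms in \<open>auto split: if_splits\<close>)

lemma wff_subst:
  "(\<And>i. i < length \<Gamma> \<Longrightarrow> ty_of \<Delta> (\<theta> i) = Some (\<Gamma> ! i)) \<Longrightarrow> wff \<Gamma> \<phi> \<Longrightarrow> wff \<Delta> (subst \<theta> \<phi>)"
proof (induction \<phi> arbitrary: \<Gamma> \<Delta> \<theta>)
  case (Forall \<tau> \<phi>)
  have "ty_of (\<tau> # \<Delta>) (up \<theta> i) = Some ((\<tau> # \<Gamma>) ! i)" if "i < length (\<tau> # \<Gamma>)" for i
    using that Forall.prems(1)
    by (cases i) (auto simp: up_def intro!: ty_of_tsubst[of \<Delta> "\<tau> # \<Delta>"])
  from Forall.IH[OF this] Forall.prems(2) show ?case by simp
next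
  case (Imp \<phi> \<psi>)
  from Imp.IH[OF Imp.prems(1)] Imp.prems(2) show ?case by simp
qed (auto intro: ty_of_tsubst)

lemma wff_inst: "ty_of \<Gamma> t = Some \<tau> \<Longrightarrow> wff (\<tau> # \<Gamma>) \<phi> \<Longrightarrow> wff \<Gamma> (inst t \<phi>)"
  unfolding inst_def by (erule wff_subst[rotated]) (auto split: nat.splits)

lemma ty_of_append: "ty_of \<Gamma> t = Some \<tau> \<Longrightarrow> ty_of (\<Gamma> @ \<Delta>) t = Some \<tau>"
proof (induction t arbitrary: \<tau>)
  case (App s t)
  from App.prems obtain \<sigma> where "ty_of \<Gamma> s = Some (\<sigma> \<rightarrow> \<tau>)" "ty_of \<Gamma> t = Some \<sigma>"
    by (rule ty_of_App_SomeE)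
  then show ?case using App.IH by simp
qed (auto simp: nth_append split: if_splits)

lemma wff_append: "wff \<Gamma> \<phi> \<Longrightarrow> wff (\<Gamma> @ \<Delta>) \<phi>"
  by (induction \<phi> arbitrary: \<Gamma>) (auto intro: ty_of_append simp flip: append_Cons)

lemma derives_wff: "derives T \<Gamma> H \<phi> \<Longrightarrow> wff \<Gamma> \<phi>"
proof (induction rule: derives.induct)
  case (Ax \<phi> \<Gamma> H)
  then show ?case using wff_append[of "[]" \<phi> \<Gamma>] by simp
qed (auto intro: wff_inst)

text \<open>Axioms are sentences, so their truth in \<open>env0\<close> passes to every environment.
  For \<open>EqSubst\<close>, type-0 terms with the same value are \<open>eqv\<close>, and truth is
  invariant under \<open>eqv\<close>.\<close>

lemma soundness:
  assumes "\<And>\<psi>. \<psi> \<in> T \<Longrightarrow> sat env0 \<psi>"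
  shows "derives T \<Gamma> H \<phi> \<Longrightarrow> typed_env \<Gamma> \<rho> \<Longrightarrow> (\<forall>\<psi>\<in>set H. sat \<rho> \<psi>) \<Longrightarrow> sat \<rho> \<phi>"
proof (induction arbitrary: \<rho> rule: derives.induct)
  case (Ax \<phi> \<Gamma> H)
  then show ?case
    using sat_eqv[of "[]" \<rho> env0 \<phi>] assms by simp
next
  case (RAA \<Gamma> \<phi> H)
  then show ?case by (metis sat.simps(3,4) set_ConsD)
next
  case (ForallI \<tau> \<Gamma> H \<phi>)
  have "sat (case_nat d \<rho>) \<phi>" if "d \<in> elts \<tau>" for d
    by (rule ForallI.IH[OF typed_env_case[OF that ForallI.prems(1)]])
      (use ForallI.prems(2) in \<open>simp add: sat_lift\<close>)
  then show ?case by simp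
next
  case (ForallE \<Gamma> H \<tau> \<phi> t)
  then show ?case by (auto simp: sat_inst intro: itp_elts)
next
  case (EqSubst \<Gamma> H s t \<phi>)
  have "val (itp \<rho> s) = val (itp \<rho> t)"
    using EqSubst.IH(1)[OF EqSubst.prems] by simp
  moreover have "ty_of \<Gamma> s = Some \<zero>" "ty_of \<Gamma> t = Some \<zero>"
    using derives_wff[OF EqSubst.hyps(1)] by simp_all
  ultimately have st: "eqv \<zero> (itp \<rho> s) (itp \<rho> t)"
    using itp_elts[OF EqSubst.prems(1)] by (simp add: eqv_0_val)
  with EqSubst.IH(2)[OF EqSubst.prems] sat_eqv_Cons[OF st EqSubst.prems(1) EqSubst.hyps(2)] show ?case
    by (simp add: sat_inst)
qed auto


section \<open>Evaluating formulas written with named variables\<close>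

text \<open>
  A world lists the object variables in scope together with their types and values. The statement
  \<open>mean W P b\<close> says that the formula \<open>P\<close>, placed in the world \<open>W\<close>, is equivalent to \<open>b\<close>,
  and \<open>den W x \<tau> d\<close> that the term \<open>x\<close> denotes \<open>d\<close> in every extension of \<open>W\<close>.
\<close>

type_synonym world = "(ty \<times> cl) list"

abbreviation wctx :: "world \<Rightarrow> ctx" where "wctx W \<equiv> map fst W"

definition wenv :: "world \<Rightarrow> nat \<Rightarrow> cl" where
  "wenv W = (\<lambda>i. snd (W ! i))"

definition valid :: "world \<Rightarrow> bool" where
  "valid W \<longleftrightarrow> (\<forall>(\<tau>, d)\<in>set W. d \<in> elts \<tau>)"

definition mean :: "world \<Rightarrow> pfm \<Rightarrow> bool \<Rightarrow> bool" where
  "mean W P b \<longleftrightarrow> (valid W \<longrightarrow> (sat (wenv W) (P (wctx W)) \<longleftrightarrow> b))"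

definition den :: "world \<Rightarrow> ptm \<Rightarrow> ty \<Rightarrow> cl \<Rightarrow> bool" where
  "den W x \<tau> d \<longleftrightarrow> (\<forall>V. valid (V @ W) \<longrightarrow>
     ty_of (wctx (V @ W)) (x (wctx (V @ W))) = Some \<tau> \<and> eqv \<tau> (itp (wenv (V @ W)) (x (wctx (V @ W)))) d)"

lemma wenv_Cons: "wenv ((\<tau>, d) # W) = case_nat d (wenv W)"
  by (auto simp: wenv_def nth_Cons split: nat.splits)

lemma valid_Cons: "valid ((\<tau>, d) # W) \<longleftrightarrow> d \<in> elts \<tau> \<and> valid W"
  by (simp add: valid_def)

lemma typed_env_world:
  assumes "valid W" shows "typed_env (wctx W) (wenv W)"
proof -
  have "snd (W ! i) \<in> elts (fst (W ! i))" if "i < length W" for i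
    using assms nth_mem[OF that] unfolding valid_def by (metis case_prodD prod.collapse)
  then show ?thesis
    by (simp add: typed_env_def wenv_def)
qed

lemma den_mono: "den W x \<tau> d \<Longrightarrow> den (V @ W) x \<tau> d"
  unfolding den_def by (metis append.assoc)

lemma den_eqv: "den W x \<tau> d \<Longrightarrow> eqv \<tau> d e \<Longrightarrow> den W x \<tau> e"
  unfolding den_def using eqv_trans by blast

lemma denD:
  assumes "den W x \<tau> d" "valid W"
  shows "ty_of (wctx W) (x (wctx W)) = Some \<tau>" "eqv \<tau> (itp (wenv W) (x (wctx W))) d" "d \<in> elts \<tau>"
  using assms eqv_elts(2) unfolding den_def by (metis append_Nil)+

lemma den_bound:
  assumes "d \<in> elts \<tau>" shows "den ((\<tau>, d) # W) (bound (wctx W)) \<tau> d"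
  unfolding den_def
proof (intro allI impI)
  fix V assume "valid (V @ (\<tau>, d) # W)"
  have "length (wctx (V @ (\<tau>, d) # W)) - Suc (length (wctx W)) = length V"
    by simp
  then have "bound (wctx W) (wctx (V @ (\<tau>, d) # W)) = Var (length V)"
    by (simp add: bound_def)
  then show "ty_of (wctx (V @ (\<tau>, d) # W)) (bound (wctx W) (wctx (V @ (\<tau>, d) # W))) = Some \<tau> \<and>
      eqv \<tau> (itp (wenv (V @ (\<tau>, d) # W)) (bound (wctx W) (wctx (V @ (\<tau>, d) # W)))) d"
    using assms by (simp add: wenv_def nth_append eqv_refl)
qed

lemma den_app: "den W s (\<sigma> \<rightarrow> \<tau>) d \<Longrightarrow> den W t \<sigma> e \<Longrightarrow> den W (s \<cdot> t) \<tau> (d \<bullet> e)"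
  unfolding den_def papp_def by (auto intro: eqv_app)

lemma den_cst:
  assumes "\<And>\<Gamma>. ty_of \<Gamma> c = Some \<tau>" "\<And>\<rho>. itp \<rho> c = d" "d \<in> elts \<tau>"
  shows "den W (cst c) \<tau> d"
  using assms by (simp add: den_def cst_def eqv_refl)

lemma den_consts:
  "den W (cst (Kc \<rho> \<tau>)) (\<rho> \<rightarrow> \<tau> \<rightarrow> \<rho>) KC"
  "den W (cst (Sc \<delta> \<rho> \<tau>)) ((\<delta> \<rightarrow> \<rho> \<rightarrow> \<tau>) \<rightarrow> (\<delta> \<rightarrow> \<rho>) \<rightarrow> \<delta> \<rightarrow> \<tau>) SC"
  "den W (cst Rec) ((\<zero> \<rightarrow> \<one>) \<rightarrow> \<zero> \<rightarrow> \<one>) RecC"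
  "den W (cst Zero) \<zero> (Num 0)" "den W (cst One) \<zero> (Num 1)"
  "den W (cst Plus) (\<zero> \<rightarrow> \<one>) (C2 (+))" "den W (cst Times) (\<zero> \<rightarrow> \<one>) (C2 (*))"
  by (rule den_cst; simp add: KC_elts SC_elts RecC_elts C2_elts uncurry_base)+

text \<open>The proof instantiates \<open>V\<close> with the one new variable; stating the premise
  for any extension and any term denoting \<open>d\<close> keeps nested worlds in the form on which
  \<open>den_mono\<close> operates.\<close>

lemma mean_all:
  assumes "\<And>V x d. d \<in> elts \<tau> \<Longrightarrow> den (V @ W) x \<tau> d \<Longrightarrow> mean (V @ W) (P x) (Q d)"
  shows "mean W (pall \<tau> P) (\<forall>d\<in>elts \<tau>. Q d)"
  unfolding mean_def
proof
  assume W: "valid W"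
  have "sat (case_nat d (wenv W)) (P (bound (wctx W)) (\<tau> # wctx W)) \<longleftrightarrow> Q d" if "d \<in> elts \<tau>" for d
  proof -
    have "den ([(\<tau>, d)] @ W) (bound (wctx W)) \<tau> d"
      using den_bound[OF that] by simp
    from assms[OF that this] show ?thesis
      using W that by (simp add: mean_def valid_Cons wenv_Cons)
  qed
  then show "sat (wenv W) (pall \<tau> P (wctx W)) \<longleftrightarrow> (\<forall>d\<in>elts \<tau>. Q d)"
    by (simp add: pall_def)
qed

lemma mean_not: "mean W P b \<Longrightarrow> mean W (\<^bold>\<not> P) (\<not> b)"
  by (simp add: mean_def pnot_def)

lemma mean_imp: "mean W P b \<Longrightarrow> mean W Q c \<Longrightarrow> mean W (P \<^bold>\<longrightarrow> Q) (b \<longrightarrow> c)"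
  by (simp add: mean_def pimp_def)

lemma mean_or: "mean W P b \<Longrightarrow> mean W Q c \<Longrightarrow> mean W (P \<^bold>\<or> Q) (b \<or> c)"
  by (auto simp: mean_def por_def pimp_def pnot_def)

lemma mean_and: "mean W P b \<Longrightarrow> mean W Q c \<Longrightarrow> mean W (P \<^bold>\<and> Q) (b \<and> c)"
  by (auto simp: mean_def pand_def pimp_def pnot_def)

lemma mean_iff: "mean W P b \<Longrightarrow> mean W Q c \<Longrightarrow> mean W (P \<^bold>\<longleftrightarrow> Q) (b \<longleftrightarrow> c)"
  by (auto simp: mean_def piff_def pand_def pimp_def pnot_def)

lemma mean_cong: "mean W P b \<Longrightarrow> b = c \<Longrightarrow> mean W P c"
  by simp

lemma pex_eq: "pex \<tau> P = (\<^bold>\<not> pall \<tau> (\<lambda>x. \<^bold>\<not> P x))"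
  by (simp add: pex_def pall_def pnot_def)

lemma eqv_ArrD: "eqv (\<sigma> \<rightarrow> \<tau>) d e \<Longrightarrow> a \<in> elts \<sigma> \<Longrightarrow> eqv \<tau> (d \<bullet> a) (e \<bullet> a)"
  using eqv_app eqv_refl by blast

lemma mean_eqT:
  "den W s \<tau> d \<Longrightarrow> den W t \<tau> e \<Longrightarrow> b = eqv \<tau> d e \<Longrightarrow> mean W (eqT \<tau> s t) b"
proof (induction \<tau> arbitrary: W s t d e b)
  case Ty0
  then show ?case
    unfolding mean_def using denD[OF Ty0(1)] denD[OF Ty0(2)] by (auto simp: peq_def eqv_0_val)
next
  case (Arr \<sigma> \<tau>)
  have "mean W (eqT (\<sigma> \<rightarrow> \<tau>) s t) (\<forall>a\<in>elts \<sigma>. eqv \<tau> (d \<bullet> a) (e \<bullet> a))"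
    unfolding eqT.simps
    by (rule mean_all) (rule Arr.IH(2)[OF den_app den_app refl], (rule den_mono, rule Arr.prems | assumption)+)
  moreover have "eqv (\<sigma> \<rightarrow> \<tau>) d e \<longleftrightarrow> (\<forall>a\<in>elts \<sigma>. eqv \<tau> (d \<bullet> a) (e \<bullet> a))" if "valid W"
    by (rule eqv_Arr_iff) (rule denD(3)[OF Arr.prems(1) that], rule denD(3)[OF Arr.prems(2) that])
  ultimately show ?case
    using Arr.prems(3) by (simp add: mean_def)
qed


subsection \<open>Denotations of low type\<close>

text \<open>Together with \<open>C1_elts\<close> this identifies the type-1 objects, up to
  \<open>eqv\<close>, with the functions in \<open>M1\<close>.\<close>

lemma eqv_C1: assumes "d \<in> elts \<one>" obtains f where "f \<in> M1" "eqv \<one> d (C1 f)"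
proof -
  obtain G where G: "G \<in> M1" "\<And>i. ev (d \<bullet> Num i) (row G 0 i)"
    using rel_1_rows[OF assms[unfolded elts_def eqv_def mem_Collect_eq]] by metis
  have f: "row G 0 \<in> M1"
    by (rule M1_row[OF G(1)])
  have "eqv \<one> d (C1 (row G 0))"
  proof (rule eqv_ext[OF assms C1_elts[OF f]])
    fix a assume a: "a \<in> elts \<zero>"
    have "eqv \<zero> (d \<bullet> a) (d \<bullet> Num (val a))"
      by (rule eqv_app[OF eqv_refl[OF assms] eqv_Num[OF a]])
    moreover have "eqv \<zero> (d \<bullet> Num (val a)) (C1 (row G 0) \<bullet> a)"
      using G(2) ev.C1[OF elts_0_ev[OF a]] by (auto simp: eqv_0_iff)
    ultimately show "eqv \<zero> (d \<bullet> a) (C1 (row G 0) \<bullet> a)"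
      by (rule eqv_trans)
  qed
  with f show thesis by (rule that)
qed

lemma eqv_C2: assumes "d \<in> elts (\<zero> \<rightarrow> \<one>)" obtains u where "uncurry u \<in> M1" "eqv (\<zero> \<rightarrow> \<one>) d (C2 u)"
proof -
  obtain G where G: "G \<in> M1" "\<And>i j. ev (d \<bullet> Num i \<bullet> Num j) (G (prod_encode (0, prod_encode (i, j))))"
    using rel_00_rows[OF assms[unfolded elts_def eqv_def mem_Collect_eq]] by metis
  let ?u = "\<lambda>i j. G (prod_encode (0, prod_encode (i, j)))"
  have "uncurry ?u = row G 0"
    by (simp add: uncurry_def row_def case_prod_unfold)
  then have u: "uncurry ?u \<in> M1"
    using M1_row[OF G(1)] by simp
  have "eqv (\<zero> \<rightarrow> \<one>) d (C2 ?u)"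
  proof (rule eqv_ext[OF assms C2_elts[OF u]])
    fix a assume a: "a \<in> elts \<zero>"
    show "eqv \<one> (d \<bullet> a) (C2 ?u \<bullet> a)"
    proof (rule eqv_ext[OF elts_app[OF assms a] elts_app[OF C2_elts[OF u] a]])
      fix b assume b: "b \<in> elts \<zero>"
      have "eqv \<zero> (d \<bullet> a \<bullet> b) (d \<bullet> Num (val a) \<bullet> Num (val b))"
        by (rule eqv_app[OF eqv_app[OF eqv_refl[OF assms] eqv_Num[OF a]] eqv_Num[OF b]])
      moreover have "eqv \<zero> (d \<bullet> Num (val a) \<bullet> Num (val b)) (C2 ?u \<bullet> a \<bullet> b)"
        using G(2) ev.C2[OF elts_0_ev[OF a] elts_0_ev[OF b], of ?u] by (auto simp: eqv_0_iff)
      ultimately show "eqv \<zero> (d \<bullet> a \<bullet> b) (C2 ?u \<bullet> a \<bullet> b)"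
        by (rule eqv_trans)
    qed
  qed
  with u show thesis by (rule that)
qed

lemma ev_C1_app: assumes "eqv \<one> a (C1 f)" shows "ev (a \<bullet> Num i) (f i)"
proof -
  obtain n where "ev (a \<bullet> Num i) n" "ev (C1 f \<bullet> Num i) n"
    using eqv_ArrD[OF assms Num_elts] unfolding eqv_0_iff by blast
  moreover from this have "n = f i"
    using ev_unique[OF _ ev.C1[OF ev.Num]] by blast
  ultimately show ?thesis by simp
qed

lemma ev_Op_app:
  "eqv \<one> a (C1 f) \<Longrightarrow> b \<in> elts \<zero> \<Longrightarrow> ev (Op \<Phi> \<bullet> a \<bullet> b) (\<Phi> f (val b))"
  by (rule ev.Op[OF ev_C1_app elts_0_ev refl])

text \<open>Applying \<open>d\<close> to the family of the rows of \<open>G\<close> shows that its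
  values along a sequence in \<open>M1\<close> form such a sequence again. With
  \<open>Op_elts\<close>, the objects of this type are the admissible functionals.\<close>

lemma eqv_Op:
  assumes "d \<in> elts (\<one> \<rightarrow> \<one>)" obtains \<Phi> where "admissible \<Phi>" "eqv (\<one> \<rightarrow> \<one>) d (Op \<Phi>)"
proof -
  define \<Phi> where "\<Phi> f n = val (d \<bullet> C1 f \<bullet> Num n)" for f n
  have \<Phi>: "ev (d \<bullet> C1 f \<bullet> Num n) (\<Phi> f n)" if "f \<in> M1" for f n
    unfolding \<Phi>_def by (rule elts_0_ev[OF elts_app[OF elts_app[OF assms C1_elts[OF that]] Num_elts]])
  have adm: "admissible \<Phi>"
    unfolding admissible_def
  proof
    fix G assume G: "G \<in> M1"
    have "rel \<one> (\<lambda>p. d \<bullet> C1 (row G p)) (\<lambda>p. d \<bullet> C1 (row G p))"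
      by (rule rel_app[OF assms[unfolded elts_def eqv_def mem_Collect_eq] rel_C1_rows[OF G]])
    from rel_1_rows[OF this] obtain H where H: "H \<in> M1" "\<And>p i. ev (d \<bullet> C1 (row G p) \<bullet> Num i) (row H p i)"
      by metis
    have "\<Phi> (row G p) i = row H p i" for p i
      by (rule ev_unique[OF \<Phi>[OF M1_row[OF G]] H(2)])
    then have "uncurry (\<lambda>p. \<Phi> (row G p)) = H"
      by (simp add: uncurry_def row_def case_prod_unfold)
    with H(1) show "uncurry (\<lambda>p. \<Phi> (row G p)) \<in> M1"
      by simp
  qed
  have "eqv (\<one> \<rightarrow> \<one>) d (Op \<Phi>)"
  proof (rule eqv_ext[OF assms Op_elts[OF adm]])
    fix a assume a: "a \<in> elts \<one>"
    then obtain f where f: "f \<in> M1" "eqv \<one> a (C1 f)"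
      by (rule eqv_C1)
    show "eqv \<one> (d \<bullet> a) (Op \<Phi> \<bullet> a)"
    proof (rule eqv_ext[OF elts_app[OF assms a] elts_app[OF Op_elts[OF adm] a]])
      fix b assume b: "b \<in> elts \<zero>"
      have "eqv \<zero> (d \<bullet> a \<bullet> b) (d \<bullet> C1 f \<bullet> Num (val b))"
        by (rule eqv_app[OF eqv_app[OF eqv_refl[OF assms] f(2)] eqv_Num[OF b]])
      moreover have "eqv \<zero> (d \<bullet> C1 f \<bullet> Num (val b)) (Op \<Phi> \<bullet> a \<bullet> b)"
        using \<Phi>[OF f(1)] ev_Op_app[OF f(2) b] by (auto simp: eqv_0_iff)
      ultimately show "eqv \<zero> (d \<bullet> a \<bullet> b) (Op \<Phi> \<bullet> a \<bullet> b)"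
        by (rule eqv_trans)
    qed
  qed
  with adm show thesis by (rule that)
qed

definition dn0 :: "world \<Rightarrow> ptm \<Rightarrow> nat \<Rightarrow> bool" where
  "dn0 W x n \<longleftrightarrow> den W x \<zero> (Num n)"
definition dn1 :: "world \<Rightarrow> ptm \<Rightarrow> (nat \<Rightarrow> nat) \<Rightarrow> bool" where
  "dn1 W x f \<longleftrightarrow> f \<in> M1 \<and> den W x \<one> (C1 f)"
definition dn00 :: "world \<Rightarrow> ptm \<Rightarrow> (nat \<Rightarrow> nat \<Rightarrow> nat) \<Rightarrow> bool" where
  "dn00 W x u \<longleftrightarrow> uncurry u \<in> M1 \<and> den W x (\<zero> \<rightarrow> \<one>) (C2 u)"
definition dn11 :: "world \<Rightarrow> ptm \<Rightarrow> ((nat \<Rightarrow> nat) \<Rightarrow> nat \<Rightarrow> nat) \<Rightarrow> bool" where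
  "dn11 W x \<Phi> \<longleftrightarrow> admissible \<Phi> \<and> den W x (\<one> \<rightarrow> \<one>) (Op \<Phi>)"

lemma dn_mono:
  "dn0 W x n \<Longrightarrow> dn0 (V @ W) x n" "dn1 W x f \<Longrightarrow> dn1 (V @ W) x f"
  "dn00 W x u \<Longrightarrow> dn00 (V @ W) x u" "dn11 W x \<Phi> \<Longrightarrow> dn11 (V @ W) x \<Phi>"
  by (simp_all add: dn0_def dn1_def dn00_def dn11_def den_mono)

lemma dn1_M1: "dn1 W x f \<Longrightarrow> f \<in> M1"
  by (simp add: dn1_def)

lemma dn0I: assumes "den W x \<zero> d" "ev d n" shows "dn0 W x n"
  unfolding dn0_def by (rule den_eqv[OF assms(1)]) (use assms(2) ev.Num in \<open>auto simp: eqv_0_iff\<close>)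

lemma dn0_app:
  assumes "dn1 W s f" "dn0 W t n" "m = f n" shows "dn0 W (s \<cdot> t) m"
proof -
  have "den W s \<one> (C1 f)" "den W t \<zero> (Num n)"
    using assms(1,2) by (simp_all add: dn0_def dn1_def)
  then have "den W (s \<cdot> t) \<zero> (C1 f \<bullet> Num n)"
    by (rule den_app)
  then show ?thesis
    unfolding assms(3) by (rule dn0I) (rule ev.C1[OF ev.Num])
qed

lemma dn1_app00:
  assumes "dn00 W s u" "dn0 W t n" "f = u n" shows "dn1 W (s \<cdot> t) f"
proof -
  have d: "den W (s \<cdot> t) \<one> (C2 u \<bullet> Num n)" and u: "uncurry u \<in> M1"
    using assms(1,2) den_app by (auto simp: dn0_def dn00_def)
  have f: "f \<in> M1"
    using M1_row[OF u, of n] assms(3) by simp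
  have "eqv \<one> (C2 u \<bullet> Num n) (C1 f)"
  proof (rule eqv_ext[OF elts_app[OF C2_elts[OF u] Num_elts] C1_elts[OF f]])
    fix a assume "a \<in> elts \<zero>"
    then show "eqv \<zero> (C2 u \<bullet> Num n \<bullet> a) (C1 f \<bullet> a)"
      using ev.C2[OF ev.Num elts_0_ev, of a u n] ev.C1[OF elts_0_ev, of a f] assms(3)
      by (auto simp: eqv_0_iff)
  qed
  with d f show ?thesis
    by (auto simp: dn1_def intro: den_eqv)
qed

lemma dn1_app11:
  assumes "dn11 W s \<Phi>" "dn1 W t f" "g = \<Phi> f" shows "dn1 W (s \<cdot> t) g"
proof -
  have d: "den W (s \<cdot> t) \<one> (Op \<Phi> \<bullet> C1 f)" and \<Phi>: "admissible \<Phi>" and f: "f \<in> M1"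
    using assms(1,2) den_app by (auto simp: dn1_def dn11_def)
  have g: "g \<in> M1"
    using admissible_M1[OF \<Phi> f] assms(3) by simp
  have "eqv \<one> (Op \<Phi> \<bullet> C1 f) (C1 g)"
  proof (rule eqv_ext[OF elts_app[OF Op_elts[OF \<Phi>] C1_elts[OF f]] C1_elts[OF g]])
    fix a assume "a \<in> elts \<zero>"
    then show "eqv \<zero> (Op \<Phi> \<bullet> C1 f \<bullet> a) (C1 g \<bullet> a)"
      using ev_Op_app[OF eqv_refl[OF C1_elts[OF f]], of a \<Phi>] ev.C1[OF elts_0_ev, of a g] assms(3)
      by (auto simp: eqv_0_iff)
  qed
  with d g show ?thesis
    by (auto simp: dn1_def intro: den_eqv)
qed

lemma dn0_binary:
  assumes "den W c (\<zero> \<rightarrow> \<one>) (C2 u)" "uncurry u \<in> M1" "dn0 W s n" "dn0 W t m" "k = u n m"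
  shows "dn0 W (c \<cdot> s \<cdot> t) k"
proof (rule dn0_app[where f = "u n" and n = m])
  show "dn1 W (c \<cdot> s) (u n)"
    by (rule dn1_app00[OF _ assms(3) refl]) (simp add: dn00_def assms)
qed (rule assms)+

lemma dn0_add: "dn0 W s n \<Longrightarrow> dn0 W t m \<Longrightarrow> k = n + m \<Longrightarrow> dn0 W (s \<^bold>+ t) k"
  unfolding padd_def by (rule dn0_binary[OF den_consts(6) uncurry_base(3)])

lemma dn0_mul: "dn0 W s n \<Longrightarrow> dn0 W t m \<Longrightarrow> k = n * m \<Longrightarrow> dn0 W (s \<^bold>* t) k"
  unfolding pmul_def by (rule dn0_binary[OF den_consts(7) uncurry_base(4)])

lemma dn0_zero: "k = 0 \<Longrightarrow> dn0 W \<^bold>0 k"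
  and dn0_one: "k = 1 \<Longrightarrow> dn0 W \<^bold>1 k"
  using den_consts(4,5) by (simp_all add: dn0_def pzero_def pone_def)

lemma dn0_pr: "dn0 W s n \<Longrightarrow> dn0 W t m \<Longrightarrow> k = npr n m \<Longrightarrow> dn0 W (pr s t) k"
  unfolding pr_def npr_def by (auto intro!: dn0_add dn0_mul)

lemma dn0_rec:
  assumes "dn00 W s u" "dn0 W t m" "dn0 W r n" "k = rec_nat m u n"
  shows "dn0 W (cst Rec \<cdot> s \<cdot> t \<cdot> r) k"
proof -
  have "den W s (\<zero> \<rightarrow> \<one>) (C2 u)" "den W t \<zero> (Num m)" "den W r \<zero> (Num n)"
    using assms by (simp_all add: dn00_def dn0_def)
  from den_app[OF den_app[OF den_app[OF den_consts(3) this(1)] this(2)] this(3)]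
  have d: "den W (cst Rec \<cdot> s \<cdot> t \<cdot> r) \<zero> (RecC \<bullet> C2 u \<bullet> Num m \<bullet> Num n)" .
  have "ev (RecC \<bullet> C2 u \<bullet> Num m \<bullet> Num n) k"
    by (rule ev.Rec[OF ev.C2[OF ev.Num ev.Num] ev.Num ev.Num assms(4)])
  with d show ?thesis
    by (rule dn0I)
qed

section \<open>Bracket abstraction in the model\<close>

lemma ty_of_bracket:
  assumes "ty_of (\<sigma> # \<Gamma>) t = Some \<tau>" shows "ty_of \<Gamma> (bracket \<sigma> \<Gamma> t) = Some (\<sigma> \<rightarrow> \<tau>)"
  using assms
proof (induction t arbitrary: \<tau>)
  case (Var n)
  then show ?case by (cases n) (auto split: if_splits)
next
  case (App s t)
  from App.prems obtain \<rho> where "ty_of (\<sigma> # \<Gamma>) s = Some (\<rho> \<rightarrow> \<tau>)" "ty_of (\<sigma> # \<Gamma>) t = Some \<rho>"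
    by (rule ty_of_App_SomeE)
  then show ?case using App.IH by simp
qed auto

text \<open>The beta rule. It holds up to \<open>eqv\<close> only, since the reductions take place
  inside arguments as well as at the head.\<close>

lemma itp_bracket:
  assumes env: "typed_env \<Gamma> \<rho>" and d: "d \<in> elts \<sigma>" and t: "ty_of (\<sigma> # \<Gamma>) t = Some \<tau>"
  shows "eqv \<tau> (itp \<rho> (bracket \<sigma> \<Gamma> t) \<bullet> d) (itp (case_nat d \<rho>) t)"
  using t
proof (induction t arbitrary: \<tau>)
  case (Var n)
  show ?case
  proof (cases n)
    case 0
    with Var have \<tau>: "\<tau> = \<sigma>" by simp
    have "eqv \<sigma> (SC \<bullet> KC \<bullet> KC \<bullet> d) (KC \<bullet> d \<bullet> (KC \<bullet> d))"
    proof (rule eqv_head_step[OF head_step.S])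
      have "KC \<bullet> d \<in> elts (\<sigma> \<rightarrow> \<sigma>)"
        by (rule elts_app[OF KC_elts d])
      then show "KC \<bullet> d \<bullet> (KC \<bullet> d) \<in> elts \<sigma>"
        by (rule elts_app[OF elts_app[OF KC_elts d]])
    qed
    moreover have "eqv \<sigma> (KC \<bullet> d \<bullet> (KC \<bullet> d)) d"
      by (rule eqv_head_step[OF head_step.K d])
    ultimately show ?thesis
      using eqv_trans by (simp add: 0 \<tau>)
  next
    case (Suc m)
    with Var have "m < length \<Gamma>" "\<tau> = \<Gamma> ! m" by (auto split: if_splits)
    then have "\<rho> m \<in> elts \<tau>"
      using env by (simp add: typed_env_def)
    then show ?thesis
      by (simp add: Suc eqv_head_step[OF head_step.K])
  qed
next
  case (App s t)
  from App.prems obtain \<rho>' where st: "ty_of (\<sigma> # \<Gamma>) s = Some (\<rho>' \<rightarrow> \<tau>)" "ty_of (\<sigma> # \<Gamma>) t = Some \<rho>'"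
    by (rule ty_of_App_SomeE)
  let ?s = "itp \<rho> (bracket \<sigma> \<Gamma> s)" and ?t = "itp \<rho> (bracket \<sigma> \<Gamma> t)"
  have IH: "eqv \<tau> (?s \<bullet> d \<bullet> (?t \<bullet> d)) (itp (case_nat d \<rho>) s \<bullet> itp (case_nat d \<rho>) t)"
    by (rule eqv_app[OF App.IH(1)[OF st(1)] App.IH(2)[OF st(2)]])
  have "eqv \<tau> (SC \<bullet> ?s \<bullet> ?t \<bullet> d) (?s \<bullet> d \<bullet> (?t \<bullet> d))"
    by (rule eqv_head_step[OF head_step.S eqv_elts(1)[OF IH]])
  from eqv_trans[OF this IH] show ?case
    by simp
qed (auto intro!: eqv_head_step[OF head_step.K] C2_elts uncurry_base KC_elts SC_elts RecC_elts)

lemma den_lam: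
  assumes e: "e \<in> elts (\<sigma> \<rightarrow> \<tau>)"
    and F: "\<And>V x d. d \<in> elts \<sigma> \<Longrightarrow> den (V @ W) x \<sigma> d \<Longrightarrow> den (V @ W) (F x) \<tau> (e \<bullet> d)"
  shows "den W (plam \<sigma> F) (\<sigma> \<rightarrow> \<tau>) e"
  unfolding den_def
proof (intro allI impI)
  fix V assume V: "valid (V @ W)"
  let ?W = "V @ W"
  let ?t = "F (bound (wctx ?W)) (\<sigma> # wctx ?W)"
  have env: "typed_env (wctx ?W) (wenv ?W)"
    by (rule typed_env_world[OF V])
  have F': "ty_of (\<sigma> # wctx ?W) ?t = Some \<tau>" "eqv \<tau> (itp (case_nat d (wenv ?W)) ?t) (e \<bullet> d)"
    if "d \<in> elts \<sigma>" for d
  proof -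
    have "den (((\<sigma>, d) # V) @ W) (F (bound (wctx ?W))) \<tau> (e \<bullet> d)"
      by (rule F[OF that]) (use den_bound[OF that, of ?W] in simp)
    from denD[OF this] show "ty_of (\<sigma> # wctx ?W) ?t = Some \<tau>"
      "eqv \<tau> (itp (case_nat d (wenv ?W)) ?t) (e \<bullet> d)"
      using V that by (simp_all add: valid_Cons wenv_Cons)
  qed
  \<comment> \<open>The typing of the body is known only in the presence of some value for the bound
    variable, which \<open>elts_nonempty\<close> provides.\<close>
  have ty: "ty_of (wctx ?W) (plam \<sigma> F (wctx ?W)) = Some (\<sigma> \<rightarrow> \<tau>)"
    using elts_nonempty[of \<sigma>] F'(1) ty_of_bracket by (auto simp: plam_def simp del: map_append)
  moreover have "eqv (\<sigma> \<rightarrow> \<tau>) (itp (wenv ?W) (plam \<sigma> F (wctx ?W))) e"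
  proof (rule eqv_ext[OF itp_elts[OF env ty] e])
    fix d assume d: "d \<in> elts \<sigma>"
    show "eqv \<tau> (itp (wenv ?W) (plam \<sigma> F (wctx ?W)) \<bullet> d) (e \<bullet> d)"
      unfolding plam_def by (rule eqv_trans[OF itp_bracket[OF env d F'(1)[OF d]] F'(2)[OF d]])
  qed
  ultimately show "ty_of (wctx ?W) (plam \<sigma> F (wctx ?W)) = Some (\<sigma> \<rightarrow> \<tau>) \<and>
      eqv (\<sigma> \<rightarrow> \<tau>) (itp (wenv ?W) (plam \<sigma> F (wctx ?W))) e" ..
qed

lemma dn1_lam:
  assumes f: "f \<in> M1" and F: "\<And>V x n. dn0 (V @ W) x n \<Longrightarrow> dn0 (V @ W) (F x) (f n)"
  shows "dn1 W (plam \<zero> F) f"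
  unfolding dn1_def
proof (intro conjI f den_lam C1_elts)
  fix V x d assume d: "d \<in> elts \<zero>" "den (V @ W) x \<zero> d"
  have "den (V @ W) (F x) \<zero> (Num (f (val d)))"
    using F[of V x "val d"] d eqv_Num by (auto simp: dn0_def intro: den_eqv)
  then show "den (V @ W) (F x) \<zero> (C1 f \<bullet> d)"
    by (rule den_eqv) (use ev.C1[OF elts_0_ev[OF d(1)], of f] ev.Num in \<open>auto simp: eqv_0_iff\<close>)
qed

lemma dn00_lam:
  assumes u: "uncurry u \<in> M1" and F: "\<And>V x n. dn0 (V @ W) x n \<Longrightarrow> dn1 (V @ W) (F x) (u n)"
  shows "dn00 W (plam \<zero> F) u"
  unfolding dn00_def
proof (intro conjI u den_lam C2_elts)
  fix V x d assume d: "d \<in> elts \<zero>" "den (V @ W) x \<zero> d"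
  have "dn1 (V @ W) (F x) (u (val d))"
    using F[of V x "val d"] d eqv_Num by (auto simp: dn0_def intro: den_eqv)
  then have *: "den (V @ W) (F x) \<one> (C1 (u (val d)))" "u (val d) \<in> M1"
    by (auto simp: dn1_def)
  show "den (V @ W) (F x) \<one> (C2 u \<bullet> d)"
  proof (rule den_eqv[OF *(1)], rule eqv_ext[OF C1_elts[OF *(2)] elts_app[OF C2_elts[OF u] d(1)]])
    fix a assume "a \<in> elts \<zero>"
    then show "eqv \<zero> (C1 (u (val d)) \<bullet> a) (C2 u \<bullet> d \<bullet> a)"
      using ev.C2[OF elts_0_ev[OF d(1)] elts_0_ev, of a u] ev.C1[OF elts_0_ev, of a "u (val d)"]
      by (auto simp: eqv_0_iff)
  qed
qed

lemma dn0_pow2: assumes "dn0 W s n" "k = 2 ^ n" shows "dn0 W (pow2 s) k"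
proof -
  have *: "uncurry (\<lambda>k m. m + m) \<in> M1" "(\<lambda>m. m + m) \<in> M1"
    unfolding uncurry_def case_prod_unfold by (intro M1_intros)+
  have k: "k = rec_nat 1 (\<lambda>k m. m + m) n"
    unfolding assms(2) by (induction n) auto
  show ?thesis
    unfolding pow2_def
  proof (rule dn0_rec[OF dn00_lam dn0_one[OF refl] assms(1) k], rule *, rule dn1_lam, rule *)
    fix V x n V' y m assume "dn0 (V' @ V @ W) y m"
    then show "dn0 (V' @ V @ W) (y \<^bold>+ y) (m + m)"
      by (intro dn0_add[OF _ _ refl])
  qed
qed

lemma dn0_initseg: assumes "dn1 W s g" "dn0 W t n" "k = nseg g n" shows "dn0 W (initseg s t) k"
proof -
  have g: "g \<in> M1"
    by (rule dn1_M1[OF assms(1)])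
  have *: "uncurry (\<lambda>k s. npr s (g k) + 1) \<in> M1" "(\<lambda>s. npr s (g k) + 1) \<in> M1" for k
    unfolding uncurry_def case_prod_unfold npr_def by (intro M1_intros M1_comp[OF g])+
  show ?thesis
    unfolding initseg_def assms(3) nseg_def
  proof (rule dn0_rec[OF dn00_lam dn0_zero[OF refl] assms(2) refl], rule *, rule dn1_lam, rule *)
    fix V x n V' y m assume "dn0 (V @ W) x n" "dn0 (V' @ V @ W) y m"
    then have "dn0 (V' @ V @ W) (s \<cdot> x) (g n)"
      by (intro dn0_app[OF dn_mono(2)[OF dn_mono(2)[OF assms(1)]] dn_mono(1) refl])
    with \<open>dn0 (V' @ V @ W) y m\<close> show "dn0 (V' @ V @ W) (pr y (s \<cdot> x) \<^bold>+ \<^bold>1) (npr m (g n) + 1)"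
      by (intro dn0_add[OF _ _ refl] dn0_pr[OF _ _ refl] dn0_one[OF refl])
  qed
qed


subsection \<open>Quantifiers of low type and prime formulas\<close>

lemma mean_all0:
  assumes "\<And>V x n. dn0 (V @ W) x n \<Longrightarrow> mean (V @ W) (P x) (Q n)"
  shows "mean W (pall \<zero> P) (\<forall>n. Q n)"
proof -
  have "mean W (pall \<zero> P) (\<forall>d\<in>elts \<zero>. Q (val d))"
    by (rule mean_all, rule assms) (auto simp: dn0_def intro: den_eqv eqv_Num)
  moreover have "(\<forall>d\<in>elts \<zero>. Q (val d)) \<longleftrightarrow> (\<forall>n. Q n)"
    using Num_elts val_Num by metis
  ultimately show ?thesis by simp
qed

text \<open>A variable with value \<open>d\<close> also denotes every object \<open>eqv\<close> to
  \<open>d\<close>, so a quantifier may be read as ranging over chosen representatives.\<close>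

lemma mean_all_canonical:
  assumes P: "\<And>V x f. f \<in> A \<Longrightarrow> den (V @ W) x \<tau> (c f) \<Longrightarrow> mean (V @ W) (P x) (Q f)"
    and c: "\<And>f. f \<in> A \<Longrightarrow> c f \<in> elts \<tau>"
    and ex: "\<And>d. d \<in> elts \<tau> \<Longrightarrow> \<exists>f\<in>A. eqv \<tau> d (c f)"
  shows "mean W (pall \<tau> P) (\<forall>f\<in>A. Q f)"
  unfolding mean_def
proof
  assume W: "valid W"
  have *: "sat (case_nat d (wenv W)) (P (bound (wctx W)) (\<tau> # wctx W)) \<longleftrightarrow> Q f"
    if "d \<in> elts \<tau>" "f \<in> A" "eqv \<tau> d (c f)" for d f
  proof -
    have "den ([(\<tau>, d)] @ W) (bound (wctx W)) \<tau> (c f)"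
      using den_eqv[OF den_bound[OF that(1)] that(3)] by simp
    from P[OF that(2) this] show ?thesis
      using W that by (simp add: mean_def valid_Cons wenv_Cons)
  qed
  show "sat (wenv W) (pall \<tau> P (wctx W)) \<longleftrightarrow> (\<forall>f\<in>A. Q f)"
  proof
    assume "sat (wenv W) (pall \<tau> P (wctx W))"
    then show "\<forall>f\<in>A. Q f"
      using * c eqv_refl unfolding pall_def sat.simps by blast
  next
    assume "\<forall>f\<in>A. Q f"
    then show "sat (wenv W) (pall \<tau> P (wctx W))"
      using * ex unfolding pall_def sat.simps by blast
  qed
qed

lemma mean_all1:
  assumes "\<And>V x f. dn1 (V @ W) x f \<Longrightarrow> mean (V @ W) (P x) (Q f)"
  shows "mean W (pall \<one> P) (\<forall>f\<in>M1. Q f)"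
proof (rule mean_all_canonical[where c = C1])
  show "mean (V @ W) (P x) (Q f)" if "f \<in> M1" "den (V @ W) x \<one> (C1 f)" for V x f
    by (rule assms) (use that in \<open>simp add: dn1_def\<close>)
  show "\<exists>f\<in>M1. eqv \<one> d (C1 f)" if "d \<in> elts \<one>" for d
    by (rule eqv_C1[OF that]) blast
qed (simp add: C1_elts)

lemma mean_all00:
  assumes "\<And>V x u. dn00 (V @ W) x u \<Longrightarrow> mean (V @ W) (P x) (Q u)"
  shows "mean W (pall (\<zero> \<rightarrow> \<one>) P) (\<forall>u\<in>{u. uncurry u \<in> M1}. Q u)"
proof (rule mean_all_canonical[where c = C2])
  show "mean (V @ W) (P x) (Q u)" if "u \<in> {u. uncurry u \<in> M1}" "den (V @ W) x (\<zero> \<rightarrow> \<one>) (C2 u)" for V x u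
    by (rule assms) (use that in \<open>simp add: dn00_def\<close>)
  show "\<exists>u\<in>{u. uncurry u \<in> M1}. eqv (\<zero> \<rightarrow> \<one>) d (C2 u)" if "d \<in> elts (\<zero> \<rightarrow> \<one>)" for d
    by (rule eqv_C2[OF that]) blast
qed (simp add: C2_elts)

lemma mean_all11:
  assumes "\<And>V x \<Phi>. dn11 (V @ W) x \<Phi> \<Longrightarrow> mean (V @ W) (P x) (Q \<Phi>)"
  shows "mean W (pall (\<one> \<rightarrow> \<one>) P) (\<forall>\<Phi>\<in>Collect admissible. Q \<Phi>)"
proof (rule mean_all_canonical[where c = Op])
  show "mean (V @ W) (P x) (Q \<Phi>)" if "\<Phi> \<in> Collect admissible" "den (V @ W) x (\<one> \<rightarrow> \<one>) (Op \<Phi>)" for V x \<Phi>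
    by (rule assms) (use that in \<open>simp add: dn11_def\<close>)
  show "\<exists>\<Phi>\<in>Collect admissible. eqv (\<one> \<rightarrow> \<one>) d (Op \<Phi>)" if "d \<in> elts (\<one> \<rightarrow> \<one>)" for d
    by (rule eqv_Op[OF that]) blast
qed (simp add: Op_elts)

lemma mean_ex0:
  assumes "\<And>V x n. dn0 (V @ W) x n \<Longrightarrow> mean (V @ W) (P x) (Q n)"
  shows "mean W (pex \<zero> P) (\<exists>n. Q n)"
  unfolding pex_eq using mean_not[OF mean_all0[OF mean_not[OF assms]]] by simp

lemma mean_ex1:
  assumes "\<And>V x f. dn1 (V @ W) x f \<Longrightarrow> mean (V @ W) (P x) (Q f)"
  shows "mean W (pex \<one> P) (\<exists>f\<in>M1. Q f)"
  unfolding pex_eq using mean_not[OF mean_all1[OF mean_not[OF assms]]] by simp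

lemma mean_ex00:
  assumes "\<And>V x u. dn00 (V @ W) x u \<Longrightarrow> mean (V @ W) (P x) (Q u)"
  shows "mean W (pex (\<zero> \<rightarrow> \<one>) P) (\<exists>u\<in>{u. uncurry u \<in> M1}. Q u)"
  unfolding pex_eq using mean_not[OF mean_all00[OF mean_not[OF assms]]] by simp

lemma mean_ex11:
  assumes "\<And>V x \<Phi>. dn11 (V @ W) x \<Phi> \<Longrightarrow> mean (V @ W) (P x) (Q \<Phi>)"
  shows "mean W (pex (\<one> \<rightarrow> \<one>) P) (\<exists>\<Phi>\<in>Collect admissible. Q \<Phi>)"
  unfolding pex_eq using mean_not[OF mean_all11[OF mean_not[OF assms]]] by simp

lemma dn0_val:
  assumes "dn0 W s n" "valid W" shows "val (itp (wenv W) (s (wctx W))) = n"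
  using denD(2)[OF assms(1)[unfolded dn0_def] assms(2)] by (simp add: eqv_0_val)

lemma mean_peq: "dn0 W s n \<Longrightarrow> dn0 W t m \<Longrightarrow> b = (n = m) \<Longrightarrow> mean W (s \<^bold>= t) b"
  by (simp add: mean_def peq_def dn0_val)

lemma mean_plt: "dn0 W s n \<Longrightarrow> dn0 W t m \<Longrightarrow> b = (n < m) \<Longrightarrow> mean W (s \<^bold>< t) b"
  by (simp add: mean_def plt_def dn0_val)

lemma mean_ple: "dn0 W s n \<Longrightarrow> dn0 W t m \<Longrightarrow> b = (n < m \<or> n = m) \<Longrightarrow> mean W (s \<^bold>\<le> t) b"
  using mean_or[OF mean_plt[OF _ _ refl] mean_peq[OF _ _ refl]] by (simp add: ple_def)


section \<open>Evaluating the formulas about reals\<close>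

definition dnq :: "world \<Rightarrow> qtriple \<Rightarrow> ntriple \<Rightarrow> bool" where
  "dnq W p t \<longleftrightarrow> dn0 W (fst p) (fst t) \<and> dn0 W (fst (snd p)) (fst (snd t)) \<and> dn0 W (snd (snd p)) (snd (snd t))"

lemma dnq_triple: "dn0 W i i' \<Longrightarrow> dn0 W j j' \<Longrightarrow> dn0 W c c' \<Longrightarrow> dnq W (i, j, c) (i', j', c')"
  by (simp add: dnq_def)

lemma dnq_mono: "dnq W p t \<Longrightarrow> dnq (V @ W) p t"
  by (simp add: dnq_def dn_mono)

lemma dnq_qadd: "dnq W p s \<Longrightarrow> dnq W q t \<Longrightarrow> r = nqadd s t \<Longrightarrow> dnq W (qadd p q) r"
  by (cases p; cases q; cases s; cases t)
    (auto simp: dnq_def intro!: dn0_add[OF _ _ refl] dn0_mul[OF _ _ refl])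

lemma dnq_qneg: "dnq W p s \<Longrightarrow> r = nqneg s \<Longrightarrow> dnq W (qneg p) r"
  by (cases p; cases s) (auto simp: dnq_def)

lemma dnq_qsub: "dnq W p s \<Longrightarrow> dnq W q t \<Longrightarrow> r = nqsub s t \<Longrightarrow> dnq W (qsub p q) r"
  by (auto simp: qsub_def nqsub_def intro: dnq_qadd dnq_qneg)

lemma dnq_qmul: "dnq W p s \<Longrightarrow> dnq W q t \<Longrightarrow> r = nqmul s t \<Longrightarrow> dnq W (qmul p q) r"
  by (cases p; cases q; cases s; cases t)
    (auto simp: dnq_def intro!: dn0_add[OF _ _ refl] dn0_mul[OF _ _ refl])

lemma dnq_q0: "r = (0, 0, 1) \<Longrightarrow> dnq W q0 r"
  and dnq_q1: "r = (1, 0, 1) \<Longrightarrow> dnq W q1 r"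
  by (auto simp: dnq_def q0_def q1_def intro!: dn0_zero dn0_one)

lemma dnq_qeps: "dn0 W n m \<Longrightarrow> r = nqeps m \<Longrightarrow> dnq W (qeps n) r"
  and dnq_qeps2: "dn0 W n m \<Longrightarrow> r = nqeps2 m \<Longrightarrow> dnq W (qeps2 n) r"
  by (auto simp: dnq_def qeps_def qeps2_def nqeps_def nqeps2_def
      intro!: dn0_zero dn0_one dn0_add[OF dn0_one[OF refl] dn0_one[OF refl]] dn0_pow2)

lemma mean_qless: "dnq W p s \<Longrightarrow> dnq W q t \<Longrightarrow> mean W (qless p q) (nqless s t)"
  by (cases p; cases q; cases s; cases t)
    (auto simp: dnq_def intro!: mean_plt[OF _ _ refl] dn0_add[OF _ _ refl] dn0_mul[OF _ _ refl])

lemma mean_qle: "dnq W p s \<Longrightarrow> dnq W q t \<Longrightarrow> mean W (qle p q) (nqle s t)"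
  unfolding qle_def nqle_def by (intro mean_not mean_qless)

lemma mean_qabs_less: "dnq W p s \<Longrightarrow> dnq W q t \<Longrightarrow> mean W (qabs_less p q) (nqabs_less s t)"
  unfolding qabs_less_def nqabs_less_def by (intro mean_and mean_qless dnq_qneg[OF _ refl])

lemma mean_qabs_le: "dnq W p s \<Longrightarrow> dnq W q t \<Longrightarrow> mean W (qabs_le p q) (nqabs_le s t)"
  unfolding qabs_le_def nqabs_le_def by (intro mean_and mean_qle dnq_qneg[OF _ refl])

lemma dn0_rcode: "dnq W p t \<Longrightarrow> k = ncode t \<Longrightarrow> dn0 W (rcode p) k"
  by (cases p; cases t) (auto simp: dnq_def ncode.simps intro!: dn0_pr[OF _ _ refl])

lemma dn1_rconst: "dnq W q t \<Longrightarrow> f = (\<lambda>_. ncode t) \<Longrightarrow> dn1 W (rconst q) f"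
  unfolding rconst_def by (auto intro!: dn1_lam dn0_rcode[OF _ refl] dnq_mono)

lemma mean_dec:
  assumes q: "dn0 W q n" and \<Phi>: "\<And>V p t. dnq (V @ W) p t \<Longrightarrow> mean (V @ W) (\<Phi> p) (\<Phi>' t)"
  shows "mean W (dec q \<Phi>) (sdec n \<Phi>')"
  unfolding dec_def sdec_def
proof (rule mean_ex0, rule mean_ex0, rule mean_ex0)
  fix V1 V2 V3 i j c i' j' c'
  assume i: "dn0 (V1 @ W) i i'" and j: "dn0 (V2 @ V1 @ W) j j'" and c: "dn0 (V3 @ V2 @ V1 @ W) c c'"
  have p: "dnq (V3 @ V2 @ V1 @ W) (i, j, c) (i', j', c')"
    by (intro dnq_triple c dn_mono(1) j i)
  have "mean (V3 @ V2 @ V1 @ W) (\<Phi> (i, j, c)) (\<Phi>' (i', j', c'))"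
    using \<Phi>[of "V3 @ V2 @ V1"] p by simp
  moreover have "mean (V3 @ V2 @ V1 @ W) (q \<^bold>= rcode (i, j, c)) (n = npr i' (npr j' c'))"
    by (rule mean_peq[OF _ dn0_rcode[OF p refl]]) (auto intro: dn_mono q simp: ncode.simps)
  moreover have "mean (V3 @ V2 @ V1 @ W) (\<^bold>0 \<^bold>< c) (0 < c')"
    by (rule mean_plt[OF dn0_zero[OF refl] c refl])
  ultimately show "mean (V3 @ V2 @ V1 @ W) (\<^bold>0 \<^bold>< c \<^bold>\<and> q \<^bold>= rcode (i, j, c) \<^bold>\<and> \<Phi> (i, j, c))
      (0 < c' \<and> n = npr i' (npr j' c') \<and> \<Phi>' (i', j', c'))"
    by (intro mean_and)
qed

lemmas den_rules = dn0_pow2 dn0_initseg dn0_rec dn0_add dn0_mul dn0_zero dn0_one dn0_pr dn0_rcode dn0_app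
  dn1_rconst dnq_qadd dnq_qneg dnq_qsub dnq_qmul dnq_q0 dnq_q1 dnq_qeps dnq_qeps2

lemmas mean_rules = mean_imp mean_and mean_or mean_not mean_iff mean_all0 mean_all1 mean_ex0 mean_ex1
  mean_peq mean_plt mean_ple mean_dec mean_qless mean_qle mean_qabs_less mean_qabs_le

lemmas mono_rules = dn_mono dnq_mono

lemma mean_is_real: "dn1 W x f \<Longrightarrow> mean W (is_real x) (nreal f)"
  unfolding is_real_def nreal_def
  by (rule mean_rules den_rules | assumption | rule refl | rule mono_rules)+

lemma mean_req: "dn1 W x f \<Longrightarrow> dn1 W y g \<Longrightarrow> mean W (x =\<^sub>\<real> y) (nreq f g)"
  unfolding req_def nreq_def
  by (rule mean_rules den_rules | assumption | rule refl | rule mono_rules)+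

lemma mean_rless: "dn1 W x f \<Longrightarrow> dn1 W y g \<Longrightarrow> mean W (x <\<^sub>\<real> y) (nrless f g)"
  unfolding rless_def nrless_def
  by (rule mean_rules den_rules | assumption | rule refl | rule mono_rules)+

definition nrle :: "(nat \<Rightarrow> nat) \<Rightarrow> (nat \<Rightarrow> nat) \<Rightarrow> bool" where
  "nrle x y \<longleftrightarrow> \<not> nrless y x"

lemma mean_rle: "dn1 W x f \<Longrightarrow> dn1 W y g \<Longrightarrow> mean W (x \<le>\<^sub>\<real> y) (nrle f g)"
  unfolding rle_def nrle_def by (intro mean_not mean_rless)

lemma mean_rop_qsub:
  "dn1 W x f \<Longrightarrow> dn1 W y g \<Longrightarrow> dn1 W z h \<Longrightarrow> mean W (rop qsub x y z) (nrop nqsub f g h)"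
  unfolding rop_def nrop_def
  by (rule mean_is_real mean_rules den_rules | assumption | rule refl | rule mono_rules)+

lemma mean_rop_qmul:
  "dn1 W x f \<Longrightarrow> dn1 W y g \<Longrightarrow> dn1 W z h \<Longrightarrow> mean W (rop qmul x y z) (nrop nqmul f g h)"
  unfolding rop_def nrop_def
  by (rule mean_is_real mean_rules den_rules | assumption | rule refl | rule mono_rules)+

definition zero_seq :: "nat \<Rightarrow> nat" where "zero_seq = (\<lambda>_. ncode (0, 0, 1))"
definition one_seq :: "nat \<Rightarrow> nat" where "one_seq = (\<lambda>_. ncode (1, 0, 1))"

lemma dn1_zero_one: "dn1 W (rconst q0) zero_seq" "dn1 W (rconst q1) one_seq"
  unfolding zero_seq_def one_seq_def by (auto intro: dn1_rconst dnq_q0 dnq_q1)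

lemmas mean_real_rules = mean_is_real mean_req mean_rless mean_rle mean_rop_qsub mean_rop_qmul

definition nrpos :: "(nat \<Rightarrow> nat) \<Rightarrow> bool" where
  "nrpos x \<longleftrightarrow> nreal x \<and> nrless zero_seq x"
definition nrdist :: "(nat \<Rightarrow> nat) \<Rightarrow> (nat \<Rightarrow> nat) \<Rightarrow> (nat \<Rightarrow> nat) \<Rightarrow> bool" where
  "nrdist x y d \<longleftrightarrow> nrle zero_seq d \<and> (nrop nqsub x y d \<or> nrop nqsub y x d)"
definition nrdist_less :: "(nat \<Rightarrow> nat) \<Rightarrow> (nat \<Rightarrow> nat) \<Rightarrow> (nat \<Rightarrow> nat) \<Rightarrow> bool" where
  "nrdist_less x y e \<longleftrightarrow> (\<exists>d\<in>M1. nrdist x y d \<and> nrless d e)"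
definition nunit :: "(nat \<Rightarrow> nat) \<Rightarrow> bool" where
  "nunit x \<longleftrightarrow> nreal x \<and> nrle zero_seq x \<and> nrle x one_seq"

lemma mean_rpos: "dn1 W x f \<Longrightarrow> mean W (rpos x) (nrpos f)"
  unfolding rpos_def nrpos_def by (intro mean_and mean_real_rules dn1_zero_one)

lemma mean_rdist: "dn1 W x f \<Longrightarrow> dn1 W y g \<Longrightarrow> dn1 W z h \<Longrightarrow> mean W (rdist x y z) (nrdist f g h)"
  unfolding rdist_def nrdist_def by (intro mean_and mean_or mean_real_rules dn1_zero_one)

lemma mean_rdist_less:
  "dn1 W x f \<Longrightarrow> dn1 W y g \<Longrightarrow> dn1 W e h \<Longrightarrow> mean W (rdist_less x y e) (nrdist_less f g h)"
  unfolding rdist_less_def nrdist_less_def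
  by (rule mean_ex1 mean_and mean_rdist mean_rless | assumption | rule mono_rules)+

lemma mean_unit: "dn1 W x f \<Longrightarrow> mean W (unit_interval x) (nunit f)"
  unfolding unit_interval_def nunit_def by (intro mean_and mean_real_rules dn1_zero_one)

definition nreal_fun :: "((nat \<Rightarrow> nat) \<Rightarrow> nat \<Rightarrow> nat) \<Rightarrow> bool" where
  "nreal_fun \<Phi> \<longleftrightarrow> (\<forall>x\<in>M1. nunit x \<longrightarrow> nreal (\<Phi> x)) \<and>
     (\<forall>x\<in>M1. \<forall>y\<in>M1. nunit x \<and> nunit y \<and> nreq x y \<longrightarrow> nreq (\<Phi> x) (\<Phi> y))"
definition ncontinuous :: "((nat \<Rightarrow> nat) \<Rightarrow> nat \<Rightarrow> nat) \<Rightarrow> bool" where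
  "ncontinuous \<Phi> \<longleftrightarrow> (\<forall>x\<in>M1. nunit x \<longrightarrow> (\<forall>e\<in>M1. nrpos e \<longrightarrow> (\<exists>d\<in>M1. nrpos d \<and>
     (\<forall>y\<in>M1. nunit y \<and> nrdist_less x y d \<longrightarrow> nrdist_less (\<Phi> x) (\<Phi> y) e))))"
definition ndifferentiable :: "((nat \<Rightarrow> nat) \<Rightarrow> nat \<Rightarrow> nat) \<Rightarrow> (nat \<Rightarrow> nat) \<Rightarrow> bool" where
  "ndifferentiable \<Phi> x \<longleftrightarrow>
     (\<exists>L\<in>M1. nreal L \<and> (\<forall>e\<in>M1. nrpos e \<longrightarrow> (\<exists>d\<in>M1. nrpos d \<and>
        (\<forall>y\<in>M1. nunit y \<and> \<not> nreq y x \<and> nrdist_less y x d \<longrightarrow>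
           (\<exists>h\<in>M1. \<exists>u\<in>M1. \<exists>q\<in>M1.
              nrop nqsub y x h \<and> nrop nqsub (\<Phi> y) (\<Phi> x) u \<and>
              nreal q \<and> nrop nqmul q h u \<and> nrdist_less q L e)))))"

lemmas mean_fun_rules = mean_unit mean_rpos mean_rdist_less mean_real_rules mean_rules den_rules dn1_app11

lemma mean_real_fun: "dn11 W f \<Phi> \<Longrightarrow> mean W (real_fun f) (nreal_fun \<Phi>)"
  unfolding real_fun_def nreal_fun_def
  by (rule mean_fun_rules | assumption | rule refl | rule mono_rules)+

lemma mean_continuous: "dn11 W f \<Phi> \<Longrightarrow> mean W (continuous_on_unit f) (ncontinuous \<Phi>)"
  unfolding continuous_on_unit_def ncontinuous_def
  by (rule mean_fun_rules | assumption | rule refl | rule mono_rules)+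

lemma mean_differentiable:
  "dn11 W f \<Phi> \<Longrightarrow> dn1 W x g \<Longrightarrow> mean W (differentiable_at f x) (ndifferentiable \<Phi> g)"
  unfolding differentiable_at_def ndifferentiable_def
  by (rule mean_fun_rules | assumption | rule refl | rule mono_rules)+


subsection \<open>Real numbers of the model\<close>

lemma zero_one_seq [simp]: "nreal zero_seq" "rval zero_seq = 0" "nreal one_seq" "rval one_seq = 1"
  using const_ncode[of "(0, 0, 1)"] const_ncode[of "(1, 0, 1)"]
  by (simp_all add: zero_seq_def one_seq_def pos_den_def)

lemma nrle_iff: "nreal x \<Longrightarrow> nreal y \<Longrightarrow> nrle x y \<longleftrightarrow> rval x \<le> rval y"
  by (auto simp: nrle_def nrless_iff)

lemma nrpos_iff: "nrpos x \<longleftrightarrow> nreal x \<and> 0 < rval x"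
  by (auto simp: nrpos_def nrless_iff)

lemma nunit_iff: "nunit x \<longleftrightarrow> nreal x \<and> 0 \<le> rval x \<and> rval x \<le> 1"
  by (auto simp: nunit_def nrle_iff)

lemma nrdist_iff:
  "nreal x \<Longrightarrow> nreal y \<Longrightarrow> nrdist x y d \<longleftrightarrow> nreal d \<and> rval d = \<bar>rval x - rval y\<bar>"
  by (cases "nreal d") (auto simp: nrdist_def nrop_sub_iff nrle_iff abs_if)

text \<open>From right to left the distance must itself be an object of the model;
  \<open>M1_dist\<close> supplies its canonical code.\<close>

lemma nrdist_less_iff:
  assumes "x \<in> M1" "y \<in> M1" "nreal x" "nreal y" "nreal e"
  shows "nrdist_less x y e \<longleftrightarrow> \<bar>rval x - rval y\<bar> < rval e"
proof
  assume "nrdist_less x y e"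
  then show "\<bar>rval x - rval y\<bar> < rval e"
    using assms by (auto simp: nrdist_less_def nrdist_iff nrless_iff)
next
  assume "\<bar>rval x - rval y\<bar> < rval e"
  then have "nrdist x y (real_code \<bar>rval x - rval y\<bar>)" "nrless (real_code \<bar>rval x - rval y\<bar>) e"
    using assms by (simp_all add: nrdist_iff nrless_iff)
  then show "nrdist_less x y e"
    unfolding nrdist_less_def using M1_dist[OF assms(1,2)] by blast
qed

lemma rat_code: "real_code (of_rat q) \<in> M1" "nreal (real_code (of_rat q))" "rval (real_code (of_rat q)) = of_rat q"
  by simp_all

lemma takagi_code_simps [simp]: "nreal (takagi_code x)" "rval (takagi_code x) = takagi (rval x)"
  by (simp_all add: takagi_code_def)

lemma takagi_code_M1: "x \<in> M1 \<Longrightarrow> takagi_code x \<in> M1"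
  by (rule admissible_M1[OF admissible_takagi])

lemma nreal_fun_takagi: "nreal_fun takagi_code"
  by (auto simp: nreal_fun_def nreq_iff nunit_iff)

lemma ncontinuous_takagi: "ncontinuous takagi_code"
  unfolding ncontinuous_def
proof (intro ballI impI)
  fix x e assume x: "x \<in> M1" "nunit x" and e: "e \<in> M1" "nrpos e"
  then obtain k where k: "\<And>y. \<bar>rval x - y\<bar> < 1 / 2 ^ k \<Longrightarrow> \<bar>takagi (rval x) - takagi y\<bar> < rval e"
    using takagi_continuous[of "rval e" "rval x"] by (auto simp: nrpos_iff)
  let ?d = "real_code (of_rat (1 / 2 ^ k))"
  have d: "rval ?d = 1 / 2 ^ k"
    by (simp add: of_rat_divide of_rat_power)
  have "nrdist_less (takagi_code x) (takagi_code y) e" if "y \<in> M1" "nunit y" "nrdist_less x y ?d" for y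
    using that k x e d by (simp add: nrdist_less_iff takagi_code_M1 nrpos_iff nunit_iff)
  moreover have "nrpos ?d"
    unfolding nrpos_iff d by simp
  ultimately show "\<exists>d\<in>M1. nrpos d \<and> (\<forall>y\<in>M1. nunit y \<and> nrdist_less x y d \<longrightarrow>
      nrdist_less (takagi_code x) (takagi_code y) e)"
    by (intro bexI[of _ ?d]) auto
qed

lemma not_ndifferentiable_takagi:
  assumes x: "x \<in> M1" "nunit x" shows "\<not> ndifferentiable takagi_code x"
proof
  assume "ndifferentiable takagi_code x"
  then obtain L where L: "L \<in> M1" "nreal L" and D: "\<forall>e\<in>M1. nrpos e \<longrightarrow> (\<exists>d\<in>M1. nrpos d \<and>
        (\<forall>y\<in>M1. nunit y \<and> \<not> nreq y x \<and> nrdist_less y x d \<longrightarrow>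
           (\<exists>h\<in>M1. \<exists>u\<in>M1. \<exists>q\<in>M1.
              nrop nqsub y x h \<and> nrop nqsub (takagi_code y) (takagi_code x) u \<and>
              nreal q \<and> nrop nqmul q h u \<and> nrdist_less q L e)))"
    unfolding ndifferentiable_def by blast
  let ?e = "real_code (of_rat (1 / 4))"
  have e: "rval ?e = 1 / 4"
    by (simp add: of_rat_divide)
  have "nrpos ?e"
    unfolding nrpos_iff e by simp
  then obtain d where d: "d \<in> M1" "nrpos d" and D': "\<And>y. y \<in> M1 \<Longrightarrow> nunit y \<Longrightarrow> \<not> nreq y x \<Longrightarrow>
      nrdist_less y x d \<Longrightarrow> \<exists>h\<in>M1. \<exists>u\<in>M1. \<exists>q\<in>M1.
              nrop nqsub y x h \<and> nrop nqsub (takagi_code y) (takagi_code x) u \<and>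
              nreal q \<and> nrop nqmul q h u \<and> nrdist_less q L ?e"
    using D rat_code(1)[of "1 / 4"] by blast
  have xr: "nreal x" "0 \<le> rval x" "rval x \<le> 1" and dr: "nreal d" "0 < rval d"
    using x d by (auto simp: nunit_iff nrpos_iff)
  show False
  proof (rule takagi_no_derivative[OF xr(2,3) dr(2), of "rval L"])
    fix q :: rat
    assume q: "0 \<le> real_of_rat q" "real_of_rat q \<le> 1" "real_of_rat q \<noteq> rval x" "\<bar>real_of_rat q - rval x\<bar> < rval d"
    let ?y = "real_code (of_rat q)"
    have "nunit ?y" "\<not> nreq ?y x" "nrdist_less ?y x d"
      using q xr dr x d by (simp_all add: nunit_iff nreq_iff nrdist_less_iff)
    from D'[OF rat_code(1) this] obtain h u r where r: "r \<in> M1" "h \<in> M1"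
      and *: "nrop nqsub ?y x h" "nrop nqsub (takagi_code ?y) (takagi_code x) u" "nreal r"
        "nrop nqmul r h u" "nrdist_less r L ?e"
      by blast
    have h: "nreal h" "rval h = of_rat q - rval x"
      using *(1) xr by (simp_all add: nrop_sub_iff)
    have u: "nreal u" "rval u = takagi (of_rat q) - takagi (rval x)"
      using *(2) by (simp_all add: nrop_sub_iff)
    have m: "rval u = rval r * rval h"
      using *(3,4) h by (simp add: nrop_mul_iff)
    have rL: "\<bar>rval r - rval L\<bar> < 1 / 4"
      using *(5) nrdist_less_iff[OF r(1) L(1) *(3) L(2), of ?e] e by simp
    \<comment> \<open>Multiplying the difference quotient \<open>r\<close> by the increment
      \<open>h\<close> turns its distance from \<open>L\<close> into the linear estimate of
      \<open>takagi_no_derivative\<close>.\<close>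
    have "takagi (of_rat q) - takagi (rval x) - rval L * (of_rat q - rval x) = (rval r - rval L) * rval h"
      unfolding u(2)[symmetric] h(2)[symmetric] m by (rule left_diff_distrib[symmetric])
    then have "\<bar>takagi (of_rat q) - takagi (rval x) - rval L * (of_rat q - rval x)\<bar> = \<bar>rval r - rval L\<bar> * \<bar>rval h\<bar>"
      by (simp only: abs_mult)
    also have "\<dots> \<le> 1 / 4 * \<bar>rval h\<bar>"
      using rL by (intro mult_right_mono) auto
    finally show "\<bar>takagi (of_rat q) - takagi (rval x) - rval L * (of_rat q - rval x)\<bar> \<le> 1 / 4 * \<bar>of_rat q - rval x\<bar>"
      by (simp only: h(2))
  qed
qed


section \<open>The axioms hold in the model\<close>

lemma sat_closed: assumes "mean [] P b" b shows "sat env0 (P [])"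
proof -
  have "wenv [] = env0"
    by (simp add: wenv_def env0_def)
  then show ?thesis
    using assms by (simp add: mean_def valid_def)
qed

lemma sat_semiring_axioms: "\<phi> \<in> semiring_axioms \<Longrightarrow> sat env0 \<phi>"
  unfolding semiring_axioms_def image_insert image_empty
  by (elim insertE emptyE)
    (hypsubst, rule sat_closed, (rule mean_rules den_rules | assumption | rule refl | rule mono_rules)+,
      force simp: algebra_simps)+

lemma sat_combinator_axioms: "\<phi> \<in> combinator_axioms \<Longrightarrow> sat env0 \<phi>"
  unfolding combinator_axioms_def
proof (elim UnE CollectE exE conjE)
  fix \<rho> \<tau> assume \<phi>: "\<phi> = (\<^bold>\<forall>x:\<rho>. \<^bold>\<forall>y:\<tau>. eqT \<rho> (cst (Kc \<rho> \<tau>) \<cdot> x \<cdot> y) x) []"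
  show "sat env0 \<phi>"
    unfolding \<phi>
    by (rule sat_closed,
        (rule mean_all mean_eqT den_consts den_app | assumption | rule refl | rule den_mono)+)
      (auto intro: eqv_head_step[OF head_step.K])
next
  fix \<delta> \<rho> \<tau>
  assume \<phi>: "\<phi> = (\<^bold>\<forall>x:\<delta> \<rightarrow> \<rho> \<rightarrow> \<tau>. \<^bold>\<forall>y:\<delta> \<rightarrow> \<rho>. \<^bold>\<forall>z:\<delta>. eqT \<tau> (cst (Sc \<delta> \<rho> \<tau>) \<cdot> x \<cdot> y \<cdot> z) (x \<cdot> z \<cdot> (y \<cdot> z))) []"
  show "sat env0 \<phi>"
    unfolding \<phi>
    by (rule sat_closed,
        (rule mean_all mean_eqT den_consts den_app | assumption | rule refl | rule den_mono)+)
      (auto intro!: eqv_head_step[OF head_step.S] intro: elts_app)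
qed

lemma sat_extensionality_axioms: "\<phi> \<in> extensionality_axioms \<Longrightarrow> sat env0 \<phi>"
  unfolding extensionality_axioms_def
proof (elim CollectE exE conjE)
  fix \<rho> \<tau>
  assume \<phi>: "\<phi> = (\<^bold>\<forall>F:\<rho> \<rightarrow> \<tau>. \<^bold>\<forall>x:\<rho>. \<^bold>\<forall>y:\<rho>. eqT \<rho> x y \<^bold>\<longrightarrow> eqT \<tau> (F \<cdot> x) (F \<cdot> y)) []"
  show "sat env0 \<phi>"
    unfolding \<phi>
    by (rule sat_closed,
        (rule mean_all mean_imp mean_eqT den_app | assumption | rule refl | rule den_mono)+)
      (auto intro: eqv_app eqv_refl)
qed

lemma sat_recursion_axioms: "\<phi> \<in> recursion_axioms \<Longrightarrow> sat env0 \<phi>"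
  unfolding recursion_axioms_def
  by (elim insertE emptyE)
    (hypsubst, rule sat_closed,
      (rule mean_all00 mean_rules den_rules dn1_app00 | assumption | rule refl | rule mono_rules)+, simp)+

lemma sat_univ_closure:
  "(\<And>\<rho>. typed_env \<Gamma> \<rho> \<Longrightarrow> sat \<rho> \<phi>) \<Longrightarrow> sat \<rho>\<^sub>0 (univ_closure \<Gamma> \<phi>)"
  by (induction \<Gamma> arbitrary: \<phi>) (simp_all add: typed_env_case)

lemma sat_QF_IND: "\<phi> \<in> QF_IND \<Longrightarrow> sat env0 \<phi>"
  unfolding QF_IND_def
proof (elim CollectE exE conjE)
  fix \<Gamma> A
  let ?\<theta> = "\<lambda>i. case i of 0 \<Rightarrow> App (App Plus (Var 0)) One | Suc j \<Rightarrow> Var (Suc j)"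
  assume A: "wff (\<zero> # \<Gamma>) A"
    and \<phi>: "\<phi> = univ_closure \<Gamma> (Imp (inst Zero A) (Imp (Forall \<zero> (Imp A (subst ?\<theta> A))) (Forall \<zero> A)))"
  show "sat env0 \<phi>"
    unfolding \<phi>
  proof (rule sat_univ_closure)
    fix \<rho> assume \<rho>: "typed_env \<Gamma> \<rho>"
    have \<theta>: "(\<lambda>i. itp (case_nat d \<rho>) (?\<theta> i)) = case_nat (C2 (+) \<bullet> d \<bullet> Num 1) \<rho>" for d
      by (auto split: nat.splits)
    have plus: "eqv \<zero> (C2 (+) \<bullet> Num n \<bullet> Num 1) (Num (Suc n))" for n
      using ev.C2[OF ev.Num ev.Num, of "(+)" n 1] ev.Num[of "Suc n"] by (auto simp: eqv_0_iff)
    have "sat (case_nat d \<rho>) A"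
      if base: "sat (case_nat (Num 0) \<rho>) A"
        and step: "\<forall>d\<in>elts \<zero>. sat (case_nat d \<rho>) A \<longrightarrow> sat (case_nat (C2 (+) \<bullet> d \<bullet> Num 1) \<rho>) A"
        and d: "d \<in> elts \<zero>" for d
    proof -
      have "sat (case_nat (Num n) \<rho>) A" for n
      proof (induction n)
        case (Suc n)
        then have "sat (case_nat (C2 (+) \<bullet> Num n \<bullet> Num 1) \<rho>) A"
          using step by simp
        then show ?case
          using sat_eqv_Cons[OF plus \<rho> A] by simp
      qed (rule base)
      then show ?thesis
        using sat_eqv_Cons[OF eqv_Num[OF d] \<rho> A] by simp
    qed
    then show "sat \<rho> (Imp (inst Zero A) (Imp (Forall \<zero> (Imp A (subst ?\<theta> A))) (Forall \<zero> A)))"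
      by (simp only: sat.simps sat_inst sat_subst \<theta> itp.simps) blast
  qed
qed

text \<open>Equality, order and implication of truth values are among \<open>base_funs\<close>, so
  the truth value along a family of environments is computed inside \<open>M1\<close>. This is the
  uniformity behind QF-AC.\<close>

lemma qfree_char_M1:
  assumes "\<And>i. i < length \<Gamma> \<Longrightarrow> rel (\<Gamma> ! i) (\<lambda>p. \<rho> p i) (\<lambda>p. \<rho> p i)"
  shows "qfree A \<Longrightarrow> wff \<Gamma> A \<Longrightarrow> (\<lambda>p. of_bool (sat (\<rho> p) A)) \<in> M1"
proof (induction A)
  case (Eq s t)
  then obtain f g where "f \<in> M1" "g \<in> M1" "\<And>p. ev (itp (\<rho> p) s) (f p)" "\<And>p. ev (itp (\<rho> p) t) (g p)"
    using rel_itp[of \<Gamma> \<rho> \<rho> s \<zero>] rel_itp[of \<Gamma> \<rho> \<rho> t \<zero>] assms by auto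
  moreover from this have "val (itp (\<rho> p) s) = f p" "val (itp (\<rho> p) t) = g p" for p
    by (simp_all only: val_eq)
  ultimately show ?case
    using M1_eq[of f g] by simp
next
  case (Less s t)
  then obtain f g where "f \<in> M1" "g \<in> M1" "\<And>p. ev (itp (\<rho> p) s) (f p)" "\<And>p. ev (itp (\<rho> p) t) (g p)"
    using rel_itp[of \<Gamma> \<rho> \<rho> s \<zero>] rel_itp[of \<Gamma> \<rho> \<rho> t \<zero>] assms by auto
  moreover from this have "val (itp (\<rho> p) s) = f p" "val (itp (\<rho> p) t) = g p" for p
    by (simp_all only: val_eq)
  ultimately show ?case
    using M1_less[of f g] by simp
next
  case (Imp A B)
  then have "(\<lambda>p. of_bool (sat (\<rho> p) A)) \<in> M1" "(\<lambda>p. of_bool (sat (\<rho> p) B)) \<in> M1"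
    by simp_all
  from M1_imp[OF this] show ?case
    by (simp flip: One_nat_def)
qed simp_all

text \<open>There is no constant for functionals of type 2; one is obtained from
  \<open>Op \<Phi>\<close> by fixing the last argument to 0 with the combinators.\<close>

lemma ex_functional2:
  assumes "admissible \<Phi>"
  obtains Y where "Y \<in> elts \<two>" "\<And>x f. x \<in> elts \<one> \<Longrightarrow> eqv \<one> x (C1 f) \<Longrightarrow> eqv \<zero> (Y \<bullet> x) (Num (\<Phi> f 0))"
proof
  let ?Y = "SC \<bullet> Op \<Phi> \<bullet> (KC \<bullet> Num 0)"
  have K0: "KC \<bullet> Num 0 \<in> elts \<two>"
    by (rule elts_app[OF KC_elts Num_elts])
  show Y: "?Y \<in> elts \<two>"
    by (rule elts_app[OF elts_app[OF SC_elts Op_elts[OF assms]] K0])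
  fix x f assume x: "x \<in> elts \<one>" "eqv \<one> x (C1 f)"
  have "KC \<bullet> Num 0 \<bullet> x \<in> elts \<zero>"
    by (rule elts_app[OF K0 x(1)])
  moreover have "val (KC \<bullet> Num 0 \<bullet> x) = 0"
    by (rule val_eq[OF ev.head[OF head_step.K ev.Num]])
  ultimately have "ev (Op \<Phi> \<bullet> x \<bullet> (KC \<bullet> Num 0 \<bullet> x)) (\<Phi> f 0)"
    using ev_Op_app[OF x(2)] by metis
  then have "ev (?Y \<bullet> x) (\<Phi> f 0)"
    by (rule ev.head[OF head_step.S])
  then show "eqv \<zero> (?Y \<bullet> x) (Num (\<Phi> f 0))"
    using ev.Num by (auto simp: eqv_0_iff)
qed

lemma sat_QF_AC: "\<phi> \<in> QF_AC \<one> \<zero> \<Longrightarrow> sat env0 \<phi>"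
  unfolding QF_AC_def
proof (elim CollectE exE conjE)
  fix \<Gamma> A
  let ?\<theta> = "\<lambda>i. case i of 0 \<Rightarrow> App (Var 1) (Var 0) | Suc 0 \<Rightarrow> Var 0 | Suc (Suc j) \<Rightarrow> Var (Suc (Suc j))"
  assume A: "wff (\<zero> # \<one> # \<Gamma>) A" "qfree A"
    and \<phi>: "\<phi> = univ_closure \<Gamma> (Imp (Forall \<one> (Exists \<zero> A)) (Exists (\<one> \<rightarrow> \<zero>) (Forall \<one> (subst ?\<theta> A))))"
  show "sat env0 \<phi>"
    unfolding \<phi>
  proof (rule sat_univ_closure)
    fix \<rho> assume \<rho>: "typed_env \<Gamma> \<rho>"
    define B where "B f n \<longleftrightarrow> sat (case_nat (Num n) (case_nat (C1 f) \<rho>)) A" for f n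
    have B: "sat (case_nat y (case_nat x \<rho>)) A \<longleftrightarrow> B f n" if "eqv \<zero> y (Num n)" "eqv \<one> x (C1 f)" for x y f n
      unfolding B_def
    proof (rule sat_eqv[OF _ A(1)])
      fix i assume "i < length (\<zero> # \<one> # \<Gamma>)"
      then show "eqv ((\<zero> # \<one> # \<Gamma>) ! i) (case_nat y (case_nat x \<rho>) i) (case_nat (Num n) (case_nat (C1 f) \<rho>) i)"
        using that \<rho> by (auto simp: nth_Cons typed_env_def intro: eqv_refl split: nat.splits)
    qed
    \<comment> \<open>The choice functional takes the least witness. Truth of \<open>A\<close> along
      a sequence is in \<open>M1\<close>, which is closed under least-number search; and by
      \<open>B\<close> the choice depends only on the function named by \<open>x\<close>.\<close>
    have "admissible (\<lambda>f k. LEAST n. B f n)"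
      unfolding admissible_def
    proof
      fix G assume G: "G \<in> M1"
      let ?\<rho> = "\<lambda>p. case_nat (Num (snd (prod_decode p))) (case_nat (C1 (row G (fst (prod_decode p)))) \<rho>)"
      have "(\<lambda>p. of_bool (sat (?\<rho> p) A)) \<in> M1"
      proof (rule qfree_char_M1[OF _ A(2,1)])
        fix i assume i: "i < length (\<zero> # \<one> # \<Gamma>)"
        consider "i = 0" | "i = 1" | j where "i = Suc (Suc j)"
          by (metis One_nat_def not0_implies_Suc)
        then show "rel ((\<zero> # \<one> # \<Gamma>) ! i) (\<lambda>p. ?\<rho> p i) (\<lambda>p. ?\<rho> p i)"
        proof cases
          case 1
          then show ?thesis
            using rel_Num[OF M1_snd[OF M1_ident]] by (simp del: rel.simps)
        next
          case 2
          then show ?thesis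
            using rel_reindex[OF rel_C1_rows[OF G] M1_fst[OF M1_ident]] by simp
        next
          case 3
          then show ?thesis
            using \<rho> i by (simp add: typed_env_def elts_def eqv_def del: rel.simps)
        qed
      qed
      then have "uncurry (\<lambda>p n. of_bool (B (row G p) n)) \<in> M1"
        by (simp add: B_def uncurry_def case_prod_unfold)
      from M1_comp[OF M1_least[OF this] M1_fst[OF M1_ident]]
      show "uncurry (\<lambda>p k. LEAST n. B (row G p) n) \<in> M1"
        by (simp add: uncurry_def[of "\<lambda>p k. LEAST n. B (row G p) n"] case_prod_unfold
            flip: One_nat_def)
    qed
    then obtain Y where Y: "Y \<in> elts \<two>"
      "\<And>x f. x \<in> elts \<one> \<Longrightarrow> eqv \<one> x (C1 f) \<Longrightarrow> eqv \<zero> (Y \<bullet> x) (Num (LEAST n. B f n))"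
      by (rule ex_functional2) blast
    have \<theta>: "(\<lambda>i. itp (case_nat x (case_nat Z \<rho>)) (?\<theta> i)) = case_nat (Z \<bullet> x) (case_nat x \<rho>)" for x Z
      by (auto split: nat.splits)
    have "sat (case_nat (Y \<bullet> x) (case_nat x \<rho>)) A"
      if ex: "\<forall>x\<in>elts \<one>. \<exists>y\<in>elts \<zero>. sat (case_nat y (case_nat x \<rho>)) A" and x: "x \<in> elts \<one>" for x
    proof -
      obtain f where f: "eqv \<one> x (C1 f)"
        using eqv_C1[OF x] by blast
      obtain y where y: "y \<in> elts \<zero>" "sat (case_nat y (case_nat x \<rho>)) A"
        using ex x by blast
      then have "B f (val y)"
        using B[OF eqv_Num[OF y(1)] f] by simp
      then have "B f (LEAST n. B f n)"
        by (rule LeastI)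
      then show ?thesis
        using B[OF Y(2)[OF x f] f] by simp
    qed
    with Y(1) show "sat \<rho> (Imp (Forall \<one> (Exists \<zero> A)) (Exists (\<one> \<rightarrow> \<zero>) (Forall \<one> (subst ?\<theta> A))))"
      by (simp only: sat.simps sat_subst \<theta>) blast
  qed
qed

lemma sat_RCA0: "\<phi> \<in> RCA0\<omega> \<Longrightarrow> sat env0 \<phi>"
  unfolding RCA0\<omega>_def
  using sat_semiring_axioms sat_combinator_axioms sat_recursion_axioms sat_extensionality_axioms
    sat_QF_IND sat_QF_AC by blast

section \<open>The Suslin functionals\<close>

lemma dn0_tuple: "list_all2 (dn0 W) ss ns \<Longrightarrow> dn0 W (tuple ss) (ntuple ns)"
proof (induction ss arbitrary: ns rule: tuple.induct)
  case (3 s t ss)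
  then obtain n m ms where "ns = n # m # ms" "dn0 W s n" "list_all2 (dn0 W) (t # ss) (m # ms)"
    by (auto simp: list_all2_Cons1)
  then show ?case
    using dn0_pr[OF _ 3(1) refl] by simp
qed (auto simp: list_all2_Cons1 intro: dn0_zero)

lemma mean_alternate:
  "list_all2 (dn1 W) gs hs \<Longrightarrow> dn1 W x f \<Longrightarrow> mean W (alternate ex k gs x) (nalternate M1 ex k hs f)"
proof (induction k arbitrary: ex W gs hs)
  case 0
  have "mean (V @ W) (x \<cdot> tuple (map (\<lambda>g. initseg g n) (rev gs)) \<^bold>= \<^bold>0)
      (f (ntuple (map (\<lambda>g. nseg g m) (rev hs))) = 0)" if n: "dn0 (V @ W) n m" for V n m
  proof -
    have "list_all2 (dn0 (V @ W)) (map (\<lambda>g. initseg g n) (rev gs)) (map (\<lambda>g. nseg g m) (rev hs))"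
      unfolding list_all2_map1 list_all2_map2 list_all2_rev
      by (rule list_all2_mono[OF 0(1)]) (intro dn0_initseg[OF _ n refl] dn_mono)
    from dn0_app[OF dn_mono(2)[OF 0(2)] dn0_tuple[OF this] refl] show ?thesis
      by (rule mean_peq[OF _ dn0_zero[OF refl] refl])
  qed
  then show ?case
    by (cases ex) (simp_all add: mean_ex0 mean_all0)
next
  case (Suc k)
  have "mean (V @ W) (alternate b k (g # gs) x) (nalternate M1 b k (h # hs) f)" if "dn1 (V @ W) g h" for V g h b
  proof (rule Suc.IH)
    show "list_all2 (dn1 (V @ W)) (g # gs) (h # hs)"
      using that list_all2_mono[OF Suc.prems(1), of "dn1 (V @ W)"] dn_mono(2) by simp
    show "dn1 (V @ W) x f"
      by (rule dn_mono(2)[OF Suc.prems(2)])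
  qed
  then show ?case
    by (cases ex) (simp_all add: mean_ex1 mean_all1)
qed

text \<open>The body is evaluated at the witness alone. This covers types such as 2, for which no
  system of representatives has been set up.\<close>

lemma mean_ex_witness:
  assumes "e \<in> elts \<tau>" "\<And>V x. den (V @ W) x \<tau> e \<Longrightarrow> mean (V @ W) (P x) True"
  shows "mean W (pex \<tau> P) True"
proof -
  have "den ([(\<tau>, e)] @ W) (bound (wctx W)) \<tau> e"
    using den_bound[OF assms(1)] by simp
  from assms(2)[OF this] show ?thesis
    using assms(1) by (auto simp: mean_def pex_def valid_Cons wenv_Cons)
qed

lemma mean_all_counterexample:
  assumes "e \<in> elts \<tau>" "\<And>V x. den (V @ W) x \<tau> e \<Longrightarrow> mean (V @ W) (P x) False"
  shows "mean W (pall \<tau> P) False"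
proof -
  have "den ([(\<tau>, e)] @ W) (bound (wctx W)) \<tau> e"
    using den_bound[OF assms(1)] by simp
  from assms(2)[OF this] show ?thesis
    using assms(1) by (auto simp: mean_def pall_def valid_Cons wenv_Cons)
qed

text \<open>The functional decides truth in Baire space, the axiom speaks of truth in the model;
  \<open>nalternate_M1\<close> identifies the two.\<close>

lemma sat_Suslin: "sat env0 (Suslin_ax k)"
proof -
  obtain Y where Y: "Y \<in> elts \<two>"
    "\<And>x f. x \<in> elts \<one> \<Longrightarrow> eqv \<one> x (C1 f) \<Longrightarrow> eqv \<zero> (Y \<bullet> x) (Num (sigma_char k f 0))"
    using ex_functional2[OF admissible_sigma[of k]] by blast
  have app: "dn0 W (S \<cdot> x) (sigma_char k f 0)" if S: "den W S \<two> Y" and x: "dn1 W x f" for W S x f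
  proof -
    have f: "f \<in> M1" "den W x \<one> (C1 f)"
      using x by (simp_all add: dn1_def)
    have "eqv \<zero> (Y \<bullet> C1 f) (Num (sigma_char k f 0))"
      by (rule Y(2)[OF C1_elts[OF f(1)] eqv_refl[OF C1_elts[OF f(1)]]])
    then show ?thesis
      unfolding dn0_def by (rule den_eqv[OF den_app[OF S f(2)]])
  qed
  show ?thesis
    unfolding Suslin_ax_def
  proof (rule sat_closed[OF _ TrueI], rule mean_ex_witness[OF Y(1)], rule mean_cong, rule mean_all1)
    fix V S V' x f assume S: "den (V @ []) S \<two> Y" and x: "dn1 (V' @ V @ []) x f"
    note d = app[OF den_mono[OF S] x]
    show "mean (V' @ V @ []) ((S \<cdot> x \<^bold>= \<^bold>0 \<^bold>\<or> S \<cdot> x \<^bold>= \<^bold>1) \<^bold>\<and> (S \<cdot> x \<^bold>= \<^bold>0 \<^bold>\<longleftrightarrow> alternate True k [] x))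
      ((sigma_char k f 0 = 0 \<or> sigma_char k f 0 = 1) \<and> (sigma_char k f 0 = 0 \<longleftrightarrow> nalternate M1 True k [] f))"
      by (intro mean_and mean_or mean_iff mean_peq[OF d _ refl] dn0_zero dn0_one refl
          mean_alternate[OF _ x]) simp
  qed (simp add: sigma_char_def nalternate_M1)
qed

section \<open>Finite choice for IND0\<close>

definition ncantor :: "(nat \<Rightarrow> nat) \<Rightarrow> bool" where
  "ncantor f \<longleftrightarrow> (\<forall>n. f n = 0 \<or> f n = 1)"

lemma mean_cantor: "dn1 W x f \<Longrightarrow> mean W (cantor x) (ncantor f)"
  unfolding cantor_def ncantor_def
  by (rule mean_rules den_rules | assumption | rule refl | rule mono_rules)+

lemma mean_eqT1: "dn1 W x f \<Longrightarrow> dn1 W y g \<Longrightarrow> mean W (eqT \<one> x y) (eqv \<one> (C1 f) (C1 g))"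
  by (rule mean_eqT[OF _ _ refl]) (simp_all add: dn1_def)

text \<open>The family \<open>c\<close> may be chosen outside the model; finitely many of its
  members are pasted together by adding, for each index, a characteristic function times the
  member.\<close>

lemma finite_family_M1:
  assumes "\<And>m. c m \<in> M1" shows "uncurry (\<lambda>m. if m < k then c m else (\<lambda>_. 0)) \<in> M1"
proof (induction k)
  case 0
  then show ?case by (simp add: uncurry_def case_prod_unfold)
next
  case (Suc k)
  have "(\<lambda>p. of_bool (fst (prod_decode p) = k) * c k (snd (prod_decode p))
      + uncurry (\<lambda>m. if m < k then c m else (\<lambda>_. 0)) p) \<in> M1"
    using Suc.IH by (intro M1_add M1_mult M1_eq M1_fst M1_ident M1_const M1_comp[OF assms] M1_snd) simp
  moreover have "(\<lambda>p. of_bool (fst (prod_decode p) = k) * c k (snd (prod_decode p))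
      + uncurry (\<lambda>m. if m < k then c m else (\<lambda>_. 0)) p) = uncurry (\<lambda>m. if m < Suc k then c m else (\<lambda>_. 0))"
    by (auto simp: uncurry_def case_prod_unfold less_Suc_eq)
  ultimately show ?case by simp
qed

lemma sat_IND0: "sat env0 IND0"
proof -
  \<comment> \<open>Witnesses are chosen in the metatheory and set to 0 from \<open>k\<close> on,
    which brings the family into \<open>M1\<close>.\<close>
  have finite_choice: "\<exists>u\<in>{u. uncurry u \<in> M1}. \<forall>m. m < k \<longrightarrow> (Q (u m) m \<longleftrightarrow> (\<exists>f\<in>M1. Q f m))" for Q k
  proof -
    have "\<exists>c. \<forall>m. c m \<in> M1 \<and> ((\<exists>f\<in>M1. Q f m) \<longrightarrow> Q (c m) m)"
      using M1_const[of 0] by (intro choice) blast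
    then obtain c where c: "\<And>m. c m \<in> M1" "\<And>m. (\<exists>f\<in>M1. Q f m) \<longrightarrow> Q (c m) m"
      by blast
    show ?thesis
      by (rule bexI[of _ "\<lambda>m. if m < k then c m else (\<lambda>_. 0)"]) (use c in \<open>auto intro: finite_family_M1\<close>)
  qed
  have "mean [] (\<^bold>\<forall>Y:\<one> \<rightarrow> \<zero> \<rightarrow> \<zero>.
        (\<^bold>\<forall>n:\<zero>. \<^bold>\<forall>f:\<one>. \<^bold>\<forall>g:\<one>.
            cantor f \<^bold>\<and> cantor g \<^bold>\<and> Y \<cdot> f \<cdot> n \<^bold>= \<^bold>0 \<^bold>\<and> Y \<cdot> g \<cdot> n \<^bold>= \<^bold>0 \<^bold>\<longrightarrow> eqT \<one> f g) \<^bold>\<longrightarrow>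
        (\<^bold>\<forall>k:\<zero>. \<^bold>\<exists>w:\<zero> \<rightarrow> \<one>. \<^bold>\<forall>m:\<zero>. m \<^bold>< k \<^bold>\<longrightarrow>
            (cantor (w \<cdot> m) \<^bold>\<and> Y \<cdot> (w \<cdot> m) \<cdot> m \<^bold>= \<^bold>0 \<^bold>\<longleftrightarrow>
             (\<^bold>\<exists>f:\<one>. cantor f \<^bold>\<and> Y \<cdot> f \<cdot> m \<^bold>= \<^bold>0))))
     (\<forall>\<Phi>\<in>Collect admissible.
        (\<forall>n. \<forall>f\<in>M1. \<forall>g\<in>M1. ncantor f \<and> ncantor g \<and> \<Phi> f n = 0 \<and> \<Phi> g n = 0 \<longrightarrow> eqv \<one> (C1 f) (C1 g)) \<longrightarrow>
        (\<forall>k. \<exists>u\<in>{u. uncurry u \<in> M1}. \<forall>m. m < k \<longrightarrow>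
           (ncantor (u m) \<and> \<Phi> (u m) m = 0 \<longleftrightarrow> (\<exists>f\<in>M1. ncantor f \<and> \<Phi> f m = 0))))"
  proof (rule mean_all11, rule mean_imp)
    fix V Y \<Phi> assume Y: "dn11 (V @ []) Y \<Phi>"
    show "mean (V @ []) (\<^bold>\<forall>n:\<zero>. \<^bold>\<forall>f:\<one>. \<^bold>\<forall>g:\<one>.
            cantor f \<^bold>\<and> cantor g \<^bold>\<and> Y \<cdot> f \<cdot> n \<^bold>= \<^bold>0 \<^bold>\<and> Y \<cdot> g \<cdot> n \<^bold>= \<^bold>0 \<^bold>\<longrightarrow> eqT \<one> f g)
       (\<forall>n. \<forall>f\<in>M1. \<forall>g\<in>M1. ncantor f \<and> ncantor g \<and> \<Phi> f n = 0 \<and> \<Phi> g n = 0 \<longrightarrow> eqv \<one> (C1 f) (C1 g))"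
      by (rule mean_cantor mean_eqT1 mean_fun_rules | assumption | rule refl | rule Y | rule mono_rules)+
    show "mean (V @ []) (\<^bold>\<forall>k:\<zero>. \<^bold>\<exists>w:\<zero> \<rightarrow> \<one>. \<^bold>\<forall>m:\<zero>. m \<^bold>< k \<^bold>\<longrightarrow>
            (cantor (w \<cdot> m) \<^bold>\<and> Y \<cdot> (w \<cdot> m) \<cdot> m \<^bold>= \<^bold>0 \<^bold>\<longleftrightarrow>
             (\<^bold>\<exists>f:\<one>. cantor f \<^bold>\<and> Y \<cdot> f \<cdot> m \<^bold>= \<^bold>0)))
       (\<forall>k. \<exists>u\<in>{u. uncurry u \<in> M1}. \<forall>m. m < k \<longrightarrow>
           (ncantor (u m) \<and> \<Phi> (u m) m = 0 \<longleftrightarrow> (\<exists>f\<in>M1. ncantor f \<and> \<Phi> f m = 0)))"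
    proof (rule mean_all0, rule mean_ex00, rule mean_all0)
      fix V1 k k' V2 w u V3 m m'
      let ?W = "V3 @ V2 @ V1 @ V @ []"
      assume k: "dn0 (V1 @ V @ []) k k'" and w: "dn00 (V2 @ V1 @ V @ []) w u" and m: "dn0 ?W m m'"
      have Y': "dn11 ?W Y \<Phi>"
        by (intro dn_mono(4) Y)
      have wm: "dn1 ?W (w \<cdot> m) (u m')"
        by (rule dn1_app00[OF dn_mono(3)[OF w] m refl])
      show "mean ?W (m \<^bold>< k \<^bold>\<longrightarrow> (cantor (w \<cdot> m) \<^bold>\<and> Y \<cdot> (w \<cdot> m) \<cdot> m \<^bold>= \<^bold>0 \<^bold>\<longleftrightarrow>
             (\<^bold>\<exists>f:\<one>. cantor f \<^bold>\<and> Y \<cdot> f \<cdot> m \<^bold>= \<^bold>0)))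
          (m' < k' \<longrightarrow> (ncantor (u m') \<and> \<Phi> (u m') m' = 0 \<longleftrightarrow> (\<exists>f\<in>M1. ncantor f \<and> \<Phi> f m' = 0)))"
        by (rule wm mean_cantor mean_fun_rules | assumption | rule refl | rule Y' m | rule mono_rules k)+
    qed
  qed
  then show ?thesis
    unfolding IND0_def
  proof (rule sat_closed, intro ballI impI allI)
    fix \<Phi> k
    show "\<exists>u\<in>{u. uncurry u \<in> M1}. \<forall>m. m < k \<longrightarrow>
        (ncantor (u m) \<and> \<Phi> (u m) m = 0 \<longleftrightarrow> (\<exists>f\<in>M1. ncantor f \<and> \<Phi> f m = 0))"
      by (rule finite_choice)
  qed
qed

lemma sat_Z2_IND0: "\<phi> \<in> Z2\<omega>_IND0 \<Longrightarrow> sat env0 \<phi>"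
  unfolding Z2\<omega>_IND0_def Z2\<omega>_def using sat_RCA0 sat_Suslin sat_IND0 by blast

lemma Z2_IND0_not_provable: assumes "mean [] P False" shows "\<not> Z2\<omega>_IND0 \<turnstile> P []"
proof
  assume "Z2\<omega>_IND0 \<turnstile> P []"
  then have "derives Z2\<omega>_IND0 [] [] (P [])"
    by (simp only: proves_def)
  from soundness[OF sat_Z2_IND0 this, of env0] have "sat env0 (P [])"
    by simp
  moreover have "sat env0 ((\<^bold>\<not> P) [])"
    by (rule sat_closed[OF mean_not[OF assms]]) simp
  ultimately show False
    by (simp add: pnot_def)
qed


section \<open>Every continuous function of the model is in ACG and in ACG*\<close>

text \<open>Passing to the canonical code before taking the index makes each set respect equality of
  reals.\<close>

definition singletons :: "(nat \<Rightarrow> nat) \<Rightarrow> nat \<Rightarrow> nat" where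
  "singletons x n = of_bool (index (canonical_code x) = n)"

lemma admissible_singletons: "admissible singletons"
  using admissible_index by (simp add: singletons_def[abs_def])

lemma singletons_iff: "singletons x n = 1 \<longleftrightarrow> index (canonical_code x) = n"
  by (simp add: singletons_def)

lemma singletons_unique:
  assumes "x \<in> M1" "y \<in> M1" "singletons x n = 1" "singletons y n = 1"
  shows "rval x = rval y"
proof -
  have "index (canonical_code x) = index (canonical_code y)"
    using assms(3,4) unfolding singletons_iff by simp
  from index_inj[OF _ _ this] have "canonical_code x = canonical_code y"
    using assms(1,2) admissible_M1[OF admissible_canonical] by blast
  then show ?thesis
    unfolding canonical_code_def by (metis rval_real_code)
qed

lemma mean_mem: "dn11 W C \<Phi> \<Longrightarrow> dn0 W n m \<Longrightarrow> dn1 W x f \<Longrightarrow> mean W (mem C n x) (nunit f \<and> \<Phi> f m = 1)"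
  unfolding mem_def by (rule mean_fun_rules | assumption | rule refl | rule mono_rules)+

lemma mean_and_False: "mean W P False \<Longrightarrow> mean W (P \<^bold>\<and> Q) False"
  by (simp add: mean_def pand_def pimp_def pnot_def)

text \<open>A false premise spares the evaluation of \<open>Q\<close>: the sums in the definition of
  absolute continuity stay uninterpreted, so that AC and its starred version are treated at
  once.\<close>

lemma mean_imp_False: "mean W P False \<Longrightarrow> mean W (P \<^bold>\<longrightarrow> Q) True"
  by (simp add: mean_def pimp_def)

text \<open>
  The sets of the sequence have at most one element, so there is no interval with both endpoints
  in one of them.
\<close>

lemma mean_AC_wrt_singletons:
  assumes C: "dn11 W C singletons" and n: "dn0 W n m"
  shows "mean W (AC_wrt V (mem C n)) True"
proof -
  have disjoint: "mean (U @ W) (disjoint_intervals (mem C n) a b k) False"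
    if a: "dn00 (U @ W) a u" and b: "dn00 (U @ W) b v" and k: "dn0 (U @ W) k k'" for U a b k u v k'
  proof -
    have 1: "mean (U @ W) (\<^bold>\<forall>i:\<zero>. i \<^bold>\<le> k \<^bold>\<longrightarrow> mem C n (a \<cdot> i) \<^bold>\<and> mem C n (b \<cdot> i) \<^bold>\<and> a \<cdot> i <\<^sub>\<real> b \<cdot> i)
      (\<forall>i. (i < k' \<or> i = k') \<longrightarrow> (nunit (u i) \<and> singletons (u i) m = 1) \<and>
         (nunit (v i) \<and> singletons (v i) m = 1) \<and> nrless (u i) (v i))"
      by (rule mean_mem mean_rless mean_rules dn1_app00 | assumption | rule refl | rule C n a b k | rule mono_rules)+
    have "\<not> (\<forall>i. (i < k' \<or> i = k') \<longrightarrow> (nunit (u i) \<and> singletons (u i) m = 1) \<and>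
         (nunit (v i) \<and> singletons (v i) m = 1) \<and> nrless (u i) (v i))"
    proof
      assume "\<forall>i. (i < k' \<or> i = k') \<longrightarrow> (nunit (u i) \<and> singletons (u i) m = 1) \<and>
         (nunit (v i) \<and> singletons (v i) m = 1) \<and> nrless (u i) (v i)"
      \<comment> \<open>Collections are indexed by all i \<le> k, hence are never empty; the last
        interval already gives the contradiction.\<close>
      then have *: "nunit (u k')" "singletons (u k') m = 1" "nunit (v k')" "singletons (v k') m = 1"
        "nrless (u k') (v k')"
        by auto
      have "u k' \<in> M1" "v k' \<in> M1"
        using a b M1_row[of "uncurry u" k'] M1_row[of "uncurry v" k'] by (simp_all add: dn00_def)
      from singletons_unique[OF this *(2,4)] *(1,3,5) show False
        by (simp add: nunit_iff nrless_iff)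
    qed
    then have "mean (U @ W) (\<^bold>\<forall>i:\<zero>. i \<^bold>\<le> k \<^bold>\<longrightarrow> mem C n (a \<cdot> i) \<^bold>\<and> mem C n (b \<cdot> i) \<^bold>\<and> a \<cdot> i <\<^sub>\<real> b \<cdot> i) False"
      by (intro mean_cong[OF 1]) blast
    then show ?thesis
      unfolding disjoint_intervals_def by (rule mean_and_False)
  qed
  have d: "mean (U @ W) (rpos e \<^bold>\<longrightarrow> (\<^bold>\<exists>d:\<one>. rpos d \<^bold>\<and>
        (\<^bold>\<forall>k:\<zero>. \<^bold>\<forall>a:\<zero> \<rightarrow> \<one>. \<^bold>\<forall>b:\<zero> \<rightarrow> \<one>. disjoint_intervals (mem C n) a b k \<^bold>\<longrightarrow>
           sum_less rdist a b k d \<^bold>\<longrightarrow> sum_less V a b k e))) True"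
    if e: "dn1 (U @ W) e g" for U e g
  proof (cases "nrpos g")
    case False
    then show ?thesis
      using mean_rpos[OF e] by (intro mean_imp_False) simp
  next
    case True
    have *: "mean (U' @ U @ W) (rpos d \<^bold>\<and>
        (\<^bold>\<forall>k:\<zero>. \<^bold>\<forall>a:\<zero> \<rightarrow> \<one>. \<^bold>\<forall>b:\<zero> \<rightarrow> \<one>. disjoint_intervals (mem C n) a b k \<^bold>\<longrightarrow>
           sum_less rdist a b k d \<^bold>\<longrightarrow> sum_less V a b k e)) (nrpos h)"
      if h: "dn1 (U' @ U @ W) d h" for U' d h
    proof (rule mean_cong[OF mean_and[OF mean_rpos[OF h] mean_all0]], rule mean_all00, rule mean_all00, rule mean_imp_False)
      fix V1 k k' V2 a u V3 b v
      assume "dn0 (V1 @ U' @ U @ W) k k'" "dn00 (V2 @ V1 @ U' @ U @ W) a u" "dn00 (V3 @ V2 @ V1 @ U' @ U @ W) b v"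
      then show "mean (V3 @ V2 @ V1 @ U' @ U @ W) (disjoint_intervals (mem C n) a b k) False"
        using disjoint[of "V3 @ V2 @ V1 @ U' @ U" a u b v k k'] dn_mono by simp
    qed simp
    \<comment> \<open>Any positive real can serve as delta; epsilon itself is one.\<close>
    have "\<exists>h\<in>M1. nrpos h"
      using True dn1_M1[OF e] by blast
    with mean_cong[OF mean_imp[OF mean_rpos[OF e] mean_ex1[OF *]]] show ?thesis
      by simp
  qed
  from mean_all1[OF d] show ?thesis
    unfolding AC_wrt_def by simp
qed

lemma mean_generalised:
  assumes A: "\<And>f X. \<exists>V. A f X = AC_wrt V X"
    and f: "dn11 W f \<Phi>" "nreal_fun \<Phi>" "ncontinuous \<Phi>"
  shows "mean W (generalised A f) True"
proof -
  \<comment> \<open>The complement of a set with at most one point is open: if the set has a point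
    in the model, a ball of radius below the distance to it avoids the set; otherwise every ball
    does.\<close>
  have sep: "\<exists>k. \<forall>y\<in>M1. nunit y \<and> nrdist_less x y (\<lambda>_. ncode (nqeps k)) \<longrightarrow> \<not> (nunit y \<and> singletons y n = 1)"
    if x: "x \<in> M1" "nunit x" "singletons x n \<noteq> 1" for x n
  proof (cases "\<exists>z\<in>M1. nunit z \<and> singletons z n = 1")
    case True
    then obtain z where z: "z \<in> M1" "nunit z" "singletons z n = 1"
      by blast
    have "rval x \<noteq> rval z"
    proof
      assume "rval x = rval z"
      then have "singletons x n = singletons z n"
        by (simp add: singletons_def canonical_code_def)
      with x z show False by simp
    qed
    then obtain k where k: "1 / 2 ^ k < \<bar>rval x - rval z\<bar>"
      using ex_inverse_power_less[of "\<bar>rval x - rval z\<bar>" 1] by auto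
    have "\<not> (nunit y \<and> singletons y n = 1)"
      if y: "y \<in> M1" "nunit y \<and> nrdist_less x y (\<lambda>_. ncode (nqeps k))" for y
    proof
      assume "nunit y \<and> singletons y n = 1"
      then have "rval y = rval z"
        using singletons_unique y z by blast
      moreover have "\<bar>rval x - rval y\<bar> < 1 / 2 ^ k"
        using y(2) x(2) const_ncode[of "nqeps k"] nrdist_less_iff[OF x(1) y(1), of "\<lambda>_. ncode (nqeps k)"]
        by (auto simp: nunit_iff)
      ultimately show False
        using k by simp
    qed
    then show ?thesis by blast
  next
    case False
    then show ?thesis by blast
  qed
  have sets: "mean (U @ W) (set_seq C \<^bold>\<and> (\<^bold>\<forall>n:\<zero>. is_closed (mem C n)) \<^bold>\<and>
         (\<^bold>\<forall>x:\<one>. unit_interval x \<^bold>\<longrightarrow> (\<^bold>\<exists>n:\<zero>. mem C n x)) \<^bold>\<and> (\<^bold>\<forall>n:\<zero>. A f (mem C n))) True"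
    if C: "dn11 (U @ W) C singletons" for U C
  proof -
    have "mean (U @ W) (set_seq C)
      ((\<forall>x\<in>M1. \<forall>n. nunit x \<longrightarrow> singletons x n = 0 \<or> singletons x n = 1) \<and>
       (\<forall>x\<in>M1. \<forall>y\<in>M1. \<forall>n. nunit x \<and> nunit y \<and> nreq x y \<longrightarrow> singletons x n = singletons y n))"
      unfolding set_seq_def
      by (rule mean_fun_rules | assumption | rule refl | rule C | rule mono_rules)+
    moreover have "(\<forall>x\<in>M1. \<forall>n. nunit x \<longrightarrow> singletons x n = 0 \<or> singletons x n = 1) \<and>
       (\<forall>x\<in>M1. \<forall>y\<in>M1. \<forall>n. nunit x \<and> nunit y \<and> nreq x y \<longrightarrow> singletons x n = singletons y n)"
      by (auto simp: singletons_def nunit_iff nreq_iff canonical_code_def)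
    ultimately have 1: "mean (U @ W) (set_seq C) True"
      by simp
    have "mean (U @ W) (\<^bold>\<forall>n:\<zero>. is_closed (mem C n))
      (\<forall>n. \<forall>x\<in>M1. nunit x \<and> \<not> (nunit x \<and> singletons x n = 1) \<longrightarrow>
        (\<exists>k. \<forall>y\<in>M1. nunit y \<and> nrdist_less x y (\<lambda>_. ncode (nqeps k)) \<longrightarrow> \<not> (nunit y \<and> singletons y n = 1)))"
      unfolding is_closed_def is_open_def
      by (rule mean_mem mean_fun_rules | assumption | rule refl | rule C | rule mono_rules)+
    then have 2: "mean (U @ W) (\<^bold>\<forall>n:\<zero>. is_closed (mem C n)) True"
      by (rule mean_cong) (use sep in blast)
    have "mean (U @ W) (\<^bold>\<forall>x:\<one>. unit_interval x \<^bold>\<longrightarrow> (\<^bold>\<exists>n:\<zero>. mem C n x))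
      (\<forall>x\<in>M1. nunit x \<longrightarrow> (\<exists>n. nunit x \<and> singletons x n = 1))"
      by (rule mean_mem mean_fun_rules | assumption | rule refl | rule C | rule mono_rules)+
    then have 3: "mean (U @ W) (\<^bold>\<forall>x:\<one>. unit_interval x \<^bold>\<longrightarrow> (\<^bold>\<exists>n:\<zero>. mem C n x)) True"
      by (rule mean_cong) (simp only: singletons_iff, blast)
    have "mean (V' @ U @ W) (A f (mem C n)) True" if n: "dn0 (V' @ U @ W) n m" for V' n m
      using A[of f "mem C n"] mean_AC_wrt_singletons[OF dn_mono(4)[OF C] n] by metis
    from mean_cong[OF mean_all0[OF this]] have 4: "mean (U @ W) (\<^bold>\<forall>n:\<zero>. A f (mem C n)) True"
      by simp
    show ?thesis
      using mean_and[OF 1 mean_and[OF 2 mean_and[OF 3 4]]] by simp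
  qed
  have "mean W (\<^bold>\<exists>C:\<one> \<rightarrow> \<zero> \<rightarrow> \<zero>. set_seq C \<^bold>\<and> (\<^bold>\<forall>n:\<zero>. is_closed (mem C n)) \<^bold>\<and>
         (\<^bold>\<forall>x:\<one>. unit_interval x \<^bold>\<longrightarrow> (\<^bold>\<exists>n:\<zero>. mem C n x)) \<^bold>\<and> (\<^bold>\<forall>n:\<zero>. A f (mem C n))) True"
    by (rule mean_ex_witness[OF Op_elts[OF admissible_singletons]], rule sets)
      (simp add: dn11_def admissible_singletons)
  from mean_and[OF mean_real_fun[OF f(1)] mean_and[OF mean_continuous[OF f(1)] this]] f(2,3)
  show ?thesis
    by (simp add: generalised_def)
qed

section \<open>Refutation of the four sentences\<close>

lemma takagi_dn11: "den W f (\<one> \<rightarrow> \<one>) (Op takagi_code) \<Longrightarrow> dn11 W f takagi_code"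
  by (simp add: dn11_def admissible_takagi)

lemma not_provable_somewhere_differentiable:
  assumes G: "\<And>W f \<Phi>. dn11 W f \<Phi> \<Longrightarrow> nreal_fun \<Phi> \<Longrightarrow> ncontinuous \<Phi> \<Longrightarrow> mean W (G f) True"
  shows "\<not> Z2\<omega>_IND0 \<turnstile> somewhere_differentiable G"
  unfolding somewhere_differentiable_def
proof (rule Z2_IND0_not_provable, rule mean_all_counterexample[OF Op_elts[OF admissible_takagi]])
  fix V f assume "den (V @ []) f (\<one> \<rightarrow> \<one>) (Op takagi_code)"
  then have f: "dn11 (V @ []) f takagi_code"
    by (rule takagi_dn11)
  have "mean (V @ []) (\<^bold>\<exists>x:\<one>. unit_interval x \<^bold>\<and> differentiable_at f x)
      (\<exists>x\<in>M1. nunit x \<and> ndifferentiable takagi_code x)"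
    by (rule mean_differentiable mean_fun_rules | assumption | rule refl | rule f | rule mono_rules)+
  then have "mean (V @ []) (\<^bold>\<exists>x:\<one>. unit_interval x \<^bold>\<and> differentiable_at f x) False"
    by (rule mean_cong) (use not_ndifferentiable_takagi in blast)
  from mean_imp[OF G[OF f nreal_fun_takagi ncontinuous_takagi] this]
  show "mean (V @ []) (G f \<^bold>\<longrightarrow> (\<^bold>\<exists>x:\<one>. unit_interval x \<^bold>\<and> differentiable_at f x)) False"
    by simp
qed

text \<open>In the model the complement of the class is empty, so it approximates nothing. The
  Takagi function and the bound 1 merely provide one continuous function and one positive
  real.\<close>

lemma not_provable_complement_dense:
  assumes G: "\<And>W f \<Phi>. dn11 W f \<Phi> \<Longrightarrow> nreal_fun \<Phi> \<Longrightarrow> ncontinuous \<Phi> \<Longrightarrow> mean W (G f) True"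
  shows "\<not> Z2\<omega>_IND0 \<turnstile> complement_dense G"
  unfolding complement_dense_def
proof (rule Z2_IND0_not_provable, rule mean_all_counterexample[OF Op_elts[OF admissible_takagi]])
  fix V g assume "den (V @ []) g (\<one> \<rightarrow> \<one>) (Op takagi_code)"
  then have g: "dn11 (V @ []) g takagi_code"
    by (rule takagi_dn11)
  have one: "one_seq \<in> M1"
    unfolding one_seq_def by (rule M1_const)
  \<comment> \<open>The formula \<open>R\<close> is arbitrary, so the closeness condition need not
    be evaluated.\<close>
  have no: "mean (U @ W) (real_fun f \<^bold>\<and> continuous_on_unit f \<^bold>\<and> \<^bold>\<not> G f \<^bold>\<and> R f) False"
    if f: "dn11 (U @ W) f \<Phi>" for U W f \<Phi> R
  proof (cases "nreal_fun \<Phi> \<and> ncontinuous \<Phi>")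
    case True
    then have "mean (U @ W) (\<^bold>\<not> G f) False"
      using mean_not[OF G[OF f]] by simp
    from mean_and_False[OF this]
      mean_and[OF mean_real_fun[OF f] mean_and[OF mean_continuous[OF f], of _ False]]
    show ?thesis by simp
  next
    case False
    then show ?thesis
      using mean_real_fun[OF f] mean_continuous[OF f]
      by (auto simp: mean_def pand_def pimp_def pnot_def)
  qed
  have e: "mean (V @ []) (\<^bold>\<forall>e:\<one>. rpos e \<^bold>\<longrightarrow> (\<^bold>\<exists>f:\<one> \<rightarrow> \<one>. real_fun f \<^bold>\<and> continuous_on_unit f \<^bold>\<and> \<^bold>\<not> G f \<^bold>\<and>
           (\<^bold>\<forall>x:\<one>. unit_interval x \<^bold>\<longrightarrow> rdist_less (f \<cdot> x) (g \<cdot> x) e))) False"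
  proof (rule mean_all_counterexample[OF C1_elts[OF one]])
    fix U e assume "den (U @ V @ []) e \<one> (C1 one_seq)"
    then have "mean (U @ V @ []) (rpos e) True"
      using mean_rpos[of "U @ V @ []" e one_seq] one by (simp add: dn1_def nrpos_iff)
    from mean_imp[OF this mean_ex11[OF no]]
    show "mean (U @ V @ []) (rpos e \<^bold>\<longrightarrow> (\<^bold>\<exists>f:\<one> \<rightarrow> \<one>. real_fun f \<^bold>\<and> continuous_on_unit f \<^bold>\<and> \<^bold>\<not> G f \<^bold>\<and>
           (\<^bold>\<forall>x:\<one>. unit_interval x \<^bold>\<longrightarrow> rdist_less (f \<cdot> x) (g \<cdot> x) e))) False"
      by simp
  qed
  from mean_imp[OF mean_and[OF mean_real_fun[OF g] mean_continuous[OF g]] e]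
  show "mean (V @ []) (real_fun g \<^bold>\<and> continuous_on_unit g \<^bold>\<longrightarrow> (\<^bold>\<forall>e:\<one>. rpos e \<^bold>\<longrightarrow>
        (\<^bold>\<exists>f:\<one> \<rightarrow> \<one>. real_fun f \<^bold>\<and> continuous_on_unit f \<^bold>\<and> \<^bold>\<not> G f \<^bold>\<and>
           (\<^bold>\<forall>x:\<one>. unit_interval x \<^bold>\<longrightarrow> rdist_less (f \<cdot> x) (g \<cdot> x) e)))) False"
    by (simp add: nreal_fun_takagi ncontinuous_takagi)
qed

theorem theorem4p2:
  shows "\<not> Z2\<omega>_IND0 \<turnstile> somewhere_differentiable ACG \<and>
         \<not> Z2\<omega>_IND0 \<turnstile> somewhere_differentiable ACGstar \<and>
         \<not> Z2\<omega>_IND0 \<turnstile> complement_dense ACG \<and>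
         \<not> Z2\<omega>_IND0 \<turnstile> complement_dense ACGstar"
proof -
  have AC: "\<exists>V. AC f X = AC_wrt V X" and ACstar: "\<exists>V. ACstar f X = AC_wrt V X" for f X
    by (auto simp: AC_def ACstar_def)
  have "mean W (ACG f) True" "mean W (ACGstar f) True"
    if "dn11 W f \<Phi>" "nreal_fun \<Phi>" "ncontinuous \<Phi>" for W f \<Phi>
    unfolding ACG_def ACGstar_def by (rule mean_generalised[OF AC that], rule mean_generalised[OF ACstar that])
  then show ?thesis
    by (intro conjI not_provable_somewhere_differentiable not_provable_complement_dense)
qed

end
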